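(* Let $\phi$ be a $\mathsf{C\text{-}RASP}_+$ program with precision $p$, depth $L$ and size $d$. There exists a fixed-precision transformer $T$ with precision $O(p)$, depth $O(L)$ and hidden dimension $O(d)$ which simulates $\phi$.
   Context: $\mathsf{C\text{-}RASP}_+$ formulas over a finite alphabet $\Sigma$: $\phi ::= \sigma \mid \neg\phi \mid \phi_1\wedge\phi_2 \mid \sum_{t}\alpha_t t\sim k$, terms $t ::= \#[\phi] \mid c$, with $\alpha_t,k,c\in\mathbb N$ and ${\sim}\in\{\ge,>,=,<,\le\}$; $w,i\models\sigma$ iff $w_i=\sigma$; $\#[\phi]$ evaluates at $(w,i)$ to $|\{j\le i: w,j\models\phi\}|$. Programs are straight-line (DAG) sequences; size counts symbols with constants in binary and references to earlier lines as 1; depth counts nesting of $\#$; precision is the number of bits of the largest constant. Fixed-precision transformer: with $\mathbb F=\mathbb F_{p,s}=\{m2^{-s}: m\in\mathbb Z, -2^{p-1}\le m<2^{p-1}\}$ and $\mathrm{round}(x)$ the greatest element of $\mathbb F$ that is $\le x$, it consists of $E:\Sigma\to\mathbb F^d$, $W_Q^{(\ell)},W_K^{(\ell)},W_V^{(\ell)},f^{(\ell)}:\mathbb F^d\to\mathbb F^d$, $W_{\mathrm{out}}:\mathbb F^d\to\mathbb F$; on input $u$: $h^{(0)}_i=E(u_i)$; per layer $q_i,k_i,v_i$ are the three maps applied to $h^{(\ell-1)}_i$, $s_{ij}=q_i\cdot k_j$, $B_i=\sum_{j\le i}\mathrm{round}(\exp(s_{ij}))$, $\alpha_{ij}=\mathrm{round}(\mathrm{round}(\exp(s_{ij}))/B_i)$,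 $c_i=\mathrm{round}(\sum_{j\le i}\alpha_{ij}v_j)$, $h^{(\ell)}_i=f^{(\ell)}(c_i+h^{(\ell-1)}_i)$; output at position $i$ is $W_{\mathrm{out}}(h^{(L)}_i)$. $T$ simulates $\phi$ if for all $w\in\Sigma^*$ and positions $i$ of $w$: the output of $T$ on $\texttt{<BOS>}\cdot w$ (a special beginning-of-sequence symbol prepended) at the position of $w_i$ is $>0$ iff $w,i\models\phi$. *)

theory Defs
  imports Complex_Main
begin

datatype cmp = CGe | CGt | CEq | CLt | CLe

fun cmp_rel :: "cmp \<Rightarrow> nat \<Rightarrow> nat \<Rightarrow> bool" where
  "cmp_rel CGe x k = (x \<ge> k)"
| "cmp_rel CGt x k = (x > k)"
| "cmp_rel CEq x k = (x = k)"
| "cmp_rel CLt x k = (x < k)"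
| "cmp_rel CLe x k = (x \<le> k)"

text \<open>A line of a straight-line program. \<open>Ref k\<close> refers to (the formula of) the earlier
line number \<open>k\<close>. \<open>Lin s c k\<close> is the comparison \<open>\<Sum>\<^sub>t \<alpha>\<^sub>t t \<sim> k\<close>, where \<open>s\<close> is the
list of pairs (coefficient, term).\<close>
datatype 'a cform =
    Sym 'a
  | Ref nat
  | Neg "'a cform"
  | Conj "'a cform" "'a cform"
  | Lin "'a lsum" cmp nat
and 'a cterm = Cnt "'a cform" | CConst nat
and 'a lsum = LNil | LCons nat "'a cterm" "'a lsum"

text \<open>Semantics: positions are 0-based, \<open>env k i\<close> is the truth value of line \<open>k\<close> at position \<open>i\<close>.\<close>
primrec holds :: "(nat \<Rightarrow> nat \<Rightarrow> bool) \<Rightarrow> 'a list \<Rightarrow> 'a cform \<Rightarrow> nat \<Rightarrow> bool"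
and tval :: "(nat \<Rightarrow> nat \<Rightarrow> bool) \<Rightarrow> 'a list \<Rightarrow> 'a cterm \<Rightarrow> nat \<Rightarrow> nat"
and sval :: "(nat \<Rightarrow> nat \<Rightarrow> bool) \<Rightarrow> 'a list \<Rightarrow> 'a lsum \<Rightarrow> nat \<Rightarrow> nat" where
  "holds env w (Sym a) i = (w ! i = a)"
| "holds env w (Ref k) i = env k i"
| "holds env w (Neg f) i = (\<not> holds env w f i)"
| "holds env w (Conj f g) i = (holds env w f i \<and> holds env w g i)"
| "holds env w (Lin s c k) i = cmp_rel c (sval env w s i) k"
| "tval env w (Cnt f) i = card {j. j \<le> i \<and> holds env w f j}"
| "tval env w (CConst c) i = c"
| "sval env w LNil i = 0"
| "sval env w (LCons a t s) i = a * tval env w t i + sval env w s i"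

definition penv :: "'a cform list \<Rightarrow> 'a list \<Rightarrow> nat \<Rightarrow> nat \<Rightarrow> bool" where
  "penv P w = foldl (\<lambda>e k. e(k := holds e w (P ! k))) (\<lambda>_ _. False) [0..<length P]"

definition models :: "'a cform list \<Rightarrow> 'a list \<Rightarrow> nat \<Rightarrow> bool" where
  "models P w i = penv P w (length P - 1) i"

primrec frefs :: "'a cform \<Rightarrow> nat set"
and trefs :: "'a cterm \<Rightarrow> nat set"
and srefs :: "'a lsum \<Rightarrow> nat set" where
  "frefs (Sym a) = {}"
| "frefs (Ref k) = {k}"
| "frefs (Neg f) = frefs f"
| "frefs (Conj f g) = frefs f \<union> frefs g"
| "frefs (Lin s c k) = srefs s"
| "trefs (Cnt f) = frefs f"
| "trefs (CConst c) = {}"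
| "srefs LNil = {}"
| "srefs (LCons a t s) = trefs t \<union> srefs s"

definition wf_prog :: "'a cform list \<Rightarrow> bool" where
  "wf_prog P \<longleftrightarrow> P \<noteq> [] \<and> (\<forall>k<length P. \<forall>r\<in>frefs (P ! k). r < k)"

fun bitlen :: "nat \<Rightarrow> nat" where
  "bitlen n = (if n \<le> 1 then 1 else 1 + bitlen (n div 2))"

primrec fsize :: "'a cform \<Rightarrow> nat"
and tsize :: "'a cterm \<Rightarrow> nat"
and ssize :: "'a lsum \<Rightarrow> nat" where
  "fsize (Sym a) = 1"
| "fsize (Ref k) = 1"
| "fsize (Neg f) = 1 + fsize f"
| "fsize (Conj f g) = 1 + fsize f + fsize g"
| "fsize (Lin s c k) = ssize s + 1 + bitlen k"
| "tsize (Cnt f) = 1 + fsize f"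
| "tsize (CConst c) = bitlen c"
| "ssize LNil = 0"
| "ssize (LCons a t s) = bitlen a + 1 + tsize t + 1 + ssize s"

definition psize :: "'a cform list \<Rightarrow> nat" where
  "psize P = sum_list (map fsize P)"

primrec fdepth :: "(nat \<Rightarrow> nat) \<Rightarrow> 'a cform \<Rightarrow> nat"
and tdepth :: "(nat \<Rightarrow> nat) \<Rightarrow> 'a cterm \<Rightarrow> nat"
and sdepth :: "(nat \<Rightarrow> nat) \<Rightarrow> 'a lsum \<Rightarrow> nat" where
  "fdepth D (Sym a) = 0"
| "fdepth D (Ref k) = D k"
| "fdepth D (Neg f) = fdepth D f"
| "fdepth D (Conj f g) = max (fdepth D f) (fdepth D g)"
| "fdepth D (Lin s c k) = sdepth D s"
| "tdepth D (Cnt f) = 1 + fdepth D f"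
| "tdepth D (CConst c) = 0"
| "sdepth D LNil = 0"
| "sdepth D (LCons a t s) = max (tdepth D t) (sdepth D s)"

definition line_depths :: "'a cform list \<Rightarrow> nat \<Rightarrow> nat" where
  "line_depths P = foldl (\<lambda>D k. D(k := fdepth D (P ! k))) (\<lambda>_. 0) [0..<length P]"

definition pdepth :: "'a cform list \<Rightarrow> nat" where
  "pdepth P = Max (insert 0 (line_depths P ` {..<length P}))"

primrec fconsts :: "'a cform \<Rightarrow> nat set"
and tconsts :: "'a cterm \<Rightarrow> nat set"
and sconsts :: "'a lsum \<Rightarrow> nat set" where
  "fconsts (Sym a) = {}"
| "fconsts (Ref k) = {}"
| "fconsts (Neg f) = fconsts f"
| "fconsts (Conj f g) = fconsts f \<union> fconsts g"
| "fconsts (Lin s c k) = insert k (sconsts s)"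
| "tconsts (Cnt f) = fconsts f"
| "tconsts (CConst c) = {c}"
| "sconsts LNil = {}"
| "sconsts (LCons a t s) = insert a (tconsts t \<union> sconsts s)"

definition pprec :: "'a cform list \<Rightarrow> nat" where
  "pprec P = bitlen (Max (insert 0 (\<Union>f\<in>set P. fconsts f)))"

definition inF :: "nat \<Rightarrow> nat \<Rightarrow> real \<Rightarrow> bool" where
  "inF p s x \<longleftrightarrow> (\<exists>m::int. x = of_int m / 2 ^ s \<and> - (2 ^ (p - 1)) \<le> m \<and> m < 2 ^ (p - 1))"

definition Fvec :: "nat \<Rightarrow> nat \<Rightarrow> nat \<Rightarrow> real list \<Rightarrow> bool" where
  "Fvec p s d v \<longleftrightarrow> length v = d \<and> (\<forall>x\<in>set v. inF p s x)"

definition fmin :: "nat \<Rightarrow> nat \<Rightarrow> real" where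
  "fmin p s = - ((2::real) ^ (p - 1)) / 2 ^ s"

definition fmax :: "nat \<Rightarrow> nat \<Rightarrow> real" where
  "fmax p s = ((2::real) ^ (p - 1) - 1) / 2 ^ s"

text \<open>Greatest element of F that is \<open>\<le> x\<close> (saturating at the minimum of F if none exists).\<close>
definition rnd :: "nat \<Rightarrow> nat \<Rightarrow> real \<Rightarrow> real" where
  "rnd p s x = max (fmin p s) (min (fmax p s) (of_int \<lfloor>x * 2 ^ s\<rfloor> / 2 ^ s))"

definition dotp :: "nat \<Rightarrow> real list \<Rightarrow> real list \<Rightarrow> real" where
  "dotp d q k = (\<Sum>l<d. q ! l * k ! l)"

type_synonym layer =
  "(real list \<Rightarrow> real list) \<times> (real list \<Rightarrow> real list) \<times> (real list \<Rightarrow> real list) \<times> (real list \<Rightarrow> real list)"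

text \<open>Input tokens: \<open>None\<close> is \<open><BOS>\<close>, \<open>Some a\<close> is the letter \<open>a\<close>.\<close>
record 'a transformer =
  tprec :: nat
  tfrac :: nat
  tdim :: nat
  temb :: "'a option \<Rightarrow> real list"
  tlayers :: "layer list"
  tout :: "real list \<Rightarrow> real"

definition tdepth_of :: "'a transformer \<Rightarrow> nat" where
  "tdepth_of T = length (tlayers T)"

definition layer_step :: "nat \<Rightarrow> nat \<Rightarrow> nat \<Rightarrow> layer \<Rightarrow> (nat \<Rightarrow> real list) \<Rightarrow> nat \<Rightarrow> real list" where
  "layer_step p s d L H i = (case L of (WQ, WK, WV, f) \<Rightarrow>
     let q = WQ (H i);
         e = (\<lambda>j. rnd p s (exp (dotp d q (WK (H j)))));
         B = (\<Sum>j\<le>i. e j);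
         a = (\<lambda>j. rnd p s (e j / B));
         c = map (\<lambda>l. rnd p s (\<Sum>j\<le>i. a j * (WV (H j) ! l))) [0..<d]
     in f (map2 (+) c (H i)))"

definition hidden :: "'a transformer \<Rightarrow> 'a option list \<Rightarrow> nat \<Rightarrow> real list" where
  "hidden T u = foldl (\<lambda>H L. layer_step (tprec T) (tfrac T) (tdim T) L H)
                  (\<lambda>i. temb T (u ! i)) (tlayers T)"

definition toutput :: "'a transformer \<Rightarrow> 'a option list \<Rightarrow> nat \<Rightarrow> real" where
  "toutput T u i = tout T (hidden T u i)"

definition wf_transformer :: "'a transformer \<Rightarrow> bool" where
  "wf_transformer T \<longleftrightarrow>
     (let p = tprec T; s = tfrac T; d = tdim T in
       p \<ge> 1 \<and>
       (\<forall>a. Fvec p s d (temb T a)) \<and>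
       (\<forall>(WQ, WK, WV, f) \<in> set (tlayers T).
          (\<forall>v. Fvec p s d v \<longrightarrow> Fvec p s d (WQ v) \<and> Fvec p s d (WK v) \<and> Fvec p s d (WV v)) \<and>
          (\<forall>v. length v = d \<longrightarrow> Fvec p s d (f v))) \<and>
       (\<forall>v. Fvec p s d v \<longrightarrow> inF p s (tout T v)))"

definition simulates :: "'a transformer \<Rightarrow> 'a cform list \<Rightarrow> bool" where
  "simulates T P \<longleftrightarrow>
     (\<forall>w i. i < length w \<longrightarrow>
        (toutput T (None # map Some w) (Suc i) > 0 \<longleftrightarrow> models P w i))"

end

theory Submission
  imports Defs
begin

text \<open>
  A transformer layer serves as a family of threshold tests. Scores are either exactly \<open>0\<close> or so
  negative that the rounded exponential vanishes, and \<open><BOS>\<close> always has score \<open>0\<close>. All matching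
  positions then get the same weight, which is positive iff at most \<open>2 ^ s\<close> positions match, and
  because rounding goes downwards a coordinate of the attention result is negative iff the sum of
  the matching values is.

  The linear comparisons of a program become thresholds on weighted counts. They are monotone along a
  word, so a word splits into phases on which all thresholds found so far are constant, and with
  constants below \<open>K = 2 ^ p\<close> only the first \<open>O(K)\<close> positions of each letter in each phase matter.

  If the depth is at most \<open>2 ^ p\<close>, then over a fixed alphabet there are only \<open>2 ^ O(p)\<close> phases, and one
  layer can test all comparisons of a nesting level at once on the positions that matter. Otherwise
  the size \<open>d\<close> is at least \<open>2 ^ p\<close>; then \<open>O(L)\<close> batches of \<open>d / 2 ^ p\<close> comparisons are processed one after
  the other, small enough for reading counts in unary, and the counts of up to \<open>2 d\<close> phases are
  summed along a tree of height four, whose inner nodes are the positions at which a new group of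
  phases starts.
\<close>

section \<open>Layers as threshold tests\<close>

text \<open>The precision counts bits only; the scale \<open>s\<close> is free. So the fan-out
  \<open>2 ^ s\<close> may exceed \<open>2 ^ p\<close>, but a larger \<open>s\<close> shrinks all
  numbers, and the score \<open>- s\<close> that makes an exponential vanish must then be collected
  from many coordinates. Fan-out is paid for in dimension, and this trade-off shapes both cases. The
  obvious bound on the number of phases, one more than the number of thresholds, is linear in
  \<open>d\<close> and would call for a fan-out beyond \<open>2 ^ O(p)\<close>. A bound polynomial
  in the nesting depth rescues small depth: \<open>s = O(p)\<close> with precision
  \<open>2 * s\<close> suffices. For larger depth the fan-out has to be cut instead. Adding partial
  sums along a tree needs their values and not just one sign, and a value up to \<open>2 * K\<close>
  takes that many boolean coordinates per comparison. Batches keep this within \<open>O(d)\<close>.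
  They add at most \<open>2 * 2 ^ p\<close> to the one batch per level, which is \<open>O(L)\<close>
  exactly because the depth is at least \<open>2 ^ p\<close>.\<close>

datatype 'q key = KAll | KNone | KCls 'q

fun matches :: "'q \<Rightarrow> 'q key \<Rightarrow> bool" where
  "matches q KAll = True"
| "matches q KNone = False"
| "matches q (KCls x) = (x = q)"

type_synonym ('st, 'q, 'v) mlayer =
  "('st \<Rightarrow> 'q) \<times> ('st \<Rightarrow> 'q key) \<times> ('st \<Rightarrow> 'v \<Rightarrow> int) \<times> ('st \<Rightarrow> ('v \<Rightarrow> bool) \<Rightarrow> 'st)"

text \<open>
  A layer of an abstract machine with states \<open>'st\<close>: a query class, a key, an integer vector of values
  and the next state as a function of the signs of the attended value sums. Transformer layers can
  only see these signs, and only as long as at most \<open>2 ^ s\<close> positions are attended.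
\<close>

definition attended :: "('st \<Rightarrow> 'q) \<Rightarrow> ('st \<Rightarrow> 'q key) \<Rightarrow> (nat \<Rightarrow> 'st) \<Rightarrow> nat \<Rightarrow> nat set" where
  "attended qc kc H i = {j. j \<le> i \<and> matches (qc (H i)) (kc (H j))}"

fun mstep :: "nat \<Rightarrow> 'v set \<Rightarrow> ('st, 'q, 'v) mlayer \<Rightarrow> (nat \<Rightarrow> 'st) \<Rightarrow> nat \<Rightarrow> 'st" where
  "mstep s V (qc, kc, vl, nx) H i =
     nx (H i) (\<lambda>v. v \<in> V \<and> card (attended qc kc H i) \<le> 2 ^ s \<and>
                    (\<Sum>j\<in>attended qc kc H i. vl (H j) v) < 0)"

fun mlayer_ok :: "nat \<Rightarrow> 'q set \<Rightarrow> 'v set \<Rightarrow> 'st set \<Rightarrow> ('st, 'q, 'v) mlayer \<Rightarrow> bool" where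
  "mlayer_ok p Q V VS (qc, kc, vl, nx) \<longleftrightarrow>
     (\<forall>\<sigma>\<in>VS. qc \<sigma> \<in> Q \<and> set_key (kc \<sigma>) \<subseteq> Q \<and>
        (\<forall>v\<in>V. \<bar>vl \<sigma> v\<bar> < 2 ^ (p - 1)) \<and> (\<forall>b. nx \<sigma> b \<in> VS))"

definition mrun :: "nat \<Rightarrow> 'v set \<Rightarrow> ('st, 'q, 'v) mlayer list \<Rightarrow> (nat \<Rightarrow> 'st) \<Rightarrow> nat \<Rightarrow> 'st" where
  "mrun s V Ls H = foldl (\<lambda>H L. mstep s V L H) H Ls"

lemma mrun_append: "mrun s V (Ls @ Ms) H = mrun s V Ms (mrun s V Ls H)"
  by (simp add: mrun_def)

lemma mrun_Nil [simp]: "mrun s V [] H = H"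
  by (simp add: mrun_def)

lemma mrun_Cons [simp]: "mrun s V (L # Ls) H = mrun s V Ls (mstep s V L H)"
  by (simp add: mrun_def)

text \<open>Rounding down is asymmetric: a negative number stays negative, while a small positive
  one collapses to \<open>0\<close>. So negativity survives rounding without any lower bound on the
  magnitude.\<close>

lemma rnd_neg_iff:
  assumes "p \<ge> 2"
  shows "rnd p s x < 0 \<longleftrightarrow> x < 0"
proof -
  have 1: "fmin p s < 0" by (simp add: fmin_def)
  have "(2::real) ^ (p - 1) \<ge> 2 ^ 1" using assms by (intro power_increasing) auto
  then have 2: "fmax p s > 0" by (simp add: fmax_def)
  have "of_int \<lfloor>x * 2 ^ s\<rfloor> / 2 ^ s < (0::real) \<longleftrightarrow> \<lfloor>x * 2 ^ s\<rfloor> < 0"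
    by (simp add: divide_less_0_iff)
  also have "\<dots> \<longleftrightarrow> x < 0"
    by (simp add: mult_less_0_iff)
  finally show ?thesis using 1 2 unfolding rnd_def by (auto simp: max_def min_def)
qed

lemma rnd_0:
  assumes "p \<ge> 2"
  shows "rnd p s 0 = 0"
proof -
  have "fmin p s < 0" by (simp add: fmin_def)
  moreover have "(2::real) ^ (p - 1) \<ge> 1" by simp
  then have "fmax p s \<ge> 0" by (simp add: fmax_def)
  ultimately show ?thesis unfolding rnd_def by (simp add: max_def min_def)
qed

lemma rnd_small:
  assumes "p \<ge> 2" "0 \<le> x" "x * 2 ^ s < 1"
  shows "rnd p s x = 0"
proof -
  have "\<lfloor>x * 2 ^ s\<rfloor> = 0" using assms by (simp add: floor_eq_iff)
  then show ?thesis using rnd_0[OF assms(1), of s] unfolding rnd_def by simp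
qed

lemma rnd_pos:
  assumes "p \<ge> 2" "x * 2 ^ s \<ge> 1"
  shows "rnd p s x > 0"
proof -
  have "(2::real) ^ (p - 1) \<ge> 2 ^ 1" using assms by (intro power_increasing) auto
  then have 2: "fmax p s > 0" by (simp add: fmax_def)
  have "\<lfloor>x * 2 ^ s\<rfloor> \<ge> 1" using assms by (simp add: le_floor_iff)
  then have "of_int \<lfloor>x * 2 ^ s\<rfloor> / 2 ^ s > (0::real)" by simp
  with 2 show ?thesis unfolding rnd_def by (auto simp: max_def min_def)
qed

text \<open>Since \<open>2 / exp 1 < 1\<close>, a score of \<open>- s\<close> already pushes the
  exponential below the smallest positive element \<open>1 / 2 ^ s\<close>.\<close>

lemma exp_times_power_less_one:
  assumes "s \<ge> 1" "x \<le> - real s"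
  shows "exp x * 2 ^ s < 1"
proof -
  have "exp x * 2 ^ s \<le> exp (- real s) * 2 ^ s" using assms by simp
  also have "\<dots> = (2 / exp 1) ^ s"
    by (simp add: exp_minus power_divide divide_simps flip: exp_of_nat_mult)
  also have "\<dots> < 1"
  proof -
    have "2 / exp 1 < (1::real)"
      using exp_lower_Taylor_quadratic[of "1::real"] by simp
    then show ?thesis using assms(1) by (simp add: power_less_one_iff)
  qed
  finally show ?thesis .
qed


text \<open>All attended positions have the same rounded exponential, so their common weight is
  \<open>1 / card A\<close> rounded down, and a positive common factor does not change the sign of a
  sum. The last clause keeps the coordinates that carry the state undisturbed by the residual
  addition.\<close>

lemma layer_step_threshold:
  assumes p: "p \<ge> 2" and s: "s \<ge> 1"
    and A: "A \<subseteq> {..i}"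
    and in0: "\<And>j. j \<in> A \<Longrightarrow> dotp d (WQ (H i)) (WK (H j)) = 0"
    and out: "\<And>j. j \<le> i \<Longrightarrow> j \<notin> A \<Longrightarrow> dotp d (WQ (H i)) (WK (H j)) \<le> - real s"
  obtains c where "layer_step p s d (WQ, WK, WV, f) H i = f (map2 (+) c (H i))"
    "length c = d"
    "\<And>l. l < d \<Longrightarrow> c ! l < 0 \<longleftrightarrow> card A \<le> 2 ^ s \<and> (\<Sum>j\<in>A. WV (H j) ! l) < 0"
    "\<And>l. l < d \<Longrightarrow> (\<And>j. j \<in> A \<Longrightarrow> WV (H j) ! l = 0) \<Longrightarrow> c ! l = 0"
proof -
  define e where "e j = rnd p s (exp (dotp d (WQ (H i)) (WK (H j))))" for j
  define B where "B = (\<Sum>j\<le>i. e j)"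
  define a where "a j = rnd p s (e j / B)" for j
  define c where "c = map (\<lambda>l. rnd p s (\<Sum>j\<le>i. a j * (WV (H j) ! l))) [0..<d]"
  \<comment> \<open>If \<open>s\<close> is large compared with \<open>p\<close>, then
    \<open>1\<close> exceeds \<open>fmax\<close> and \<open>E0\<close> saturates below
    \<open>1\<close>. This is harmless, as \<open>E0\<close> cancels in
    \<open>e j / B\<close>.\<close>
  define E0 where "E0 = rnd p s 1"
  define a0 where "a0 = rnd p s (1 / real (card A))"
  have finA: "finite A" using A finite_subset by blast
  have E0: "E0 > 0" unfolding E0_def by (rule rnd_pos[OF p]) simp
  have e_in: "e j = E0" if "j \<in> A" for j
    using in0[OF that] by (simp add: e_def E0_def)
  have e_out: "e j = 0" if "j \<le> i" "j \<notin> A" for j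
    unfolding e_def using exp_times_power_less_one[OF s out[OF that]] by (intro rnd_small[OF p]) auto
  have "B = (\<Sum>j\<in>A. e j)"
    unfolding B_def using A e_out by (intro sum.mono_neutral_right) auto
  then have B: "B = real (card A) * E0" using e_in by simp
  have a_in: "a j = a0" if "j \<in> A" for j
    using that E0 B e_in[OF that] by (simp add: a_def a0_def)
  have a_out: "a j = 0" if "j \<le> i" "j \<notin> A" for j
    using e_out[OF that] rnd_0[OF p] by (simp add: a_def)
  have sum_eq: "(\<Sum>j\<le>i. a j * (WV (H j) ! l)) = a0 * (\<Sum>j\<in>A. WV (H j) ! l)" for l
  proof -
    have "(\<Sum>j\<le>i. a j * (WV (H j) ! l)) = (\<Sum>j\<in>A. a j * (WV (H j) ! l))"
      using A a_out by (intro sum.mono_neutral_right) auto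
    also have "\<dots> = a0 * (\<Sum>j\<in>A. WV (H j) ! l)"
      using a_in by (simp add: sum_distrib_left)
    finally show ?thesis .
  qed
  have a0: "a0 > 0" if "card A \<le> 2 ^ s" "card A > 0"
  proof -
    have "real (card A) \<le> 2 ^ s" using that(1) by (metis of_nat_le_iff of_nat_numeral of_nat_power)
    then show ?thesis unfolding a0_def using that by (intro rnd_pos[OF p]) (simp add: field_simps)
  qed
  have a0': "a0 = 0" if "card A > 2 ^ s"
  proof -
    have *: "real (card A) > 2 ^ s" using that by (metis of_nat_less_iff of_nat_numeral of_nat_power)
    moreover have "(0::real) < 2 ^ s" by simp
    ultimately have "real (card A) > 0" by linarith
    with * show ?thesis unfolding a0_def by (intro rnd_small[OF p]) (auto simp: field_simps)
  qed
  show ?thesis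
  proof
    show "layer_step p s d (WQ, WK, WV, f) H i = f (map2 (+) c (H i))"
      by (simp add: layer_step_def Let_def c_def a_def B_def e_def)
    show "length c = d" by (simp add: c_def)
    fix l assume l: "l < d"
    have cl: "c ! l = rnd p s (a0 * (\<Sum>j\<in>A. WV (H j) ! l))"
      using l sum_eq by (simp add: c_def)
    show "c ! l < 0 \<longleftrightarrow> card A \<le> 2 ^ s \<and> (\<Sum>j\<in>A. WV (H j) ! l) < 0"
    proof (cases "card A = 0")
      case True
      then have "A = {}" using finA by simp
      then show ?thesis unfolding cl rnd_neg_iff[OF p] by simp
    next
      case False
      then show ?thesis unfolding cl rnd_neg_iff[OF p]
        using a0 a0' by (cases "card A \<le> 2 ^ s") (auto simp: mult_less_0_iff)
    qed
    show "c ! l = 0" if "\<And>j. j \<in> A \<Longrightarrow> WV (H j) ! l = 0"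
      unfolding cl using that rnd_0[OF p] by simp
  qed
qed

section \<open>Encoding machine states, query classes and keys as vectors over F\<close>

lemma dotp_block_conflict:
  fixes \<eta> :: real and X Y :: "nat \<Rightarrow> bool"
  assumes len: "m * R \<le> d"
  defines "q \<equiv> map (\<lambda>l. if l < m * R \<and> X (l div R) then \<eta> else 0) [0..<d]"
    and "k \<equiv> map (\<lambda>l. if l < m * R \<and> Y (l div R) then - \<eta> else 0) [0..<d]"
  shows "\<not> (\<exists>b<m. X b \<and> Y b) \<Longrightarrow> dotp d q k = 0"
    and "\<exists>b<m. X b \<and> Y b \<Longrightarrow> dotp d q k \<le> - (real R * \<eta>\<^sup>2)"
proof -
  have dot: "dotp d q k = (\<Sum>l<d. if l < m * R \<and> X (l div R) \<and> Y (l div R) then - \<eta>\<^sup>2 else 0)"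
    unfolding dotp_def q_def k_def by (intro sum.cong) (auto simp: power2_eq_square)
  have div_less: "l div R < m" if "l < m * R" for l
    using that by (simp add: less_mult_imp_div_less)
  show "dotp d q k = 0" if "\<not> (\<exists>b<m. X b \<and> Y b)"
    unfolding dot using that div_less by (intro sum.neutral) auto
  show "dotp d q k \<le> - (real R * \<eta>\<^sup>2)" if conflict: "\<exists>b<m. X b \<and> Y b"
  proof -
    obtain b where b: "b < m" "X b" "Y b" using conflict by blast
    have "Suc b * R \<le> m * R" using b(1) by (intro mult_le_mono1) simp
    then have sub: "b * R + R \<le> m * R" by simp
    have in_block: "l div R = b" if "l \<in> {b * R..<b * R + R}" for l
      using that by (intro div_nat_eqI) (auto simp: algebra_simps)
    \<comment> \<open>No product is positive, so nothing cancels and the other blocks may be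
      dropped.\<close>
    have "dotp d q k \<le> (\<Sum>l\<in>{b * R..<b * R + R}. if l < m * R \<and> X (l div R) \<and> Y (l div R) then - \<eta>\<^sup>2 else 0)"
      unfolding dot
    proof -
      have "(\<Sum>l<d. if l < m * R \<and> X (l div R) \<and> Y (l div R) then - \<eta>\<^sup>2 else 0)
        = (\<Sum>l\<in>{b * R..<b * R + R}. if l < m * R \<and> X (l div R) \<and> Y (l div R) then - \<eta>\<^sup>2 else 0)
        + (\<Sum>l\<in>{..<d} - {b * R..<b * R + R}. if l < m * R \<and> X (l div R) \<and> Y (l div R) then - \<eta>\<^sup>2 else 0)"
        using sub len by (subst sum.subset_diff[of "{b * R..<b * R + R}"]) (auto simp: add.commute)
      moreover have "(\<Sum>l\<in>{..<d} - {b * R..<b * R + R}. if l < m * R \<and> X (l div R) \<and> Y (l div R) then - \<eta>\<^sup>2 else 0) \<le> 0"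
        by (intro sum_nonpos) auto
      ultimately show "(\<Sum>l<d. if l < m * R \<and> X (l div R) \<and> Y (l div R) then - \<eta>\<^sup>2 else 0)
        \<le> (\<Sum>l\<in>{b * R..<b * R + R}. if l < m * R \<and> X (l div R) \<and> Y (l div R) then - \<eta>\<^sup>2 else 0)"
        by linarith
    qed
    also have "\<dots> = (\<Sum>l\<in>{b * R..<b * R + R}. - \<eta>\<^sup>2)"
      using in_block b sub by (intro sum.cong) auto
    also have "\<dots> = - (real R * \<eta>\<^sup>2)" by simp
    finally show ?thesis .
  qed
qed

lemma bit_differs_below:
  fixes x y :: nat
  assumes "x < 2 ^ t" "y < 2 ^ t" "x \<noteq> y"
  shows "\<exists>b<t. bit x b \<noteq> bit y b"
proof (rule ccontr)
  assume "\<not> ?thesis"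
  then have "take_bit t x = take_bit t y"
    by (intro bit_eqI) (auto simp: bit_take_bit_iff)
  then show False using assms by (simp add: take_bit_nat_eq_self)
qed


text \<open>The first \<open>nC\<close> coordinates hold the state, the next \<open>nV\<close>
  receive the attended values. States vanish on the latter and values on the former, so the residual
  addition mixes nothing. Queries and keys use two blocks of \<open>R\<close> coordinates for each
  of the \<open>t\<close> bits of a class index; by \<open>gap\<close>, one block with entries of
  size \<open>2 ^ (p - 2) / 2 ^ s\<close> lowers the score to \<open>- s\<close>.\<close>

locale machine_encoding =
  fixes p s R t D nC nV :: nat
    and C :: "'c set" and V :: "'v set" and Q :: "'q set" and VS :: "'st set"
    and feat :: "'st \<Rightarrow> 'c \<Rightarrow> bool"
    and cix :: "'c \<Rightarrow> nat" and vix :: "'v \<Rightarrow> nat" and qix :: "'q \<Rightarrow> nat"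
  assumes p: "p \<ge> 2" and s: "s \<ge> 1" and t: "t \<ge> 1"
    and dim: "nC + nV \<le> D" "2 * t * R \<le> D"
    and gap: "real s \<le> real R * (2 ^ (p - 2) / 2 ^ s)\<^sup>2"
    and cix: "inj_on cix C" "cix ` C \<subseteq> {..<nC}"
    and vix: "inj_on vix V" "vix ` V \<subseteq> {..<nV}"
    and qix: "inj_on qix Q" "qix ` Q \<subseteq> {..<2 ^ t}"
    and feat: "\<And>\<sigma> \<tau>. \<sigma> \<in> VS \<Longrightarrow> \<tau> \<in> VS \<Longrightarrow> (\<And>c. c \<in> C \<Longrightarrow> feat \<sigma> c = feat \<tau> c) \<Longrightarrow> \<sigma> = \<tau>"
begin

definition \<eta> :: real where "\<eta> = 2 ^ (p - 2) / 2 ^ s"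

definition enc :: "'st \<Rightarrow> real list" where
  "enc \<sigma> = map (\<lambda>l. if \<exists>c\<in>C. cix c = l \<and> feat \<sigma> c then 1 / 2 ^ s else 0) [0..<D]"

definition dec :: "real list \<Rightarrow> 'st" where
  "dec x = (SOME \<sigma>. \<sigma> \<in> VS \<and> (\<forall>c\<in>C. feat \<sigma> c \<longleftrightarrow> x ! cix c \<noteq> 0))"

text \<open>
  Block \<open>2 b + v\<close> of a query is nonzero iff bit \<open>b\<close> of its class is not \<open>v\<close>, and of a key iff the bit
  is \<open>v\<close>. So all products are \<open>\<le> 0\<close>, and one differing bit already costs a whole block of \<open>R\<close> coordinates.
\<close>

definition qconf :: "'q \<Rightarrow> nat \<Rightarrow> bool" where
  "qconf q b \<longleftrightarrow> (odd b \<longleftrightarrow> \<not> bit (qix q) (b div 2))"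

fun kconf :: "'q key \<Rightarrow> nat \<Rightarrow> bool" where
  "kconf KAll b = False"
| "kconf KNone b = True"
| "kconf (KCls q) b = (odd b \<longleftrightarrow> bit (qix q) (b div 2))"

definition qvec :: "'q \<Rightarrow> real list" where
  "qvec q = map (\<lambda>l. if l < 2 * t * R \<and> qconf q (l div R) then \<eta> else 0) [0..<D]"

definition kvec :: "'q key \<Rightarrow> real list" where
  "kvec k = map (\<lambda>l. if l < 2 * t * R \<and> kconf k (l div R) then - \<eta> else 0) [0..<D]"

text \<open>The bound test inside puts the result into F for every argument, because well-formedness
  quantifies over all vectors and not only over encodings of reachable states.\<close>

definition vvec :: "('v \<Rightarrow> int) \<Rightarrow> real list" where
  "vvec g = map (\<lambda>l. if nC \<le> l \<and> l - nC \<in> vix ` V \<and> \<bar>g (inv_into V vix (l - nC))\<bar> < 2 ^ (p - 1)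
                 then of_int (g (inv_into V vix (l - nC))) / 2 ^ s else 0) [0..<D]"

fun layer_of :: "('st, 'q, 'v) mlayer \<Rightarrow> layer" where
  "layer_of (qc, kc, vl, nx) =
     (\<lambda>x. qvec (qc (dec x)), \<lambda>x. kvec (kc (dec x)), \<lambda>x. vvec (vl (dec x)),
      \<lambda>x. enc (nx (dec x) (\<lambda>v. v \<in> V \<and> x ! (nC + vix v) < 0)))"

definition trans_of ::
  "('a option \<Rightarrow> 'st) \<Rightarrow> ('st, 'q, 'v) mlayer list \<Rightarrow> ('st \<Rightarrow> bool) \<Rightarrow> 'a transformer" where
  "trans_of init Ls out = \<lparr>tprec = p, tfrac = s, tdim = D, temb = (\<lambda>a. enc (init a)),
     tlayers = map layer_of Ls, tout = (\<lambda>x. if out (dec x) then 1 / 2 ^ s else 0)\<rparr>"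

lemma inF_of_int: "\<bar>m\<bar> < 2 ^ (p - 1) \<Longrightarrow> inF p s (of_int m / 2 ^ s)"
  unfolding inF_def by (rule exI[of _ m]) auto

lemma two_le_power: "(2::int) \<le> 2 ^ (p - 1)"
  using power_increasing[of 1 "p - 1" "2::int"] p by simp

lemma inF_simps [simp]: "inF p s 0" "inF p s (1 / 2 ^ s)" "inF p s \<eta>" "inF p s (- \<eta>)"
proof -
  show "inF p s 0" using inF_of_int[of 0] by simp
  show "inF p s (1 / 2 ^ s)" using inF_of_int[of 1] two_le_power by simp
  have "(2::int) ^ (p - 2) < 2 ^ (p - 1)" using p by (intro power_strict_increasing) auto
  then show "inF p s \<eta>" "inF p s (- \<eta>)"
    using inF_of_int[of "2 ^ (p - 2)"] inF_of_int[of "- (2 ^ (p - 2))"] by (auto simp: \<eta>_def)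
qed

lemma Fvec_simps [simp]: "Fvec p s D (enc \<sigma>)" "Fvec p s D (qvec q)" "Fvec p s D (kvec k)" "Fvec p s D (vvec g)"
  by (auto simp: Fvec_def enc_def qvec_def kvec_def vvec_def inF_of_int)

lemma wf_trans_of: "wf_transformer (trans_of init Ls out)"
proof -
  have "case layer_of L of (WQ, WK, WV, f) \<Rightarrow>
      (\<forall>v. Fvec p s D v \<longrightarrow> Fvec p s D (WQ v) \<and> Fvec p s D (WK v) \<and> Fvec p s D (WV v)) \<and>
      (\<forall>v. length v = D \<longrightarrow> Fvec p s D (f v))" for L
    by (cases L) simp
  then show ?thesis using p by (simp add: wf_transformer_def trans_of_def Let_def)
qed

lemma cix_less: "c \<in> C \<Longrightarrow> cix c < nC" "c \<in> C \<Longrightarrow> cix c < D"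
  using cix(2) dim by auto

lemma vix_less: "v \<in> V \<Longrightarrow> nC + vix v < D"
  using vix(2) dim by fastforce

lemma enc_nth_cix: "c \<in> C \<Longrightarrow> enc \<sigma> ! cix c \<noteq> 0 \<longleftrightarrow> feat \<sigma> c"
  using cix_less(2) cix(1) by (auto simp: enc_def inj_on_def)

lemma enc_nth_high: "nC \<le> l \<Longrightarrow> l < D \<Longrightarrow> enc \<sigma> ! l = 0"
  using cix_less(1) by (fastforce simp: enc_def)

text \<open>Only the state coordinates are inspected, so a state can still be decoded after the
  attention result has been added.\<close>

lemma dec_eqI:
  assumes "\<sigma> \<in> VS" "\<And>c. c \<in> C \<Longrightarrow> x ! cix c = enc \<sigma> ! cix c"
  shows "dec x = \<sigma>"
  unfolding dec_def
proof (rule some_equality)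
  show "\<sigma> \<in> VS \<and> (\<forall>c\<in>C. feat \<sigma> c \<longleftrightarrow> x ! cix c \<noteq> 0)"
    using assms enc_nth_cix by auto
  show "\<tau> = \<sigma>" if "\<tau> \<in> VS \<and> (\<forall>c\<in>C. feat \<tau> c \<longleftrightarrow> x ! cix c \<noteq> 0)" for \<tau>
    using that assms enc_nth_cix by (intro feat) auto
qed

lemma dec_enc [simp]: "\<sigma> \<in> VS \<Longrightarrow> dec (enc \<sigma>) = \<sigma>"
  by (rule dec_eqI) auto

lemma conflict_iff:
  assumes "q \<in> Q" "set_key k \<subseteq> Q"
  shows "(\<exists>b<2 * t. qconf q b \<and> kconf k b) \<longleftrightarrow> \<not> matches q k"
proof (cases k)
  case KAll
  then show ?thesis by simp
next
  case KNone
  have "qconf q 0 \<or> qconf q 1" by (auto simp: qconf_def)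
  then show ?thesis using KNone t by (auto intro: exI[of _ 0] exI[of _ 1])
next
  case (KCls x)
  show ?thesis
  proof
    assume "\<exists>b<2 * t. qconf q b \<and> kconf k b"
    then show "\<not> matches q k" using KCls by (auto simp: qconf_def)
  next
    assume "\<not> matches q k"
    then have "qix x \<noteq> qix q" using KCls assms qix(1) by (auto simp: inj_on_def)
    moreover have "qix x < 2 ^ t" "qix q < 2 ^ t" using KCls assms qix(2) by auto
    ultimately obtain b where b: "b < t" "bit (qix x) b \<noteq> bit (qix q) b"
      using bit_differs_below by blast
    define b' where "b' = 2 * b + (if bit (qix x) b then 1 else 0)"
    have "b' < 2 * t" "b' div 2 = b" "odd b' \<longleftrightarrow> bit (qix x) b" using b(1) by (auto simp: b'_def)
    then show "\<exists>b<2 * t. qconf q b \<and> kconf k b"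
      using KCls b(2) by (intro exI[of _ b']) (auto simp: qconf_def)
  qed
qed

lemma dotp_vec:
  assumes "q \<in> Q" "set_key k \<subseteq> Q"
  shows "matches q k \<Longrightarrow> dotp D (qvec q) (kvec k) = 0"
    and "\<not> matches q k \<Longrightarrow> dotp D (qvec q) (kvec k) \<le> - real s"
  using dotp_block_conflict[OF dim(2), of "qconf q" "kconf k" \<eta>] conflict_iff[OF assms] gap
  unfolding qvec_def kvec_def \<eta>_def by auto

lemma layer_step_layer_of:
  assumes ok: "mlayer_ok p Q V VS L" and H: "\<And>j. j \<le> i \<Longrightarrow> G j \<in> VS"
    and G: "\<And>j. j \<le> i \<Longrightarrow> H j = enc (G j)"
  shows "layer_step p s D (layer_of L) H i = enc (mstep s V L G i)" "mstep s V L G i \<in> VS"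
proof -
  obtain qc kc vl nx where L: "L = (qc, kc, vl, nx)" by (cases L) auto
  define A where "A = attended qc kc G i"
  have A: "A \<subseteq> {..i}" by (auto simp: A_def attended_def)
  have ok': "qc (G j) \<in> Q" "set_key (kc (G j)) \<subseteq> Q" "v \<in> V \<Longrightarrow> \<bar>vl (G j) v\<bar> < 2 ^ (p - 1)"
    "nx (G j) b \<in> VS" if "j \<le> i" for j v b
    using ok H[OF that] unfolding L by auto
  have dG: "dec (H j) = G j" if "j \<le> i" for j using that G H by simp
  let ?WQ = "\<lambda>x. qvec (qc (dec x))" and ?WK = "\<lambda>x. kvec (kc (dec x))"
    and ?WV = "\<lambda>x. vvec (vl (dec x))"
    and ?f = "\<lambda>x. enc (nx (dec x) (\<lambda>v. v \<in> V \<and> x ! (nC + vix v) < 0))"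
  have 1: "dotp D (?WQ (H i)) (?WK (H j)) = 0" if "j \<in> A" for j
    using that dotp_vec(1)[OF ok'(1)[of i] ok'(2)[of j]] by (simp add: A_def attended_def dG)
  have 2: "dotp D (?WQ (H i)) (?WK (H j)) \<le> - real s" if "j \<le> i" "j \<notin> A" for j
    using that dotp_vec(2)[OF ok'(1)[of i] ok'(2)[of j]] by (simp add: A_def attended_def dG)
  obtain c where c: "layer_step p s D (?WQ, ?WK, ?WV, ?f) H i = ?f (map2 (+) c (H i))"
    "length c = D"
    "\<And>l. l < D \<Longrightarrow> c ! l < 0 \<longleftrightarrow> card A \<le> 2 ^ s \<and> (\<Sum>j\<in>A. ?WV (H j) ! l) < 0"
    "\<And>l. l < D \<Longrightarrow> (\<And>j. j \<in> A \<Longrightarrow> ?WV (H j) ! l = 0) \<Longrightarrow> c ! l = 0"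
    by (rule layer_step_threshold[OF p s A, where d = D and WQ = ?WQ and WK = ?WK and WV = ?WV
          and H = H and f = ?f]) (use 1 2 in auto)
  let ?x = "map2 (+) c (H i)"
  have len: "length (enc \<sigma>) = D" for \<sigma> by (simp add: enc_def)
  have x: "?x ! l = c ! l + enc (G i) ! l" if "l < D" for l
    using that c(2) len by (simp add: G)
  have dx: "dec ?x = G i"
  proof (rule dec_eqI)
    show "G i \<in> VS" using H by simp
    fix a assume a: "a \<in> C"
    have "c ! cix a = 0"
      using cix_less[OF a] by (intro c(4)) (auto simp: vvec_def)
    then show "?x ! cix a = enc (G i) ! cix a" using x cix_less(2)[OF a] by simp
  qed
  have bits: "(\<lambda>v. v \<in> V \<and> ?x ! (nC + vix v) < 0)
    = (\<lambda>v. v \<in> V \<and> card A \<le> 2 ^ s \<and> (\<Sum>j\<in>A. vl (G j) v) < 0)"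
  proof (intro ext conj_cong refl)
    fix v assume v: "v \<in> V"
    have "vvec (vl (dec (H j))) ! (nC + vix v) = of_int (vl (G j) v) / 2 ^ s" if "j \<in> A" for j
      using that A v vix_less[OF v] ok'(3)[of j v] dG[of j] vix(1) by (auto simp: vvec_def)
    then have "(\<Sum>j\<in>A. vvec (vl (dec (H j))) ! (nC + vix v)) = (\<Sum>j\<in>A. of_int (vl (G j) v) / 2 ^ s)"
      by (intro sum.cong) auto
    also have "\<dots> = of_int (\<Sum>j\<in>A. vl (G j) v) / 2 ^ s"
      by (simp add: sum_divide_distrib)
    finally have "?x ! (nC + vix v) < 0 \<longleftrightarrow> card A \<le> 2 ^ s \<and> of_int (\<Sum>j\<in>A. vl (G j) v) / (2::real) ^ s < 0"
      using x[OF vix_less[OF v]] c(3)[OF vix_less[OF v]] enc_nth_high[of "nC + vix v"] vix_less[OF v] by simp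
    also have "of_int (\<Sum>j\<in>A. vl (G j) v) / (2::real) ^ s < 0 \<longleftrightarrow> (\<Sum>j\<in>A. vl (G j) v) < 0"
      by (simp add: divide_less_0_iff del: of_int_sum)
    finally show "?x ! (nC + vix v) < 0 \<longleftrightarrow> card A \<le> 2 ^ s \<and> (\<Sum>j\<in>A. vl (G j) v) < 0" .
  qed
  show "layer_step p s D (layer_of L) H i = enc (mstep s V L G i)"
    using c(1) by (simp only: L layer_of.simps mstep.simps dx bits A_def)
  show "mstep s V L G i \<in> VS" using ok'(4)[of i] by (simp add: L)
qed

lemma foldl_layer_step:
  assumes "\<And>L. L \<in> set Ls \<Longrightarrow> mlayer_ok p Q V VS L" "\<And>j. j \<le> i \<Longrightarrow> G j \<in> VS"
    and "\<And>j. j \<le> i \<Longrightarrow> H j = enc (G j)"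
  shows "foldl (\<lambda>H L. layer_step p s D L H) H (map layer_of Ls) i = enc (mrun s V Ls G i) \<and> mrun s V Ls G i \<in> VS"
  using assms
proof (induction Ls arbitrary: G H)
  case Nil
  then show ?case by simp
next
  case (Cons L Ls)
  have ok: "mlayer_ok p Q V VS L" using Cons.prems(1) by simp
  have "layer_step p s D (layer_of L) H j = enc (mstep s V L G j) \<and> mstep s V L G j \<in> VS" if "j \<le> i" for j
    using layer_step_layer_of[OF ok, of j G H] that Cons.prems(2,3) by auto
  then show ?case using Cons.prems(1) by (simp, intro Cons.IH) auto
qed

lemma toutput_trans_of:
  assumes "\<And>L. L \<in> set Ls \<Longrightarrow> mlayer_ok p Q V VS L" "\<And>a. init a \<in> VS"
  shows "toutput (trans_of init Ls out) u i > 0 \<longleftrightarrow> out (mrun s V Ls (\<lambda>i. init (u ! i)) i)"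
  using foldl_layer_step[OF assms(1), of Ls i "\<lambda>i. init (u ! i)" "\<lambda>i. enc (init (u ! i))"] assms(2)
  by (simp add: toutput_def hidden_def trans_of_def)

end

lemma machine_realizable:
  fixes C :: "'c set" and V :: "'v set" and Q :: "'q set" and VS :: "'st set"
    and feat :: "'st \<Rightarrow> 'c \<Rightarrow> bool" and init :: "'a option \<Rightarrow> 'st"
  assumes "p \<ge> 2" "s \<ge> 1" "t \<ge> 1" "card C + card V \<le> D" "2 * t * R \<le> D"
    and "real s \<le> real R * (2 ^ (p - 2) / 2 ^ s)\<^sup>2"
    and fin: "finite C" "finite V" "finite Q" and Q: "card Q \<le> 2 ^ t"
    and "\<And>\<sigma> \<tau>. \<sigma> \<in> VS \<Longrightarrow> \<tau> \<in> VS \<Longrightarrow> (\<And>c. c \<in> C \<Longrightarrow> feat \<sigma> c = feat \<tau> c) \<Longrightarrow> \<sigma> = \<tau>"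
    and ok: "\<And>L. L \<in> set Ls \<Longrightarrow> mlayer_ok p Q V VS L" "\<And>a. init a \<in> VS"
  shows "\<exists>T :: 'a transformer. wf_transformer T \<and> tprec T = p \<and> tdim T = D \<and> tdepth_of T = length Ls \<and>
    (\<forall>u i. toutput T u i > 0 \<longleftrightarrow> out (mrun s V Ls (\<lambda>i. init (u ! i)) i))"
proof -
  obtain cix :: "'c \<Rightarrow> nat" where cix: "bij_betw cix C {..<card C}"
    using ex_bij_betw_finite_nat[OF fin(1)] by (auto simp: atLeast0LessThan)
  obtain vix :: "'v \<Rightarrow> nat" where vix: "bij_betw vix V {..<card V}"
    using ex_bij_betw_finite_nat[OF fin(2)] by (auto simp: atLeast0LessThan)
  obtain qix :: "'q \<Rightarrow> nat" where qix: "bij_betw qix Q {..<card Q}"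
    using ex_bij_betw_finite_nat[OF fin(3)] by (auto simp: atLeast0LessThan)
  have "qix ` Q \<subseteq> {..<2 ^ t}" using qix Q by (auto simp: bij_betw_def)
  then interpret machine_encoding p s R t D "card C" "card V" C V Q VS feat cix vix qix
    using assms cix vix qix by unfold_locales (auto simp: bij_betw_def)
  have "toutput (trans_of init Ls out) u i > 0 \<longleftrightarrow> out (mrun s V Ls (\<lambda>i. init (u ! i)) i)" for u i
    using ok by (intro toutput_trans_of)
  then show ?thesis
    using wf_trans_of[of init Ls out]
    by (intro exI[of _ "trans_of init Ls out"]) (simp add: trans_of_def tdepth_of_def)
qed

section \<open>Monotone threshold systems and their phases\<close>

lemma card_low_rank:
  fixes X :: "'b::linorder set"
  assumes "finite X"
  shows "card {x \<in> X. card {y \<in> X. y \<le> x} \<le> M} = min M (card X)"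
  using assms
proof (induction rule: finite_linorder_max_induct)
  case empty
  then show ?case by simp
next
  case (insert b A)
  have b: "b \<notin> A" using insert.hyps(2) by auto
  have 1: "{y \<in> insert b A. y \<le> x} = {y \<in> A. y \<le> x}" if "x \<in> A" for x
    using that insert.hyps(2) by fastforce
  have 2: "{y \<in> insert b A. y \<le> b} = insert b A" using insert.hyps(2) by auto
  have cb: "card (insert b A) = Suc (card A)" using b insert.hyps(1) by simp
  show ?case
  proof (cases "Suc (card A) \<le> M")
    case True
    then have "{x \<in> insert b A. card {y \<in> insert b A. y \<le> x} \<le> M} = insert b {x \<in> A. card {y \<in> A. y \<le> x} \<le> M}"
      using 1 2 cb by auto
    then show ?thesis using insert b True cb by simp
  next
    case False
    then have "{x \<in> insert b A. card {y \<in> insert b A. y \<le> x} \<le> M} = {x \<in> A. card {y \<in> A. y \<le> x} \<le> M}"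
      using 1 2 cb by auto
    then show ?thesis using insert False cb by simp
  qed
qed

lemma card_UN_bound:
  assumes "finite A" "\<And>a. a \<in> A \<Longrightarrow> card (B a) \<le> M"
  shows "card (\<Union>a\<in>A. B a) \<le> card A * M"
proof -
  have "card (\<Union>a\<in>A. B a) \<le> (\<Sum>a\<in>A. card (B a))" by (rule card_UN_le[OF assms(1)])
  also have "\<dots> \<le> (\<Sum>a\<in>A. M)" using assms(2) by (intro sum_mono)
  finally show ?thesis by simp
qed

text \<open>\<open>u l a \<theta>\<close> is the contribution of a position with letter
  \<open>a\<close> and threshold values \<open>\<theta>\<close> to the count of \<open>l\<close>.
  The truth values \<open>th\<close> occur in their own defining sums; \<open>dep\<close> makes this
  well-founded, as contributions to \<open>l\<close> look only at strictly earlier batches.\<close>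

locale threshold_system =
  fixes I :: "'l set" and u :: "'l \<Rightarrow> 'a::finite \<Rightarrow> ('l \<Rightarrow> bool) \<Rightarrow> nat"
    and kap :: "'l \<Rightarrow> nat" and K :: nat and bt :: "'l \<Rightarrow> nat"
    and th :: "'a list \<Rightarrow> nat \<Rightarrow> 'l \<Rightarrow> bool"
  assumes finI: "finite I" and K: "K \<ge> 1"
    and kap: "\<And>l. l \<in> I \<Longrightarrow> kap l \<le> K" and u_le: "\<And>l a \<theta>. u l a \<theta> \<le> K"
    and th: "\<And>w i l. l \<in> I \<Longrightarrow> i < length w \<Longrightarrow>
          th w i l \<longleftrightarrow> kap l \<le> (\<Sum>j\<le>i. u l (w ! j) (th w j))"
    and dep: "\<And>l \<theta> \<theta>' a. l \<in> I \<Longrightarrow> (\<And>l'. l' \<in> I \<Longrightarrow> bt l' < bt l \<Longrightarrow> \<theta> l' = \<theta>' l') \<Longrightarrow>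
          u l a \<theta> = u l a \<theta>'"
begin

definition below :: "nat \<Rightarrow> ('l \<Rightarrow> bool) \<Rightarrow> 'l \<Rightarrow> bool" where
  "below b \<theta> l \<longleftrightarrow> l \<in> I \<and> bt l < b \<and> \<theta> l"

definition pot :: "nat \<Rightarrow> ('l \<Rightarrow> bool) \<Rightarrow> nat" where
  "pot b \<theta> = card {l. below b \<theta> l}"

text \<open>
  Thresholds only switch on along a word, so the number of true ones determines all of them;
  \<open>imp M b w i\<close> selects the first \<open>M\<close> positions of each letter in each phase of the batches below \<open>b\<close>.
\<close>

definition imp :: "nat \<Rightarrow> nat \<Rightarrow> 'a list \<Rightarrow> nat \<Rightarrow> bool" where
  "imp M b w i \<longleftrightarrow> card {j. j \<le> i \<and> pot b (th w j) = pot b (th w i) \<and> w ! j = w ! i} \<le> M"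

lemma finite_below [simp]: "finite {l. below b \<theta> l}"
  using finI by (rule rev_finite_subset) (auto simp: below_def)

lemma pot_le: "pot b \<theta> \<le> card I"
  unfolding pot_def using finI by (intro card_mono) (auto simp: below_def)

lemma pot_below [simp]: "pot b (below b \<theta>) = pot b \<theta>"
proof -
  have "below b (below b \<theta>) = below b \<theta>" by (auto simp: below_def)
  then show ?thesis by (simp add: pot_def)
qed

lemma u_below: "l \<in> I \<Longrightarrow> bt l = b \<Longrightarrow> u l a (below b \<theta>) = u l a \<theta>"
  by (rule dep) (auto simp: below_def)

lemma th_mono:
  assumes "i \<le> j" "j < length w" "l \<in> I" "th w i l"
  shows "th w j l"
proof -
  have "(\<Sum>x\<le>i. u l (w ! x) (th w x)) \<le> (\<Sum>x\<le>j. u l (w ! x) (th w x))"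
    using assms(1) by (intro sum_mono2) auto
  then show ?thesis using th[of l i w] th[of l j w] assms by simp
qed

lemma pot_mono:
  assumes "i \<le> j" "j < length w"
  shows "pot b (th w i) \<le> pot b (th w j)"
  unfolding pot_def using th_mono[OF assms] by (intro card_mono) (auto simp: below_def)

lemma pot_eq_imp_below_eq:
  assumes "i < length w" "j < length w" "pot b (th w i) = pot b (th w j)"
  shows "below b (th w i) = below b (th w j)"
proof -
  have *: "below b (th w i) = below b (th w j)"
    if "i \<le> j" "j < length w" "pot b (th w i) = pot b (th w j)" for i j
  proof -
    have "{l. below b (th w i) l} \<subseteq> {l. below b (th w j) l}"
      using th_mono[OF that(1,2)] by (auto simp: below_def)
    then have "{l. below b (th w i) l} = {l. below b (th w j) l}"
      using that(3) by (intro card_subset_eq) (auto simp: pot_def)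
    then show ?thesis by auto
  qed
  show ?thesis using *[of i j] *[of j i] assms by (metis nat_le_linear)
qed

lemma u_cong_below:
  assumes "l \<in> I" "bt l = b" "below b \<theta> = below b \<theta>'"
  shows "u l a \<theta> = u l a \<theta>'"
  by (metis assms u_below)

lemma imp_fibre:
  fixes w :: "'a list" and b :: nat
  assumes "x \<le> i"
  defines "X \<equiv> {j. j \<le> i \<and> pot b (th w j) = pot b (th w x) \<and> w ! j = w ! x}"
  shows "{j \<in> X. imp M b w j} = {j \<in> X. card {y \<in> X. y \<le> j} \<le> M}"
proof -
  have "{y \<in> X. y \<le> j} = {y. y \<le> j \<and> pot b (th w y) = pot b (th w j) \<and> w ! y = w ! j}" if "j \<in> X" for j
    using that by (auto simp: X_def)
  then show ?thesis by (auto simp: imp_def)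
qed

text \<open>If an omitted position contributes, then \<open>M\<close> selected positions before it
  share its letter and phase, and each contributes the same positive amount, so both sums reach
  \<open>M\<close>. Otherwise the sums are equal. \<open>Z\<close> restricts to a set of
  phases.\<close>

lemma sum_imp:
  assumes l: "l \<in> I" "bt l = b" and i: "i < length w"
  shows "min M (\<Sum>j | j \<le> i \<and> Z (pot b (th w j)). u l (w ! j) (th w j)) =
         min M (\<Sum>j | j \<le> i \<and> Z (pot b (th w j)) \<and> imp M b w j. u l (w ! j) (th w j))"
    (is "min M (sum ?u ?S) = min M (sum ?u ?T)")
proof (cases "\<exists>x\<in>?S - ?T. ?u x > 0")
  case False
  then have "sum ?u ?S = sum ?u ?T"
    by (intro sum.mono_neutral_right) auto
  then show ?thesis by simp
next
  case True
  then obtain x where x: "x \<le> i" "Z (pot b (th w x))" "\<not> imp M b w x" "?u x > 0" by auto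
  define X where "X = {j. j \<le> x \<and> pot b (th w j) = pot b (th w x) \<and> w ! j = w ! x}"
  have X: "{j \<in> X. imp M b w j} = {j \<in> X. card {y \<in> X. y \<le> j} \<le> M}"
    unfolding X_def by (rule imp_fibre) simp
  have "finite X" by (simp add: X_def)
  then have "card {j \<in> X. imp M b w j} = min M (card X)" unfolding X by (rule card_low_rank)
  also have "\<dots> = M" using x(3) by (simp add: imp_def X_def)
  finally have "M = (\<Sum>j\<in>{j \<in> X. imp M b w j}. 1)" by simp
  also have "\<dots> \<le> (\<Sum>j\<in>{j \<in> X. imp M b w j}. ?u j)"
  proof (intro sum_mono)
    fix j assume "j \<in> {j \<in> X. imp M b w j}"
    then have j: "j \<le> x" "pot b (th w j) = pot b (th w x)" "w ! j = w ! x" by (auto simp: X_def)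
    have "below b (th w j) = below b (th w x)"
      using j(1,2) x(1) i by (intro pot_eq_imp_below_eq) auto
    then have "?u j = ?u x" using u_cong_below[OF l] j(3) by metis
    then show "1 \<le> ?u j" using x(4) by simp
  qed
  also have "\<dots> \<le> sum ?u ?T" using x(1,2) by (intro sum_mono2) (auto simp: X_def)
  finally have "M \<le> sum ?u ?T" .
  moreover have "sum ?u ?T \<le> sum ?u ?S" by (intro sum_mono2) auto
  ultimately show ?thesis by simp
qed

lemma card_imp_le:
  "card {j. j \<le> i \<and> Z (pot b (th w j)) \<and> imp M b w j}
     \<le> card ((\<lambda>j. pot b (th w j)) ` {j. j \<le> i \<and> Z (pot b (th w j))}) * (card (UNIV :: 'a set) * M)"
proof -
  let ?S = "{j. j \<le> i \<and> Z (pot b (th w j))}"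
  let ?B = "\<lambda>z. {j \<in> ?S. imp M b w j \<and> pot b (th w j) = z}"
  let ?X = "\<lambda>z a. {j \<in> ?S. imp M b w j \<and> pot b (th w j) = z \<and> w ! j = a}"
  have X: "card (?X z a) \<le> M" for z a
  proof (cases "?X z a = {}")
    case True
    then show ?thesis unfolding True by simp
  next
    case False
    then obtain x where x: "x \<le> i" "pot b (th w x) = z" "w ! x = a" by auto
    define X where "X = {j. j \<le> i \<and> pot b (th w j) = pot b (th w x) \<and> w ! j = w ! x}"
    have "?X z a \<subseteq> {j \<in> X. imp M b w j}" using x by (auto simp: X_def)
    then have "card (?X z a) \<le> card {j \<in> X. imp M b w j}" by (intro card_mono) (auto simp: X_def)
    also have "\<dots> = min M (card X)"
      using imp_fibre[OF x(1), of b w M] card_low_rank[of X M] by (simp add: X_def)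
    finally show ?thesis by simp
  qed
  have B: "card (?B z) \<le> card (UNIV :: 'a set) * M" for z
  proof -
    have "?B z = (\<Union>a. ?X z a)" by auto
    then show ?thesis using card_UN_bound[of "UNIV :: 'a set" "?X z" M] X by simp
  qed
  have "{j. j \<le> i \<and> Z (pot b (th w j)) \<and> imp M b w j} = (\<Union>z\<in>(\<lambda>j. pot b (th w j)) ` ?S. ?B z)" by auto
  then show ?thesis
    using card_UN_bound[of "(\<lambda>j. pot b (th w j)) ` ?S" ?B "card (UNIV :: 'a set) * M"] B by simp
qed

lemma UNIV_pos: "Suc 0 \<le> card (UNIV :: 'a set)"
  by (simp add: Suc_le_eq card_gt_0_iff)

text \<open>
  Cut the interval at its rare positions, the first \<open>K\<close> occurrences of each letter. Between them the
  thresholds of batch \<open>b\<close> are constant, and every piece but the last misses the letter of the next rare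
  position. The resulting recursion in batches and letters is polynomial in the number of batches.
\<close>

lemma card_phases_interval:
  assumes "J \<subseteq> {..<length w}" "\<And>x y z. x \<in> J \<Longrightarrow> z \<in> J \<Longrightarrow> x \<le> y \<Longrightarrow> y \<le> z \<Longrightarrow> y \<in> J"
    and "(\<lambda>i. w ! i) ` J \<subseteq> A" and "\<And>i j. i \<in> J \<Longrightarrow> j \<in> J \<Longrightarrow> below b (th w i) = below b (th w j)"
  shows "card ((\<lambda>i. below (b + m) (th w i)) ` J) \<le> (2 * card (UNIV :: 'a set) * K * (m + 1)) ^ card A"
  using assms
proof (induction m arbitrary: b J A)
  case 0
  have "card ((\<lambda>i. below b (th w i)) ` J) \<le> 1"
  proof (cases "J = {}")
    case False
    then obtain x where "x \<in> J" by blast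
    then have "(\<lambda>i. below b (th w i)) ` J \<subseteq> {below b (th w x)}" using 0(4) by blast
    then show ?thesis using card_mono[of "{below b (th w x)}"] by fastforce
  qed simp
  also have "\<dots> \<le> (2 * card (UNIV :: 'a set) * K * (0 + 1)) ^ card A"
    using K UNIV_pos by (intro one_le_power) simp
  finally show ?case by simp
next
  case (Suc m)
  note conv = Suc.prems(2)
  have finJ: "finite J" using Suc.prems(1) finite_subset by blast
  let ?F = "\<lambda>i. below (b + Suc m) (th w i)"
  let ?y = "2 * card (UNIV :: 'a set) * K * (m + 1)"
  define cls where "cls i = {j \<in> J. j \<le> i \<and> w ! j = w ! i}" for i
  define rare where "rare = {i \<in> J. card (cls i) \<le> K}"
  \<comment> \<open>Numbers the pieces by the rare positions to their left, from \<open>0\<close> to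
    \<open>r\<close>.\<close>
  define rho where "rho i = card {j \<in> rare. j < i}" for i
  define r where "r = card rare"
  define Jv where "Jv v = {i \<in> J - rare. rho i = v}" for v
  have finr: "finite rare" using finJ by (simp add: rare_def)
  have r: "r \<le> card A * K"
  proof -
    have "rare = (\<Union>a\<in>A. {i \<in> J. w ! i = a \<and> card (cls i) \<le> K})"
      using Suc.prems(3) by (auto simp: rare_def)
    moreover have "card {i \<in> J. w ! i = a \<and> card (cls i) \<le> K} \<le> K" for a
    proof -
      have "{i \<in> J. w ! i = a \<and> card (cls i) \<le> K}
          = {i \<in> {i \<in> J. w ! i = a}. card {y \<in> {i \<in> J. w ! i = a}. y \<le> i} \<le> K}" (is "?lhs = ?rhs")
      proof -
        have "cls i = {y \<in> {i \<in> J. w ! i = a}. y \<le> i}" if "w ! i = a" for i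
          using that by (auto simp: cls_def)
        then have "x \<in> ?lhs \<longleftrightarrow> x \<in> ?rhs" for x by (cases "w ! x = a") simp_all
        then show ?thesis by blast
      qed
      then show ?thesis using card_low_rank[of "{i \<in> J. w ! i = a}" K] finJ by simp
    qed
    ultimately show ?thesis unfolding r_def
      using card_UN_bound[of A "\<lambda>a. {i \<in> J. w ! i = a \<and> card (cls i) \<le> K}" K] by simp
  qed
  have rho_le: "rho i \<le> r" for i unfolding rho_def r_def using finr by (intro card_mono) auto
  have no_rare: "y \<notin> rare" if "i \<in> Jv v" "i' \<in> Jv v" "i < y" "y \<le> i'" for v i i' y
  proof
    assume y: "y \<in> rare"
    have "i' \<notin> rare" using that(2) by (simp add: Jv_def)
    then have "y < i'" using y that(4) by (metis order_le_less)
    have "{j \<in> rare. j < i} \<subseteq> {j \<in> rare. j < i'}" using that(3,4) by (simp add: subset_iff)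
    moreover have "y \<in> {j \<in> rare. j < i'} - {j \<in> rare. j < i}" using y \<open>y < i'\<close> that(3) by simp
    ultimately have "{j \<in> rare. j < i} \<subset> {j \<in> rare. j < i'}" by blast
    then have "rho i < rho i'" unfolding rho_def using finr by (intro psubset_card_mono) auto
    then show False using that(1,2) by (simp add: Jv_def)
  qed
  have conv_v: "y \<in> Jv v" if "x \<in> Jv v" "z \<in> Jv v" "x \<le> y" "y \<le> z" for x y z v
  proof -
    have yJ: "y \<in> J" using conv[of x z y] that by (auto simp: Jv_def)
    have yr: "y \<notin> rare" using no_rare[of x v z y] that by (cases "x = y") (auto simp: Jv_def)
    have "{j \<in> rare. j < y} = {j \<in> rare. j < x}"
    proof -
      have "j < x" if "j \<in> rare" "j < y" for j
      proof (rule ccontr)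
        assume "\<not> j < x"
        moreover have "x \<notin> rare" using \<open>x \<in> Jv v\<close> by (simp add: Jv_def)
        ultimately have "x < j" using that(1) by (metis linorder_neqE_nat)
        then show False using no_rare[OF \<open>x \<in> Jv v\<close> \<open>z \<in> Jv v\<close>, of j] \<open>y \<le> z\<close> that by simp
      qed
      then show ?thesis using that(3) by auto
    qed
    then show ?thesis using yJ yr that(1) by (simp add: Jv_def rho_def)
  qed
  \<comment> \<open>If a threshold of batch \<open>b\<close> switched on between \<open>i\<close>
    and \<open>i'\<close>, some position there would contribute. It is not rare, so the first
    \<open>K\<close> occurrences of its letter all lie at or before \<open>i\<close>. They
    contribute as well and have already reached the threshold, which is at most
    \<open>K\<close>.\<close>
  have const: "below (Suc b) (th w i) = below (Suc b) (th w i')" if "i \<in> Jv v" "i' \<in> Jv v" "i \<le> i'" for i i' v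
  proof
    fix l
    have iJ: "i \<in> J" "i' \<in> J" using that by (auto simp: Jv_def)
    then have len: "i < length w" "i' < length w" using Suc.prems(1) by auto
    show "below (Suc b) (th w i) l = below (Suc b) (th w i') l"
    proof (cases "l \<in> I \<and> bt l = b")
      case False
      then show ?thesis using Suc.prems(4)[OF iJ] by (auto simp: below_def less_Suc_eq fun_eq_iff)
    next
      case l: True
      have "th w i l" if i': "th w i' l"
      proof (rule ccontr)
        let ?u = "\<lambda>j. u l (w ! j) (th w j)"
        assume "\<not> th w i l"
        then have lt: "(\<Sum>j\<le>i. ?u j) < kap l" and ge: "kap l \<le> (\<Sum>j\<le>i'. ?u j)"
          using th l i' len by auto
        have "\<exists>j. i < j \<and> j \<le> i' \<and> ?u j > 0"
        proof (rule ccontr)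
          assume "\<not> ?thesis"
          then have "(\<Sum>j\<le>i'. ?u j) = (\<Sum>j\<le>i. ?u j)"
            using \<open>i \<le> i'\<close> by (intro sum.mono_neutral_right) auto
          then show False using lt ge by simp
        qed
        then obtain j where j: "i < j" "j \<le> i'" "?u j > 0" by blast
        have jJ: "j \<in> J" using conv[of i i' j] iJ j by simp
        have jr: "j \<notin> rare" using no_rare[OF \<open>i \<in> Jv v\<close> \<open>i' \<in> Jv v\<close> j(1,2)] .
        have fc: "finite (cls j)" using finJ by (simp add: cls_def)
        have "{x \<in> cls j. card {y \<in> cls j. y \<le> x} \<le> K} \<subseteq> {x \<in> cls j. x \<in> rare}"
        proof
          fix x assume x: "x \<in> {x \<in> cls j. card {y \<in> cls j. y \<le> x} \<le> K}"
          then have "{y \<in> cls j. y \<le> x} = cls x" by (auto simp: cls_def)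
          then show "x \<in> {x \<in> cls j. x \<in> rare}" using x by (auto simp: rare_def cls_def)
        qed
        then have "card {x \<in> cls j. card {y \<in> cls j. y \<le> x} \<le> K} \<le> card {x \<in> cls j. x \<in> rare}"
          using fc by (intro card_mono) auto
        then have "min K (card (cls j)) \<le> card {x \<in> cls j. x \<in> rare}"
          using card_low_rank[OF fc] by simp
        moreover have "card (cls j) > K" using jr jJ by (simp add: rare_def)
        ultimately have "K \<le> (\<Sum>x\<in>{x \<in> cls j. x \<in> rare}. 1)" by simp
        also have "\<dots> \<le> (\<Sum>x\<in>{x \<in> cls j. x \<in> rare}. ?u x)"
        proof (intro sum_mono)
          fix x assume "x \<in> {x \<in> cls j. x \<in> rare}"
          then have x: "x \<in> J" "w ! x = w ! j" by (auto simp: cls_def)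
          have "?u x = ?u j" using u_cong_below[OF _ _ Suc.prems(4)[OF x(1) jJ]] l x(2) by metis
          then show "1 \<le> ?u x" using j(3) by simp
        qed
        also have "\<dots> \<le> (\<Sum>x\<le>i. ?u x)"
        proof (intro sum_mono2)
          show "{x \<in> cls j. x \<in> rare} \<subseteq> {..i}"
          proof
            fix x assume "x \<in> {x \<in> cls j. x \<in> rare}"
            then have x: "x \<in> rare" "x \<le> i'" using j(2) by (auto simp: cls_def)
            then show "x \<in> {..i}" using no_rare[OF \<open>i \<in> Jv v\<close> \<open>i' \<in> Jv v\<close>, of x] by (cases "x \<le> i") auto
          qed
        qed auto
        finally show False using lt kap[of l] l by simp
      qed
      then show ?thesis using th_mono[OF \<open>i \<le> i'\<close> len(2)] l by (auto simp: below_def)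
    qed
  qed
  have IH: "card (?F ` Jv v) \<le> ?y ^ card B" if "(\<lambda>i. w ! i) ` Jv v \<subseteq> B" for v B
  proof -
    have "card ((\<lambda>i. below (Suc b + m) (th w i)) ` Jv v) \<le> ?y ^ card B"
    proof (rule Suc.IH)
      show "Jv v \<subseteq> {..<length w}" using Suc.prems(1) by (auto simp: Jv_def)
      show "below (Suc b) (th w i) = below (Suc b) (th w j)" if "i \<in> Jv v" "j \<in> Jv v" for i j
        using const[of i v j] const[of j v i] that by (metis nat_le_linear)
      show "y \<in> Jv v" if "x \<in> Jv v" "z \<in> Jv v" "x \<le> y" "y \<le> z" for x y z
        by (rule conv_v[OF that])
      show "(\<lambda>i. w ! i) ` Jv v \<subseteq> B" by (rule that)
    qed
    then show ?thesis by simp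
  qed
  show ?case
  proof (cases "A = {}")
    case True
    then have "J = {}" using Suc.prems(3) by auto
    then show ?thesis by simp
  next
    case False
    define a where "a = card A - 1"
    have cA: "card A = Suc a" using False by (simp add: a_def card_gt_0_iff)
    have y1: "?y \<ge> 1" using K UNIV_pos by (simp add: Suc_le_eq del: mult_Suc_right)
    \<comment> \<open>The next rare position \<open>x\<close> is among the first \<open>K\<close>
      occurrences of its letter, so an earlier occurrence inside the piece would be rare
      too.\<close>
    have small: "card (?F ` Jv v) \<le> ?y ^ a" if v: "v < r" for v
    proof (cases "Jv v = {}")
      case True
      have "1 \<le> ?y ^ a" using y1 by (rule one_le_power)
      then show ?thesis unfolding True by simp
    next
      case False
      have finv: "finite (Jv v)" using finJ by (simp add: Jv_def)
      define i0 where "i0 = Max (Jv v)"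
      have i0: "i0 \<in> Jv v" "\<And>i. i \<in> Jv v \<Longrightarrow> i \<le> i0"
        using finv False by (auto simp: i0_def)
      have "\<exists>x\<in>rare. \<not> x < i0"
      proof (rule ccontr)
        assume "\<not> ?thesis"
        then have "{j \<in> rare. j < i0} = rare" by auto
        then show False using v i0(1) by (simp add: Jv_def rho_def r_def)
      qed
      then obtain x where x: "x \<in> rare" "i0 \<le> x" by force
      have "w ! i \<noteq> w ! x" if i: "i \<in> Jv v" for i
      proof
        assume eq: "w ! i = w ! x"
        have "i \<le> x" using i0(2)[OF i] x(2) by simp
        then have "card (cls i) \<le> card (cls x)"
          using eq finJ by (intro card_mono) (auto simp: cls_def)
        then show False using i x(1) by (auto simp: Jv_def rare_def)
      qed
      then have "(\<lambda>i. w ! i) ` Jv v \<subseteq> A - {w ! x}" using Suc.prems(3) by (auto simp: Jv_def)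
      moreover have "card (A - {w ! x}) = a" using x(1) Suc.prems(3) cA by (auto simp: rare_def)
      ultimately show ?thesis using IH by metis
    qed
    have J: "J = rare \<union> (\<Union>v\<in>{..<r}. Jv v) \<union> Jv r"
    proof -
      have "i \<in> (\<Union>v\<in>{..<r}. Jv v) \<union> Jv r" if "i \<in> J - rare" for i
        using that rho_le[of i] by (cases "rho i = r") (simp_all add: Jv_def)
      moreover have "Jv v \<subseteq> J" "rare \<subseteq> J" for v by (auto simp: Jv_def rare_def)
      ultimately show ?thesis by blast
    qed
    have "card (?F ` J) \<le> card (?F ` rare) + card (\<Union>v\<in>{..<r}. ?F ` Jv v) + card (?F ` Jv r)"
    proof -
      have "?F ` J = ?F ` rare \<union> (\<Union>v\<in>{..<r}. ?F ` Jv v) \<union> ?F ` Jv r"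
        by (subst J) (simp add: image_Un image_UN)
      then show ?thesis
        by (simp only:) (rule order.trans[OF card_Un_le add_right_mono[OF card_Un_le]])
    qed
    also have "card (?F ` rare) \<le> r" unfolding r_def by (rule card_image_le[OF finr])
    also have "card (\<Union>v\<in>{..<r}. ?F ` Jv v) \<le> r * ?y ^ a"
      using card_UN_bound[of "{..<r}" "\<lambda>v. ?F ` Jv v" "?y ^ a"] small by simp
    also have "card (?F ` Jv r) \<le> ?y ^ Suc a"
      unfolding cA[symmetric] using Suc.prems(3) by (intro IH) (auto simp: Jv_def)
    finally have *: "card (?F ` J) \<le> r + r * ?y ^ a + ?y ^ Suc a" by simp
    have "card A \<le> card (UNIV :: 'a set)" by (intro card_mono) auto
    then have rK: "r \<le> card (UNIV :: 'a set) * K" using r by (meson le_trans mult_le_mono1)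
    have "r + r * ?y ^ a \<le> 2 * (card (UNIV :: 'a set) * K) * ?y ^ a"
    proof -
      have "1 \<le> ?y ^ a" using y1 by (rule one_le_power)
      then have "r + r * ?y ^ a \<le> 2 * r * ?y ^ a" by simp
      also have "\<dots> \<le> 2 * (card (UNIV :: 'a set) * K) * ?y ^ a" using rK by (intro mult_le_mono) auto
      finally show ?thesis .
    qed
    \<comment> \<open>With \<open>c = 2 * card UNIV * K\<close> and \<open>?y = c * (m + 1)\<close>
      the recursion closes, because \<open>(c + ?y) * ?y ^ a \<le> (c + ?y) ^ Suc a\<close> and
      \<open>c + ?y = c * (m + 2)\<close>.\<close>
    then have "r + r * ?y ^ a + ?y ^ Suc a \<le> (2 * card (UNIV :: 'a set) * K + ?y) * ?y ^ a"
      by (simp add: algebra_simps)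
    also have "\<dots> \<le> (2 * card (UNIV :: 'a set) * K + ?y) * (2 * card (UNIV :: 'a set) * K + ?y) ^ a"
      by (intro mult_le_mono power_mono) auto
    also have "\<dots> = (2 * card (UNIV :: 'a set) * K * (Suc m + 1)) ^ card A"
      unfolding cA by (simp add: algebra_simps)
    finally show ?thesis using * by linarith
  qed
qed

text \<open>Phases for fewer batches are unions of phases for more batches, so one bound serves all
  stages of a run.\<close>

lemma card_pot_le:
  assumes "b \<le> B" "S \<subseteq> {..<length w}"
  shows "card ((\<lambda>j. pot b (th w j)) ` S) \<le> (2 * card (UNIV :: 'a set) * K * (B + 1)) ^ card (UNIV :: 'a set)"
proof -
  have "(\<lambda>j. pot b (th w j)) ` S \<subseteq> pot b ` ((\<lambda>j. below B (th w j)) ` {..<length w})"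
  proof
    fix x assume "x \<in> (\<lambda>j. pot b (th w j)) ` S"
    then obtain j where j: "j \<in> S" "x = pot b (th w j)" by blast
    have "below b (below B (th w j)) = below b (th w j)" using assms(1) by (auto simp: below_def)
    then have "x = pot b (below B (th w j))" using j by (simp add: pot_def)
    then show "x \<in> pot b ` ((\<lambda>j. below B (th w j)) ` {..<length w})" using j assms(2) by blast
  qed
  then have "card ((\<lambda>j. pot b (th w j)) ` S) \<le> card (pot b ` ((\<lambda>j. below B (th w j)) ` {..<length w}))"
    by (intro card_mono) auto
  also have "\<dots> \<le> card ((\<lambda>j. below B (th w j)) ` {..<length w})" by (intro card_image_le) auto
  also have "\<dots> \<le> (2 * card (UNIV :: 'a set) * K * (B + 1)) ^ card (UNIV :: 'a set)"
    using card_phases_interval[of "{..<length w}" w UNIV 0 B] by (simp add: below_def[abs_def])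
  finally show ?thesis .
qed

end

section \<open>Few phases: direct tests\<close>

lemma attended_Suc:
  assumes "kc (H 0) = KAll"
  shows "attended qc kc H (Suc i)
    = insert 0 (Suc ` {j. j \<le> i \<and> matches (qc (H (Suc i))) (kc (H (Suc j)))})"
proof (rule set_eqI)
  fix j show "j \<in> attended qc kc H (Suc i) \<longleftrightarrow>
    j \<in> insert 0 (Suc ` {j. j \<le> i \<and> matches (qc (H (Suc i))) (kc (H (Suc j)))})"
    using assms by (cases j) (auto simp: attended_def)
qed

text \<open>\<open><BOS>\<close> is always attended, so its value acts as a bias that turns the sign
  test into a comparison with a constant. It also takes one unit of the capacity, hence the
  \<open>Suc\<close>.\<close>

lemma mstep_Suc:
  assumes "kc (H 0) = KAll"
    and Z: "\<And>j. j \<le> i \<Longrightarrow> matches (qc (H (Suc i))) (kc (H (Suc j))) \<longleftrightarrow> Z j"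
    and val: "\<And>j v. j \<le> i \<Longrightarrow> Z j \<Longrightarrow> v \<in> V \<Longrightarrow> vl (H (Suc j)) v = val j v"
  shows "mstep s V (qc, kc, vl, nx) H (Suc i) =
    nx (H (Suc i)) (\<lambda>v. v \<in> V \<and> Suc (card {j. j \<le> i \<and> Z j}) \<le> 2 ^ s \<and>
      vl (H 0) v + (\<Sum>j | j \<le> i \<and> Z j. val j v) < 0)"
proof -
  let ?G = "{j. j \<le> i \<and> Z j}"
  have "{j. j \<le> i \<and> matches (qc (H (Suc i))) (kc (H (Suc j)))} = ?G" using Z by auto
  then have att: "attended qc kc H (Suc i) = insert 0 (Suc ` ?G)"
    using attended_Suc[of kc H qc i] assms(1) by simp
  have "(\<Sum>j\<in>?G. vl (H (Suc j)) v) = (\<Sum>j\<in>?G. val j v)" if "v \<in> V" for v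
    using val that by (intro sum.cong) auto
  then have "(v \<in> V \<and> card (attended qc kc H (Suc i)) \<le> 2 ^ s \<and>
      (\<Sum>j\<in>attended qc kc H (Suc i). vl (H j) v) < 0) \<longleftrightarrow>
    (v \<in> V \<and> Suc (card ?G) \<le> 2 ^ s \<and> vl (H 0) v + (\<Sum>j\<in>?G. val j v) < 0)" for v
    by (auto simp: att card_image sum.reindex)
  then show ?thesis by simp
qed

datatype ('a, 'l) sstate = SBos | SWord 'a "'l \<Rightarrow> bool" bool

fun sinit :: "'a option \<Rightarrow> ('a, 'l) sstate" where
  "sinit None = SBos"
| "sinit (Some a) = SWord a (\<lambda>_. False) False"

fun sfeat :: "('a, 'l) sstate \<Rightarrow> 'a + 'l option \<Rightarrow> bool" where
  "sfeat SBos c = False"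
| "sfeat (SWord a \<theta> f) (Inl x) = (x = a)"
| "sfeat (SWord a \<theta> f) (Inr None) = f"
| "sfeat (SWord a \<theta> f) (Inr (Some l)) = \<theta> l"

context threshold_system
begin

text \<open>Tests the rank of a position within its phase and letter against \<open>K\<close>; the
  flag becomes \<open>imp K b\<close>. If the capacity overflows, the flag is false, which is
  correct once \<open>K + 1 \<le> 2 ^ s\<close>.\<close>

definition class_layer :: "nat \<Rightarrow> (('a, 'l) sstate, (nat \<times> 'a) option, 'l option) mlayer" where
  "class_layer b =
    (\<lambda>\<sigma>. case \<sigma> of SBos \<Rightarrow> None | SWord a \<theta> f \<Rightarrow> Some (pot b \<theta>, a),
     \<lambda>\<sigma>. case \<sigma> of SBos \<Rightarrow> KAll | SWord a \<theta> f \<Rightarrow> KCls (Some (pot b \<theta>, a)),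
     \<lambda>\<sigma> v. case \<sigma> of SBos \<Rightarrow> - (int K + 1) | SWord a \<theta> f \<Rightarrow> 1,
     \<lambda>\<sigma> r. case \<sigma> of SBos \<Rightarrow> SBos | SWord a \<theta> f \<Rightarrow> SWord a \<theta> (r None))"

text \<open>All flagged positions share one class, whatever their phase. A negative sum means that
  the threshold is missed, so an overflow would wrongly report it as met; this is where few phases
  are essential.\<close>

definition test_layer :: "nat \<Rightarrow> (('a, 'l) sstate, (nat \<times> 'a) option, 'l option) mlayer" where
  "test_layer b =
    (\<lambda>\<sigma>. None,
     \<lambda>\<sigma>. case \<sigma> of SBos \<Rightarrow> KAll | SWord a \<theta> f \<Rightarrow> if f then KCls None else KNone,
     \<lambda>\<sigma> v. case v of None \<Rightarrow> 0 | Some l \<Rightarrow>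
        (case \<sigma> of SBos \<Rightarrow> - int (kap l) | SWord a \<theta> f \<Rightarrow> int (u l a \<theta>)),
     \<lambda>\<sigma> r. case \<sigma> of SBos \<Rightarrow> SBos | SWord a \<theta> f \<Rightarrow>
        SWord a (\<lambda>l. \<theta> l \<or> l \<in> I \<and> bt l = b \<and> \<not> r (Some l)) False)"

definition sV :: "'l option set" where "sV = insert None (Some ` I)"
definition sQ :: "(nat \<times> 'a) option set" where "sQ = insert None (Some ` ({..card I} \<times> UNIV))"
definition sVS :: "('a, 'l) sstate set" where
  "sVS = insert SBos {SWord a \<theta> f | a \<theta> f. \<forall>l. \<theta> l \<longrightarrow> l \<in> I}"
definition sC :: "('a + 'l option) set" where "sC = range Inl \<union> Inr ` sV"

definition sinv :: "nat \<Rightarrow> 'a list \<Rightarrow> (nat \<Rightarrow> ('a, 'l) sstate) \<Rightarrow> bool" where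
  "sinv b w H \<longleftrightarrow> H 0 = SBos \<and> (\<forall>i<length w. H (Suc i) = SWord (w ! i) (below b (th w i)) False)"

lemma below_Suc:
  "below (Suc b) \<theta> = (\<lambda>l. below b \<theta> l \<or> l \<in> I \<and> bt l = b \<and> \<theta> l)"
  by (auto simp: below_def)

lemma sinv_step:
  assumes inv: "sinv b w H" and s: "K + 1 \<le> 2 ^ s"
    and cap: "\<And>i. i < length w \<Longrightarrow> Suc (card {j. j \<le> i \<and> imp K b w j}) \<le> 2 ^ s"
  shows "sinv (Suc b) w (mrun s sV [class_layer b, test_layer b] H)"
proof -
  define H1 where "H1 = mstep s sV (class_layer b) H"
  have H0: "H 0 = SBos" and HS: "\<And>i. i < length w \<Longrightarrow> H (Suc i) = SWord (w ! i) (below b (th w i)) False"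
    using inv by (auto simp: sinv_def)
  have H10: "H1 0 = SBos" by (simp add: H1_def class_layer_def H0)
  have H1S: "H1 (Suc i) = SWord (w ! i) (below b (th w i)) (imp K b w i)" if i: "i < length w" for i
  proof -
    let ?G = "{j. j \<le> i \<and> pot b (th w j) = pot b (th w i) \<and> w ! j = w ! i}"
    have "H1 (Suc i) = SWord (w ! i) (below b (th w i))
        (Suc (card ?G) \<le> 2 ^ s \<and> - (int K + 1) + (\<Sum>j\<in>?G. 1) < 0)"
      unfolding H1_def class_layer_def
      by (subst mstep_Suc[where Z = "\<lambda>j. pot b (th w j) = pot b (th w i) \<and> w ! j = w ! i"
            and val = "\<lambda>_ _. 1"]) (use i in \<open>auto simp: H0 HS sV_def\<close>)
    also have "(Suc (card ?G) \<le> 2 ^ s \<and> - (int K + 1) + (\<Sum>j\<in>?G. 1) < 0) = imp K b w i"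
      using s by (auto simp: imp_def)
    finally show ?thesis .
  qed
  define H2 where "H2 = mstep s sV (test_layer b) H1"
  have H20: "H2 0 = SBos" by (simp add: H2_def test_layer_def H10)
  have H2S: "H2 (Suc i) = SWord (w ! i) (below (Suc b) (th w i)) False" if i: "i < length w" for i
  proof -
    let ?G = "{j. j \<le> i \<and> imp K b w j}"
    let ?val = "\<lambda>j v. case v of None \<Rightarrow> 0 | Some l \<Rightarrow> int (u l (w ! j) (below b (th w j)))"
    have test: "- int (kap l) + (\<Sum>j\<in>?G. int (u l (w ! j) (below b (th w j)))) < 0 \<longleftrightarrow> \<not> th w i l"
      if l: "l \<in> I" "bt l = b" for l
    proof -
      have "- int (kap l) + (\<Sum>j\<in>?G. int (u l (w ! j) (below b (th w j)))) < 0
        \<longleftrightarrow> \<not> kap l \<le> (\<Sum>j\<in>?G. u l (w ! j) (th w j))"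
        unfolding u_below[OF l] of_nat_sum[symmetric] by linarith
      also have "\<dots> \<longleftrightarrow> \<not> kap l \<le> (\<Sum>j\<le>i. u l (w ! j) (th w j))"
        using sum_imp[OF l i, of K "\<lambda>_. True"] kap[OF l(1)]
        by (simp add: atMost_def min_def split: if_splits)
      also have "\<dots> \<longleftrightarrow> \<not> th w i l" using th[OF l(1) i] by simp
      finally show ?thesis .
    qed
    have "H2 (Suc i) = SWord (w ! i) (\<lambda>l. below b (th w i) l \<or> l \<in> I \<and> bt l = b \<and>
        \<not> (- int (kap l) + (\<Sum>j\<in>?G. int (u l (w ! j) (below b (th w j)))) < 0)) False"
      unfolding H2_def test_layer_def
      by (subst mstep_Suc[where Z = "imp K b w" and val = ?val])
        (use i cap[OF i] in \<open>auto simp: H10 H1S sV_def split: option.split\<close>)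
    also have "\<dots> = SWord (w ! i) (below (Suc b) (th w i)) False"
      using test by (auto simp: below_Suc intro!: ext)
    finally show ?thesis .
  qed
  show ?thesis using H20 H2S by (simp add: sinv_def H2_def H1_def)
qed

lemma sinv_run:
  assumes inv: "sinv 0 w H" and s: "K + 1 \<le> 2 ^ s"
    and cap: "\<And>b i. b < N \<Longrightarrow> i < length w \<Longrightarrow> Suc (card {j. j \<le> i \<and> imp K b w j}) \<le> 2 ^ s"
  shows "sinv N w (mrun s sV (concat (map (\<lambda>b. [class_layer b, test_layer b]) [0..<N])) H)"
  using cap
proof (induction N)
  case 0
  then show ?case using inv by simp
next
  case (Suc N)
  then show ?case using sinv_step[OF Suc.IH s] by (simp add: mrun_append)
qed

lemma mlayer_ok_simple:
  assumes "K + 1 < 2 ^ (p - 1)"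
  shows "mlayer_ok p sQ sV sVS (class_layer b)" "mlayer_ok p sQ sV sVS (test_layer b)"
proof -
  have "int (K + 1) < int (2 ^ (p - 1))" using assms by (simp only: of_nat_less_iff)
  then have K': "int K + 1 < 2 ^ (p - 1)" by simp
  have kap': "\<bar>- int (kap l)\<bar> < 2 ^ (p - 1)" if "l \<in> I" for l using kap[OF that] K' by linarith
  have u': "\<bar>int (u l a \<theta>)\<bar> < 2 ^ (p - 1)" for l a \<theta> using u_le[of l a \<theta>] K' by linarith
  show "mlayer_ok p sQ sV sVS (class_layer b)"
    using K' pot_le K unfolding class_layer_def mlayer_ok.simps sVS_def sQ_def by (auto split: sstate.split)
  show "mlayer_ok p sQ sV sVS (test_layer b)"
    using K' kap' u' unfolding test_layer_def mlayer_ok.simps sVS_def sQ_def sV_def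
    by (auto split: sstate.split option.split)
qed

lemma sfeat_inj:
  assumes "\<sigma> \<in> sVS" "\<tau> \<in> sVS" "\<And>c. c \<in> sC \<Longrightarrow> sfeat \<sigma> c = sfeat \<tau> c"
  shows "\<sigma> = \<tau>"
proof -
  have 1: "sfeat \<sigma> (Inl x) = sfeat \<tau> (Inl x)" for x using assms(3)[of "Inl x"] by (auto simp: sC_def)
  have 2: "sfeat \<sigma> (Inr None) = sfeat \<tau> (Inr None)" using assms(3)[of "Inr None"] by (auto simp: sC_def sV_def)
  have 3: "l \<in> I \<Longrightarrow> sfeat \<sigma> (Inr (Some l)) = sfeat \<tau> (Inr (Some l))" for l
    using assms(3)[of "Inr (Some l)"] by (auto simp: sC_def sV_def)
  show ?thesis
    using assms(1,2) 1 2 3 by (cases \<sigma>; cases \<tau>) (auto simp: sVS_def intro!: ext)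
qed

lemma simple_transformer:
  fixes out :: "'a \<Rightarrow> ('l \<Rightarrow> bool) \<Rightarrow> bool"
  assumes s: "s \<ge> 1" "K + 1 \<le> 2 ^ s"
      "Suc ((2 * card (UNIV :: 'a set) * K * (N + 1)) ^ card (UNIV :: 'a set) * (card (UNIV :: 'a set) * K)) \<le> 2 ^ s"
    and p: "p \<ge> 2" "K + 1 < 2 ^ (p - 1)" and t: "t \<ge> 1" "1 + (card I + 1) * card (UNIV :: 'a set) \<le> 2 ^ t"
    and D: "card (UNIV :: 'a set) + 2 * (card I + 1) \<le> D" "2 * t * R \<le> D"
    and R: "real s \<le> real R * (2 ^ (p - 2) / 2 ^ s)\<^sup>2"
  shows "\<exists>T :: 'a transformer. wf_transformer T \<and> tprec T = p \<and> tdim T = D \<and> tdepth_of T = 2 * N \<and>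
    (\<forall>w i. i < length w \<longrightarrow>
      (toutput T (None # map Some w) (Suc i) > 0 \<longleftrightarrow> out (w ! i) (below N (th w i))))"
proof -
  let ?Ls = "concat (map (\<lambda>b. [class_layer b, test_layer b]) [0..<N])"
  let ?out = "\<lambda>\<sigma>. case \<sigma> of SBos \<Rightarrow> False | SWord a \<theta> f \<Rightarrow> out a \<theta>"
  have cV: "card sV = card I + 1" using finI by (simp add: sV_def card_image)
  have cC: "card sC \<le> card (UNIV :: 'a set) + (card I + 1)"
    unfolding sC_def using card_Un_le[of "range Inl" "Inr ` sV"]
    by (simp add: card_image cV)
  have cQ: "card sQ = 1 + (card I + 1) * card (UNIV :: 'a set)"
    by (simp add: sQ_def card_image card_cartesian_product)
  obtain T :: "'a transformer" where "wf_transformer T \<and> tprec T = p \<and> tdim T = D \<and> tdepth_of T = length ?Ls \<and>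
    (\<forall>u i. toutput T u i > 0 \<longleftrightarrow> ?out (mrun s sV ?Ls (\<lambda>i. sinit (u ! i)) i))"
  proof (rule exE[OF machine_realizable[where t = t and R = R and C = sC and V = sV and Q = sQ and VS = sVS
        and feat = sfeat and init = sinit and Ls = ?Ls and p = p and s = s and D = D and out = ?out]])
    show "card sC + card sV \<le> D" using cC cV D by simp
    show "finite sC" "finite sV" "finite sQ" using finI by (auto simp: sC_def sV_def sQ_def)
    show "card sQ \<le> 2 ^ t" using cQ t by simp
    show "mlayer_ok p sQ sV sVS L" if "L \<in> set ?Ls" for L
      using that mlayer_ok_simple[OF p(2)] by auto
    show "sinit a \<in> sVS" for a :: "'a option" by (cases a) (auto simp: sVS_def)
  qed (use assms sfeat_inj in auto)
  moreover have "?out (mrun s sV ?Ls (\<lambda>i. sinit ((None # map Some w) ! i)) (Suc i)) \<longleftrightarrow> out (w ! i) (below N (th w i))"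
    if i: "i < length w" for w i
  proof -
    have "sinv N w (mrun s sV ?Ls (\<lambda>i. sinit ((None # map Some w) ! i)))"
    proof (rule sinv_run[OF _ s(2)])
      show "sinv 0 w (\<lambda>i. sinit ((None # map Some w) ! i))"
        by (auto simp: sinv_def below_def)
      fix b i assume bi: "b < N" "i < length w"
      have "card {j. j \<le> i \<and> imp K b w j} \<le> card ((\<lambda>j. pot b (th w j)) ` {..i}) * (card (UNIV :: 'a set) * K)"
        using card_imp_le[of i "\<lambda>_. True" b w K] by (simp add: atMost_def)
      also have "\<dots> \<le> (2 * card (UNIV :: 'a set) * K * (N + 1)) ^ card (UNIV :: 'a set) * (card (UNIV :: 'a set) * K)"
        using bi by (intro mult_le_mono1 card_pot_le) auto
      finally show "Suc (card {j. j \<le> i \<and> imp K b w j}) \<le> 2 ^ s" using s(3) by linarith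
    qed
    then show ?thesis using i by (simp add: sinv_def)
  qed
  moreover have "length ?Ls = 2 * N" by (simp add: length_concat comp_def sum_list_triv)
  ultimately show ?thesis by (intro exI[of _ T]) simp
qed

end

section \<open>Many phases: summation along a tree\<close>

text \<open>
  \<open>S' i\<close> stands for \<open>S (i - 1)\<close>. A position leads a group of level \<open>h\<close> if it is the first of its group; since
  it comes right after the previous group, it is the place where the total of that group is available.
\<close>

definition lead :: "nat \<Rightarrow> (nat \<Rightarrow> nat) \<Rightarrow> (nat \<Rightarrow> nat) \<Rightarrow> nat \<Rightarrow> nat \<Rightarrow> bool" where
  "lead W S S' h i \<longleftrightarrow> S' i div W ^ h \<noteq> S i div W ^ h"

definition block_sum :: "nat \<Rightarrow> (nat \<Rightarrow> nat) \<Rightarrow> (nat \<Rightarrow> nat) \<Rightarrow> nat \<Rightarrow> nat \<Rightarrow> nat" where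
  "block_sum W S y h i = (\<Sum>j | j \<le> i \<and> S j div W ^ h = S i div W ^ h. y j)"

text \<open>At a leader the group of \<open>S' i\<close> is complete and this is its total.
  Elsewhere it is a partial sum of the current group.\<close>

definition prev_sum :: "nat \<Rightarrow> (nat \<Rightarrow> nat) \<Rightarrow> (nat \<Rightarrow> nat) \<Rightarrow> (nat \<Rightarrow> nat) \<Rightarrow> nat \<Rightarrow> nat \<Rightarrow> nat" where
  "prev_sum W S S' y h i = (\<Sum>j | j < i \<and> S j div W ^ h = S' i div W ^ h. y j)"

lemma sum_same_Suc:
  fixes g y :: "nat \<Rightarrow> nat"
  assumes "\<And>j. j \<le> i \<Longrightarrow> g j \<le> g i" "g i \<le> g (Suc i)"
  shows "(\<Sum>j | j \<le> Suc i \<and> g j = g (Suc i). y j)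
    = (if g i = g (Suc i) then \<Sum>j | j \<le> i \<and> g j = g i. y j else 0) + y (Suc i)"
proof (cases "g i = g (Suc i)")
  case True
  then have "{j. j \<le> Suc i \<and> g j = g (Suc i)} = insert (Suc i) {j. j \<le> i \<and> g j = g i}"
    by (auto simp: le_Suc_eq)
  then show ?thesis using True by simp
next
  case False
  have "{j. j \<le> Suc i \<and> g j = g (Suc i)} = {Suc i}"
    using assms False by (fastforce simp: le_Suc_eq)
  then show ?thesis using False by simp
qed

locale monotone_potential =
  fixes S S' :: "nat \<Rightarrow> nat" and n W :: nat
  assumes mono: "\<And>i j. i \<le> j \<Longrightarrow> j < n \<Longrightarrow> S i \<le> S j"
    and S'_Suc: "\<And>i. Suc i < n \<Longrightarrow> S' (Suc i) = S i"
begin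

definition inner_lead :: "nat \<Rightarrow> nat \<Rightarrow> bool" where
  "inner_lead h j \<longleftrightarrow> lead W S S' h j \<and> \<not> lead W S S' (Suc h) j"

lemma block_sum_Suc:
  assumes "Suc i < n"
  shows "block_sum W S y h (Suc i)
    = (if S i div W ^ h = S (Suc i) div W ^ h then block_sum W S y h i else 0) + y (Suc i)"
  unfolding block_sum_def
  by (rule sum_same_Suc[of i "\<lambda>j. S j div W ^ h"]) (use mono assms in \<open>auto intro!: div_le_mono\<close>)

lemma prev_sum_Suc: "Suc i < n \<Longrightarrow> prev_sum W S S' y h (Suc i) = block_sum W S y h i"
  by (simp add: prev_sum_def block_sum_def S'_Suc less_Suc_eq_le)

lemma block_0 [simp]: "block_sum W S y h 0 = y 0"
proof -
  have "{j. j \<le> 0 \<and> S j div W ^ h = S 0 div W ^ h} = {0}" by auto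
  then show ?thesis by (simp only: block_sum_def) simp
qed

text \<open>Inside a group of level \<open>Suc h\<close>, each finished subgroup is followed by the
  leader of the next one, which knows the total and does not lead level \<open>Suc h\<close>. The
  unfinished subgroup gives the first summand. Treating the totals as values \<open>z\<close> makes
  the rest a block sum too, so induction along positions applies.\<close>

lemma block_sum_up:
  assumes "i < n"
  shows "block_sum W S y (Suc h) i = block_sum W S y h i +
    (\<Sum>j | j \<le> i \<and> inner_lead h j \<and> S j div W ^ Suc h = S i div W ^ Suc h. prev_sum W S S' y h j)"
proof -
  define z where "z j = (if inner_lead h j then prev_sum W S S' y h j else 0)" for j
  have div: "x div W ^ Suc h = x div W ^ h div W" for x
    by (simp only: power_Suc2 div_mult2_eq)
  have "block_sum W S y (Suc h) i = block_sum W S y h i + block_sum W S z (Suc h) i"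
    using assms
  proof (induction i)
    case 0
    then show ?case by (simp add: z_def prev_sum_def)
  next
    case (Suc i)
    have IH: "block_sum W S y (Suc h) i = block_sum W S y h i + block_sum W S z (Suc h) i"
      using Suc by simp
    have z: "z (Suc i) = (if S i div W ^ h \<noteq> S (Suc i) div W ^ h \<and> S i div W ^ Suc h = S (Suc i) div W ^ Suc h
      then block_sum W S y h i else 0)"
      using Suc.prems by (simp add: z_def inner_lead_def lead_def S'_Suc prev_sum_Suc)
    show ?case
      unfolding block_sum_Suc[OF Suc.prems] z using IH div by auto
  qed
  also have "block_sum W S z (Suc h) i =
    (\<Sum>j | j \<le> i \<and> inner_lead h j \<and> S j div W ^ Suc h = S i div W ^ Suc h. prev_sum W S S' y h j)"
    unfolding block_sum_def
    by (rule sum.mono_neutral_cong_right) (auto simp: z_def)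
  finally show ?thesis .
qed

text \<open>For \<open>i > 0\<close> this is \<open>block_sum_up\<close> at the preceding position;
  the leader \<open>i\<close> already belongs to the next group and adds no summand.\<close>

lemma prev_sum_up:
  assumes "i < n" "lead W S S' (Suc h) i"
  shows "prev_sum W S S' y (Suc h) i = prev_sum W S S' y h i +
    (\<Sum>j | j \<le> i \<and> inner_lead h j \<and> S j div W ^ Suc h = S' i div W ^ Suc h. prev_sum W S S' y h j)"
proof (cases i)
  case 0
  have "{j. j \<le> i \<and> inner_lead h j \<and> S j div W ^ Suc h = S' i div W ^ Suc h} = {}"
    using assms(2) 0 by (auto simp: lead_def)
  then show ?thesis using 0 by (simp only: sum.empty) (simp add: prev_sum_def)
next
  case (Suc k)
  have "{j. j \<le> i \<and> inner_lead h j \<and> S j div W ^ Suc h = S' i div W ^ Suc h}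
    = {j. j \<le> k \<and> inner_lead h j \<and> S j div W ^ Suc h = S k div W ^ Suc h}"
    using assms Suc by (auto simp: lead_def S'_Suc le_Suc_eq)
  then show ?thesis using Suc assms block_sum_up[of k y h] by (simp only: prev_sum_Suc)
qed

text \<open>Leaders of level \<open>h\<close> start pairwise different groups, and a group of level
  \<open>Suc h\<close> has at most \<open>W\<close> subgroups. So one step up the tree needs only
  fan-out \<open>W\<close>, however many phases there are.\<close>

lemma card_inner_lead:
  assumes "i < n" "W > 0"
  shows "card {j. j \<le> i \<and> inner_lead h j \<and> S j div W ^ Suc h = c} \<le> W"
proof -
  let ?A = "{j. j \<le> i \<and> inner_lead h j \<and> S j div W ^ Suc h = c}"
  have less: "S j div W ^ h < S j' div W ^ h" if jj: "j < j'" "j' \<in> ?A" for j j'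
  proof -
    obtain k where k: "j' = Suc k" using jj(1) by (cases j') auto
    have "S j div W ^ h \<le> S k div W ^ h" "S k div W ^ h \<le> S j' div W ^ h"
      using mono that assms k by (auto intro!: div_le_mono)
    moreover have "S k div W ^ h \<noteq> S j' div W ^ h"
      using that(2) k S'_Suc[of k] assms(1) by (auto simp: inner_lead_def lead_def)
    ultimately show ?thesis by simp
  qed
  have "inj_on (\<lambda>j. S j div W ^ h) ?A"
  proof (rule inj_onI)
    fix j j' assume "j \<in> ?A" "j' \<in> ?A" "S j div W ^ h = S j' div W ^ h"
    then show "j = j'" using less[of j j'] less[of j' j] by (metis less_irrefl linorder_neqE_nat)
  qed
  then have "card ?A = card ((\<lambda>j. S j div W ^ h) ` ?A)" by (simp add: card_image)
  also have "\<dots> \<le> card {c * W..<c * W + W}"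
  proof (intro card_mono)
    show "(\<lambda>j. S j div W ^ h) ` ?A \<subseteq> {c * W..<c * W + W}"
    proof
      fix x assume "x \<in> (\<lambda>j. S j div W ^ h) ` ?A"
      then obtain j where "x = S j div W ^ h" "S j div W ^ Suc h = c" by auto
      then have "x div W = c" by (simp only: power_Suc2 div_mult2_eq)
      then have "x = c * W + x mod W" using div_mult_mod_eq[of x W] by simp
      moreover have "x mod W < W" using assms(2) by simp
      ultimately show "x \<in> {c * W..<c * W + W}" by (simp only: atLeastLessThan_iff) linarith
    qed
  qed simp
  finally show ?thesis by simp
qed

end

section \<open>A machine that carries out the tree summation with truncated unary counts\<close>

lemma min_sum_min:
  fixes f :: "'b \<Rightarrow> nat"
  assumes "finite A"
  shows "min M (\<Sum>j\<in>A. min M (f j)) = min M (\<Sum>j\<in>A. f j)"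
  using assms by (induction rule: finite_induct) auto

datatype ('a, 'l) tstate = TBos
  | TWord (ltr: 'a) (cur: "'l \<Rightarrow> bool") (prv: "'l \<Rightarrow> bool") (flag: bool) (psum: "nat \<Rightarrow> nat") (esum: "nat \<Rightarrow> nat")

fun tinit :: "'a option \<Rightarrow> ('a, 'l) tstate" where
  "tinit None = TBos"
| "tinit (Some a) = TWord a (\<lambda>_. False) (\<lambda>_. False) False (\<lambda>_. 0) (\<lambda>_. 0)"

datatype ('a, 'l) tfeat = FL 'a | FC 'l | FM 'l | FF | FP "nat \<times> nat" | FE "nat \<times> nat"

fun tfeature :: "('a, 'l) tstate \<Rightarrow> ('a, 'l) tfeat \<Rightarrow> bool" where
  "tfeature TBos c = False"
| "tfeature (TWord a \<theta> \<theta>' f P E) (FL x) = (x = a)"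
| "tfeature (TWord a \<theta> \<theta>' f P E) (FC l) = \<theta> l"
| "tfeature (TWord a \<theta> \<theta>' f P E) (FM l) = \<theta>' l"
| "tfeature (TWord a \<theta> \<theta>' f P E) FF = f"
| "tfeature (TWord a \<theta> \<theta>' f P E) (FP x) = (snd x \<le> P (fst x))"
| "tfeature (TWord a \<theta> \<theta>' f P E) (FE x) = (snd x \<le> E (fst x))"

text \<open>\<open>loc\<close> is the slot of a threshold within its batch. All batches reuse the
  same \<open>\<beta>\<close> slots, so unary counts take only about \<open>\<beta> * K\<close>
  coordinates.\<close>

locale batched_system = threshold_system I u kap K bt th
  for I :: "'l set" and u :: "'l \<Rightarrow> 'a::finite \<Rightarrow> ('l \<Rightarrow> bool) \<Rightarrow> nat"
    and kap :: "'l \<Rightarrow> nat" and K :: nat and bt :: "'l \<Rightarrow> nat" and th :: "'a list \<Rightarrow> nat \<Rightarrow> 'l \<Rightarrow> bool" +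
  fixes loc :: "'l \<Rightarrow> nat" and \<beta> W :: nat
  assumes \<beta>: "\<beta> \<ge> 1" and W: "W \<ge> 1"
    and loc_less: "\<And>l. l \<in> I \<Longrightarrow> loc l < \<beta>"
    and loc_inj: "\<And>l l'. l \<in> I \<Longrightarrow> l' \<in> I \<Longrightarrow> bt l = bt l' \<Longrightarrow> loc l = loc l' \<Longrightarrow> l = l'"
begin

text \<open>Twice \<open>K\<close>, because a count is compared with \<open>kap l\<close> and also,
  to recover the truth value one position earlier, with \<open>kap l\<close> plus the own
  contribution.\<close>

abbreviation MM :: nat where "MM \<equiv> 2 * K"

text \<open>The thresholds before position \<open>i\<close> is read; at \<open>i = 0\<close> the sum
  is empty, so \<open>kap l = 0\<close> decides.\<close>

definition thp :: "'a list \<Rightarrow> nat \<Rightarrow> 'l \<Rightarrow> bool" where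
  "thp w i l = (if i = 0 then kap l = 0 else th w (i - 1) l)"

text \<open>At most one summand, by \<open>loc_inj\<close>; the form as a sum gives empty slots the
  value \<open>0\<close>.\<close>

definition ub :: "nat \<Rightarrow> nat \<Rightarrow> 'a \<Rightarrow> ('l \<Rightarrow> bool) \<Rightarrow> nat" where
  "ub b y a \<theta> = (\<Sum>l | l \<in> I \<and> bt l = b \<and> loc l = y. u l a \<theta>)"

definition tV :: "(nat \<times> nat) set" where "tV = {..<\<beta>} \<times> {1..Suc MM}"
definition tQ :: "(nat \<times> 'a option) set" where "tQ = {..card I} \<times> UNIV"
definition tVS :: "('a, 'l) tstate set" where
  "tVS = insert TBos {TWord a \<theta> \<theta>' f P E | a \<theta> \<theta>' f P E. (\<forall>l. \<theta> l \<longrightarrow> l \<in> I) \<and> (\<forall>l. \<theta>' l \<longrightarrow> l \<in> I) \<and>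
     (\<forall>y. P y \<le> MM \<and> E y \<le> MM \<and> (y \<ge> \<beta> \<longrightarrow> P y = 0 \<and> E y = 0))}"
definition tC :: "('a, 'l) tfeat set" where
  "tC = range FL \<union> FC ` I \<union> FM ` I \<union> {FF} \<union> FP ` ({..<\<beta>} \<times> {1..MM}) \<union> FE ` ({..<\<beta>} \<times> {1..MM})"

text \<open>Reads off sums in unary, one threshold test per possible value up to \<open>2 * K + 1\<close>.\<close>

definition glayer ::
  "(('a, 'l) tstate \<Rightarrow> nat \<times> 'a option) \<Rightarrow> (('a, 'l) tstate \<Rightarrow> (nat \<times> 'a option) key) \<Rightarrow>
   (('a, 'l) tstate \<Rightarrow> nat \<Rightarrow> nat) \<Rightarrow> (('a, 'l) tstate \<Rightarrow> (nat \<Rightarrow> nat) \<Rightarrow> ('a, 'l) tstate) \<Rightarrow>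
   (('a, 'l) tstate, nat \<times> 'a option, nat \<times> nat) mlayer" where
  "glayer q k val upd =
    (\<lambda>\<sigma>. if \<sigma> = TBos then (0, None) else q \<sigma>,
     \<lambda>\<sigma>. if \<sigma> = TBos then KAll else k \<sigma>,
     \<lambda>\<sigma> v. if \<sigma> = TBos then - int (snd v) else int (val \<sigma> (fst v)),
     \<lambda>\<sigma> r. if \<sigma> = TBos then TBos
           else upd \<sigma> (\<lambda>y. if y < \<beta> then card {g \<in> {1..Suc MM}. \<not> r (y, g)} else 0))"

lemma glayer_0: "H 0 = TBos \<Longrightarrow> mstep s tV (glayer q k val upd) H 0 = TBos"
  by (simp add: glayer_def)

text \<open>An overflow makes every test report its threshold as met, hence the readout
  \<open>Suc MM\<close>. So the capacity may be exceeded wherever the true sum is that large anyway,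
  as can happen in the class layer.\<close>

lemma glayer_Suc:
  assumes H: "H 0 = TBos" "\<And>j. j \<le> i \<Longrightarrow> H (Suc j) \<noteq> TBos"
    and Z: "\<And>j. j \<le> i \<Longrightarrow> matches (q (H (Suc i))) (k (H (Suc j))) \<longleftrightarrow> Z j"
    and val: "\<And>j y. j \<le> i \<Longrightarrow> Z j \<Longrightarrow> y < \<beta> \<Longrightarrow> val (H (Suc j)) y = f j y"
    and cap: "\<And>y. y < \<beta> \<Longrightarrow> Suc (card {j. j \<le> i \<and> Z j}) \<le> 2 ^ s \<or> Suc MM \<le> (\<Sum>j | j \<le> i \<and> Z j. f j y)"
  shows "mstep s tV (glayer q k val upd) H (Suc i) =
    upd (H (Suc i)) (\<lambda>y. if y < \<beta> then min (Suc MM) (\<Sum>j | j \<le> i \<and> Z j. f j y) else 0)"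
proof -
  let ?G = "{j. j \<le> i \<and> Z j}"
  let ?r = "\<lambda>v. v \<in> tV \<and> Suc (card ?G) \<le> 2 ^ s \<and> - int (snd v) + (\<Sum>j\<in>?G. int (f j (fst v))) < 0"
  have r: "\<not> ?r (y, g) \<longleftrightarrow> g \<le> (\<Sum>j\<in>?G. f j y)" if "y < \<beta>" "g \<in> {1..Suc MM}" for y g
  proof -
    have "(\<Sum>j\<in>?G. int (f j y)) = int (\<Sum>j\<in>?G. f j y)" by simp
    then have "- int g + (\<Sum>j\<in>?G. int (f j y)) < 0 \<longleftrightarrow> \<not> g \<le> (\<Sum>j\<in>?G. f j y)" by linarith
    then show ?thesis using that cap[OF that(1)] by (auto simp: tV_def)
  qed
  have count: "card {g \<in> {1..Suc MM}. \<not> ?r (y, g)} = min (Suc MM) (\<Sum>j\<in>?G. f j y)" if "y < \<beta>" for y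
  proof -
    have "{g \<in> {1..Suc MM}. \<not> ?r (y, g)} = {g \<in> {1..Suc MM}. g \<le> (\<Sum>j\<in>?G. f j y)}"
      using r[OF that] by blast
    also have "\<dots> = {1..min (Suc MM) (\<Sum>j\<in>?G. f j y)}" by auto
    finally show ?thesis by simp
  qed
  have "mstep s tV (glayer q k val upd) H (Suc i) =
    upd (H (Suc i)) (\<lambda>y. if y < \<beta> then card {g \<in> {1..Suc MM}. \<not> ?r (y, g)} else 0)"
    unfolding glayer_def
    by (subst mstep_Suc[where Z = Z and val = "\<lambda>j v. int (f j (fst v))"])
      (auto simp: tV_def H Z val cong: if_cong)
  also have "(\<lambda>y. if y < \<beta> then card {g \<in> {1..Suc MM}. \<not> ?r (y, g)} else 0)
    = (\<lambda>y. if y < \<beta> then min (Suc MM) (\<Sum>j\<in>?G. f j y) else 0)"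
    using count by auto
  finally show ?thesis .
qed

definition glead :: "nat \<Rightarrow> nat \<Rightarrow> ('a, 'l) tstate \<Rightarrow> bool" where
  "glead b h \<sigma> \<longleftrightarrow> pot b (prv \<sigma>) div W ^ h \<noteq> pot b (cur \<sigma>) div W ^ h"

definition set_psum :: "('a, 'l) tstate \<Rightarrow> (nat \<Rightarrow> nat) \<Rightarrow> ('a, 'l) tstate" where
  "set_psum \<sigma> P = TWord (ltr \<sigma>) (cur \<sigma>) (prv \<sigma>) (flag \<sigma>) (\<lambda>y. min MM (P y)) (esum \<sigma>)"

definition set_esum :: "('a, 'l) tstate \<Rightarrow> (nat \<Rightarrow> nat) \<Rightarrow> ('a, 'l) tstate" where
  "set_esum \<sigma> P = TWord (ltr \<sigma>) (cur \<sigma>) (prv \<sigma>) (flag \<sigma>) (psum \<sigma>) (\<lambda>y. min MM (P y))"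

definition class_tlayer where
  "class_tlayer b = glayer (\<lambda>\<sigma>. (pot b (cur \<sigma>), Some (ltr \<sigma>))) (\<lambda>\<sigma>. KCls (pot b (cur \<sigma>), Some (ltr \<sigma>)))
    (\<lambda>\<sigma> y. 1) (\<lambda>\<sigma> r. TWord (ltr \<sigma>) (cur \<sigma>) (prv \<sigma>) (r 0 \<le> MM) (\<lambda>_. 0) (\<lambda>_. 0))"

text \<open>With \<open>sel = cur\<close> a position asks for its own phase, with
  \<open>sel = prv\<close> for the phase just before it, whose total a leader has to know.\<close>

definition base_layer where
  "base_layer sel upd b = glayer (\<lambda>\<sigma>. (pot b (sel \<sigma>), None))
    (\<lambda>\<sigma>. if flag \<sigma> then KCls (pot b (cur \<sigma>), None) else KNone)
    (\<lambda>\<sigma> y. ub b y (ltr \<sigma>) (cur \<sigma>)) upd"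

text \<open>Only leaders of level \<open>h\<close> that do not lead level \<open>Suc h\<close> are
  visible; through \<open>esum\<close> each contributes the total of the group that ended just
  before it.\<close>

definition up_layer where
  "up_layer sel upd b h = glayer (\<lambda>\<sigma>. (pot b (sel \<sigma>) div W ^ Suc h, None))
    (\<lambda>\<sigma>. if glead b h \<sigma> \<and> \<not> glead b (Suc h) \<sigma> then KCls (pot b (cur \<sigma>) div W ^ Suc h, None) else KNone)
    (\<lambda>\<sigma>. esum \<sigma>) upd"

text \<open>At the root \<open>psum\<close> is the whole prefix sum, cut off at \<open>MM\<close>,
  so the thresholds of the batch are decided locally and no word position is attended.\<close>

definition final_layer where
  "final_layer b = glayer (\<lambda>\<sigma>. (0, None)) (\<lambda>\<sigma>. KNone) (\<lambda>\<sigma> y. 0)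
    (\<lambda>\<sigma> r. TWord (ltr \<sigma>)
       (\<lambda>l. cur \<sigma> l \<or> l \<in> I \<and> bt l = b \<and> kap l \<le> psum \<sigma> (loc l))
       (\<lambda>l. prv \<sigma> l \<or> l \<in> I \<and> bt l = b \<and> kap l + u l (ltr \<sigma>) (cur \<sigma>) \<le> psum \<sigma> (loc l))
       False (\<lambda>_. 0) (\<lambda>_. 0))"

text \<open>At each level \<open>psum\<close> is raised before \<open>esum\<close>, because both
  updates must read the \<open>esum\<close> of the lower level.\<close>

definition tree_layers :: "nat \<Rightarrow> nat \<Rightarrow> (('a, 'l) tstate, nat \<times> 'a option, nat \<times> nat) mlayer list" where
  "tree_layers X b = [class_tlayer b, base_layer cur set_psum b, base_layer prv set_esum b] @
    concat (map (\<lambda>h. [up_layer cur (\<lambda>\<sigma> r. set_psum \<sigma> (\<lambda>y. psum \<sigma> y + r y)) b h,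
                      up_layer prv (\<lambda>\<sigma> r. set_esum \<sigma> (\<lambda>y. esum \<sigma> y + r y)) b h]) [0..<X]) @
    [final_layer b]"


lemma ub_loc: "l \<in> I \<Longrightarrow> ub (bt l) (loc l) a \<theta> = u l a \<theta>"
proof -
  assume l: "l \<in> I"
  have "{l'. l' \<in> I \<and> bt l' = bt l \<and> loc l' = loc l} = {l}" using l loc_inj by auto
  then show ?thesis by (simp add: ub_def)
qed

lemma ub_cases:
  obtains l where "l \<in> I" "bt l = b" "ub b y = u l" | "\<And>a \<theta>. ub b y a \<theta> = 0"
proof (cases "\<exists>l\<in>I. bt l = b \<and> loc l = y")
  case True
  then obtain l where "l \<in> I" "bt l = b" "loc l = y" by blast
  then show ?thesis using that(1)[of l] ub_loc[of l] by (auto simp: fun_eq_iff)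
next
  case False
  then have "{l. l \<in> I \<and> bt l = b \<and> loc l = y} = {}" by auto
  then have "ub b y a \<theta> = 0" for a \<theta> unfolding ub_def by (simp only: sum.empty)
  then show ?thesis by (rule that(2))
qed

lemma ub_le: "ub b y a \<theta> \<le> K"
  by (rule ub_cases[of b y]) (auto simp: u_le)

lemma ub_below: "ub b y a (below b \<theta>) = ub b y a \<theta>"
  by (rule ub_cases[of b y]) (auto simp: u_below)

lemma sum_imp_ub:
  assumes "i < length w"
  shows "min M (\<Sum>j | j \<le> i \<and> Z (pot b (th w j)). ub b y (w ! j) (th w j)) =
         min M (\<Sum>j | j \<le> i \<and> Z (pot b (th w j)) \<and> imp M b w j. ub b y (w ! j) (th w j))"
proof (rule ub_cases[of b y])
  fix l assume "l \<in> I" "bt l = b" "ub b y = u l"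
  then show ?thesis using sum_imp[OF _ _ assms, of l b M Z] by simp
qed simp

lemma monotone_pot:
  "monotone_potential (\<lambda>i. pot b (th w i)) (\<lambda>i. pot b (thp w i)) (length w)"
proof
  have "thp w (Suc i) = th w i" for i by (auto simp: thp_def)
  then show "pot b (thp w (Suc i)) = pot b (th w i)" for i by simp
qed (rule pot_mono)

definition val_at :: "nat \<Rightarrow> 'a list \<Rightarrow> nat \<Rightarrow> nat \<Rightarrow> nat" where
  "val_at b w y j = ub b y (w ! j) (th w j)"

definition stored_block :: "nat \<Rightarrow> 'a list \<Rightarrow> nat \<Rightarrow> nat \<Rightarrow> nat \<Rightarrow> nat" where
  "stored_block b w h i y = (if y < \<beta> then min MM (block_sum W (\<lambda>i. pot b (th w i)) (val_at b w y) h i) else 0)"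

definition stored_prev :: "nat \<Rightarrow> 'a list \<Rightarrow> nat \<Rightarrow> nat \<Rightarrow> nat \<Rightarrow> nat" where
  "stored_prev b w h i y = (if y < \<beta>
     then min MM (prev_sum W (\<lambda>i. pot b (th w i)) (\<lambda>i. pot b (thp w i)) (val_at b w y) h i) else 0)"

definition tinv :: "nat \<Rightarrow> 'a list \<Rightarrow> (nat \<Rightarrow> ('a, 'l) tstate) \<Rightarrow> bool" where
  "tinv b w H \<longleftrightarrow> H 0 = TBos \<and> (\<forall>i<length w.
     H (Suc i) = TWord (w ! i) (below b (th w i)) (below b (thp w i)) False (\<lambda>_. 0) (\<lambda>_. 0))"

text \<open>\<open>E\<close> is constrained at leaders of level \<open>h\<close> only; leaders of
  all higher levels are among them.\<close>

definition tstage :: "nat \<Rightarrow> 'a list \<Rightarrow> nat \<Rightarrow> (nat \<Rightarrow> ('a, 'l) tstate) \<Rightarrow> bool" where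
  "tstage b w h H \<longleftrightarrow> H 0 = TBos \<and> (\<forall>i<length w. \<exists>f E.
     H (Suc i) = TWord (w ! i) (below b (th w i)) (below b (thp w i)) f (stored_block b w h i) E \<and>
     (lead W (\<lambda>i. pot b (th w i)) (\<lambda>i. pot b (thp w i)) h i \<longrightarrow> E = stored_prev b w h i))"

lemma min_min_Suc: "min M (min (Suc M) x) = min M (x :: nat)"
  by (simp add: min_def)

lemma tstage_base:
  assumes inv: "tinv b w H" and s: "Suc MM \<le> 2 ^ s" "Suc (card (UNIV :: 'a set) * MM) \<le> 2 ^ s"
  shows "tstage b w 0 (mrun s tV [class_tlayer b, base_layer cur set_psum b, base_layer prv set_esum b] H)"
proof -
  let ?S = "\<lambda>i. pot b (th w i)" and ?S' = "\<lambda>i. pot b (thp w i)"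
  define H1 where "H1 = mstep s tV (class_tlayer b) H"
  define H2 where "H2 = mstep s tV (base_layer cur set_psum b) H1"
  define H3 where "H3 = mstep s tV (base_layer prv set_esum b) H2"
  have H0: "H 0 = TBos" and HS: "\<And>i. i < length w \<Longrightarrow>
      H (Suc i) = TWord (w ! i) (below b (th w i)) (below b (thp w i)) False (\<lambda>_. 0) (\<lambda>_. 0)"
    using inv by (auto simp: tinv_def)
  have H10: "H1 0 = TBos" unfolding H1_def class_tlayer_def by (rule glayer_0) (rule H0)
  have H20: "H2 0 = TBos" unfolding H2_def base_layer_def by (rule glayer_0) (rule H10)
  have H30: "H3 0 = TBos" unfolding H3_def base_layer_def by (rule glayer_0) (rule H20)
  have H1S: "H1 (Suc i) = TWord (w ! i) (below b (th w i)) (below b (thp w i)) (imp MM b w i) (\<lambda>_. 0) (\<lambda>_. 0)"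
    if i: "i < length w" for i
  proof -
    let ?Z = "\<lambda>j. ?S j = ?S i \<and> w ! j = w ! i"
    have "H1 (Suc i) = TWord (w ! i) (below b (th w i)) (below b (thp w i))
        (min (Suc MM) (\<Sum>j | j \<le> i \<and> ?Z j. 1) \<le> MM) (\<lambda>_. 0) (\<lambda>_. 0)"
      unfolding H1_def class_tlayer_def
      by (subst glayer_Suc[where Z = ?Z and f = "\<lambda>_ _. 1"]) (use i s \<beta> in \<open>auto simp: H0 HS\<close>)
    then show ?thesis by (simp add: imp_def min_le_iff_disj)
  qed
  \<comment> \<open>A base layer attends a single phase, so the number of phases does not enter the
    capacity.\<close>
  have cap: "Suc (card {j. j \<le> i \<and> ?S j = x \<and> imp MM b w j}) \<le> 2 ^ s" for i x
  proof -
    have "(\<lambda>j. ?S j) ` {j. j \<le> i \<and> ?S j = x} \<subseteq> {x}" by auto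
    then have "card ((\<lambda>j. ?S j) ` {j. j \<le> i \<and> ?S j = x}) \<le> card {x}" by (intro card_mono) auto
    then have "card ((\<lambda>j. ?S j) ` {j. j \<le> i \<and> ?S j = x}) * (card (UNIV :: 'a set) * MM) \<le> 1 * (card (UNIV :: 'a set) * MM)"
      by (intro mult_le_mono1) simp
    then show ?thesis using card_imp_le[of i "\<lambda>z. z = x" b w MM] s(2) by linarith
  qed
  have H2S: "H2 (Suc i) = TWord (w ! i) (below b (th w i)) (below b (thp w i)) (imp MM b w i)
      (stored_block b w 0 i) (\<lambda>_. 0)" if i: "i < length w" for i
  proof -
    let ?Z = "\<lambda>j. ?S j = ?S i \<and> imp MM b w j"
    have "H2 (Suc i) = TWord (w ! i) (below b (th w i)) (below b (thp w i)) (imp MM b w i)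
      (\<lambda>y. min MM (if y < \<beta> then min (Suc MM) (\<Sum>j | j \<le> i \<and> ?Z j. val_at b w y j) else 0)) (\<lambda>_. 0)"
      unfolding H2_def base_layer_def
      by (subst glayer_Suc[where Z = ?Z and f = "\<lambda>j y. val_at b w y j"])
        (use i cap in \<open>auto simp: H10 H1S set_psum_def val_at_def ub_below\<close>)
    also have "(\<lambda>y. min MM (if y < \<beta> then min (Suc MM) (\<Sum>j | j \<le> i \<and> ?Z j. val_at b w y j) else 0))
      = stored_block b w 0 i"
    proof
      fix y
      show "min MM (if y < \<beta> then min (Suc MM) (\<Sum>j | j \<le> i \<and> ?Z j. val_at b w y j) else 0) = stored_block b w 0 i y"
        using sum_imp_ub[OF i, where M = MM and Z = "\<lambda>z. z = ?S i" and b = b and y = y]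
        by (simp add: stored_block_def block_sum_def val_at_def min_min_Suc)
    qed
    finally show ?thesis .
  qed
  have H3S: "\<exists>E. H3 (Suc i) = TWord (w ! i) (below b (th w i)) (below b (thp w i)) (imp MM b w i)
      (stored_block b w 0 i) E \<and> (lead W ?S ?S' 0 i \<longrightarrow> E = stored_prev b w 0 i)" if i: "i < length w" for i
  proof -
    let ?Z = "\<lambda>j. ?S j = ?S' i \<and> imp MM b w j"
    let ?E = "\<lambda>y. min MM (if y < \<beta> then min (Suc MM) (\<Sum>j | j \<le> i \<and> ?Z j. val_at b w y j) else 0)"
    have "H3 (Suc i) = TWord (w ! i) (below b (th w i)) (below b (thp w i)) (imp MM b w i) (stored_block b w 0 i) ?E"
      unfolding H3_def base_layer_def
      by (subst glayer_Suc[where Z = ?Z and f = "\<lambda>j y. val_at b w y j"])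
        (use i cap in \<open>auto simp: H20 H2S set_esum_def val_at_def ub_below\<close>)
    moreover have "?E = stored_prev b w 0 i" if "lead W ?S ?S' 0 i"
    proof
      fix y
      have "{j. j \<le> i \<and> ?S j = ?S' i} = {j. j < i \<and> ?S j = ?S' i}"
        using that by (auto simp: lead_def le_less)
      then show "?E y = stored_prev b w 0 i y"
        using sum_imp_ub[OF i, where M = MM and Z = "\<lambda>z. z = ?S' i" and b = b and y = y]
        by (simp add: stored_prev_def prev_sum_def val_at_def min_min_Suc)
    qed
    ultimately show ?thesis by blast
  qed
  show ?thesis using H30 H3S unfolding tstage_def H3_def H2_def H1_def mrun_Cons mrun_Nil by blast
qed

text \<open>Truncated summands determine the truncated sum, so the stored counts suffice at every
  level.\<close>

lemma min_combine:
  fixes a x y M :: nat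
  assumes "min M x = min M y"
  shows "min M (min M a + min (Suc M) x) = min M (a + y)"
  using assms by (auto simp: min_def split: if_splits)

lemma tstage_up:
  assumes st: "tstage b w h H" and s: "Suc W \<le> 2 ^ s"
  shows "tstage b w (Suc h) (mrun s tV
    [up_layer cur (\<lambda>\<sigma> r. set_psum \<sigma> (\<lambda>y. psum \<sigma> y + r y)) b h,
     up_layer prv (\<lambda>\<sigma> r. set_esum \<sigma> (\<lambda>y. esum \<sigma> y + r y)) b h] H)"
proof -
  let ?S = "\<lambda>i. pot b (th w i)" and ?S' = "\<lambda>i. pot b (thp w i)"
  interpret mp: monotone_potential ?S ?S' "length w" W by (rule monotone_pot)
  define H1 where "H1 = mstep s tV (up_layer cur (\<lambda>\<sigma> r. set_psum \<sigma> (\<lambda>y. psum \<sigma> y + r y)) b h) H"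
  define H2 where "H2 = mstep s tV (up_layer prv (\<lambda>\<sigma> r. set_esum \<sigma> (\<lambda>y. esum \<sigma> y + r y)) b h) H1"
  define f where "f i = flag (H (Suc i))" for i
  define E where "E i = esum (H (Suc i))" for i
  have H0: "H 0 = TBos" and HS: "\<And>i. i < length w \<Longrightarrow>
      H (Suc i) = TWord (w ! i) (below b (th w i)) (below b (thp w i)) (f i) (stored_block b w h i) (E i)"
    and E: "\<And>i. i < length w \<Longrightarrow> lead W ?S ?S' h i \<Longrightarrow> E i = stored_prev b w h i"
    using st unfolding tstage_def f_def E_def by force+
  have H10: "H1 0 = TBos" unfolding H1_def up_layer_def by (rule glayer_0) (rule H0)
  have H20: "H2 0 = TBos" unfolding H2_def up_layer_def by (rule glayer_0) (rule H10)
  have gl: "glead b h' (TWord a (below b (th w i)) (below b (thp w i)) f' P' E') \<longleftrightarrow> lead W ?S ?S' h' i"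
    for h' a i f' P' E' by (simp add: glead_def lead_def)
  have cap: "Suc (card {j. j \<le> i \<and> mp.inner_lead h j \<and> ?S j div W ^ Suc h = c}) \<le> 2 ^ s"
    if "i < length w" for i c
    using mp.card_inner_lead[OF that, of h c] W s by linarith
  have sums: "min MM (\<Sum>j | j \<le> i \<and> mp.inner_lead h j \<and> ?S j div W ^ Suc h = c. E j y) =
      min MM (\<Sum>j | j \<le> i \<and> mp.inner_lead h j \<and> ?S j div W ^ Suc h = c. prev_sum W ?S ?S' (val_at b w y) h j)"
    if "i < length w" "y < \<beta>" for i c y
  proof -
    have "(\<Sum>j | j \<le> i \<and> mp.inner_lead h j \<and> ?S j div W ^ Suc h = c. E j y) =
      (\<Sum>j | j \<le> i \<and> mp.inner_lead h j \<and> ?S j div W ^ Suc h = c. min MM (prev_sum W ?S ?S' (val_at b w y) h j))"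
      using that E by (intro sum.cong) (auto simp: mp.inner_lead_def stored_prev_def)
    then show ?thesis by (simp add: min_sum_min)
  qed
  have H1S: "H1 (Suc i) = TWord (w ! i) (below b (th w i)) (below b (thp w i)) (f i) (stored_block b w (Suc h) i) (E i)"
    if i: "i < length w" for i
  proof -
    let ?Z = "\<lambda>j. mp.inner_lead h j \<and> ?S j div W ^ Suc h = ?S i div W ^ Suc h"
    have "H1 (Suc i) = TWord (w ! i) (below b (th w i)) (below b (thp w i)) (f i)
      (\<lambda>y. min MM (stored_block b w h i y + (if y < \<beta> then min (Suc MM) (\<Sum>j | j \<le> i \<and> ?Z j. E j y) else 0))) (E i)"
      unfolding H1_def up_layer_def
      by (subst glayer_Suc[where Z = ?Z and f = "\<lambda>j y. E j y"])
        (use i cap in \<open>auto simp: H0 HS set_psum_def gl mp.inner_lead_def simp del: power_Suc\<close>)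
    also have "(\<lambda>y. min MM (stored_block b w h i y + (if y < \<beta> then min (Suc MM) (\<Sum>j | j \<le> i \<and> ?Z j. E j y) else 0)))
      = stored_block b w (Suc h) i"
    proof
      fix y
      show "min MM (stored_block b w h i y + (if y < \<beta> then min (Suc MM) (\<Sum>j | j \<le> i \<and> ?Z j. E j y) else 0))
        = stored_block b w (Suc h) i y"
        using min_combine[OF sums[OF i], of y] mp.block_sum_up[OF i, of "val_at b w y" h]
        by (simp add: stored_block_def del: power_Suc)
    qed
    finally show ?thesis .
  qed
  have H2S: "\<exists>E'. H2 (Suc i) = TWord (w ! i) (below b (th w i)) (below b (thp w i)) (f i)
      (stored_block b w (Suc h) i) E' \<and> (lead W ?S ?S' (Suc h) i \<longrightarrow> E' = stored_prev b w (Suc h) i)"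
    if i: "i < length w" for i
  proof -
    let ?Z = "\<lambda>j. mp.inner_lead h j \<and> ?S j div W ^ Suc h = ?S' i div W ^ Suc h"
    let ?E = "\<lambda>y. min MM (E i y + (if y < \<beta> then min (Suc MM) (\<Sum>j | j \<le> i \<and> ?Z j. E j y) else 0))"
    have "H2 (Suc i) = TWord (w ! i) (below b (th w i)) (below b (thp w i)) (f i) (stored_block b w (Suc h) i) ?E"
      unfolding H2_def up_layer_def
      by (subst glayer_Suc[where Z = ?Z and f = "\<lambda>j y. E j y"])
        (use i cap in \<open>auto simp: H10 H1S set_esum_def gl mp.inner_lead_def simp del: power_Suc\<close>)
    moreover have "?E = stored_prev b w (Suc h) i" if ld: "lead W ?S ?S' (Suc h) i"
    proof
      fix y
      have "lead W ?S ?S' h i" using ld by (auto simp: lead_def power_Suc2 div_mult2_eq simp del: power_Suc)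
      then have "E i = stored_prev b w h i" using E[OF i] by simp
      then show "?E y = stored_prev b w (Suc h) i y"
        using min_combine[OF sums[OF i], of y] mp.prev_sum_up[OF i ld, of "val_at b w y"]
        by (simp add: stored_prev_def del: power_Suc)
    qed
    ultimately show ?thesis by blast
  qed
  show ?thesis using H20 H2S unfolding tstage_def by (force simp: H2_def H1_def)
qed

lemma tinv_final:
  assumes st: "tstage b w X H" and X: "card I < W ^ X"
  shows "tinv (Suc b) w (mstep s tV (final_layer b) H)"
proof -
  let ?S = "\<lambda>i. pot b (th w i)"
  define H1 where "H1 = mstep s tV (final_layer b) H"
  have H0: "H 0 = TBos" using st by (simp add: tstage_def)
  have H10: "H1 0 = TBos" unfolding H1_def final_layer_def by (rule glayer_0) (rule H0)
  have HS: "\<exists>f E. H (Suc i) = TWord (w ! i) (below b (th w i)) (below b (thp w i)) f (stored_block b w X i) E"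
    if "i < length w" for i using st that unfolding tstage_def by blast
  have "H1 (Suc i) = TWord (w ! i) (below (Suc b) (th w i)) (below (Suc b) (thp w i)) False (\<lambda>_. 0) (\<lambda>_. 0)"
    if i: "i < length w" for i
  proof -
    have block: "stored_block b w X i (loc l) = min MM (\<Sum>j\<le>i. u l (w ! j) (th w j))" if l: "l \<in> I" "bt l = b" for l
    proof -
      \<comment> \<open>The potential never exceeds \<open>card I\<close>, so level \<open>X\<close>
        consists of a single group, the whole word.\<close>
      have "?S j div W ^ X = 0" for j using pot_le[of b "th w j"] X by (simp add: div_less)
      then show ?thesis
        using loc_less[OF l(1)] ub_loc[OF l(1)] l(2)
        by (simp add: stored_block_def block_sum_def val_at_def atMost_def)
    qed
    have 1: "kap l \<le> stored_block b w X i (loc l) \<longleftrightarrow> th w i l" if l: "l \<in> I" "bt l = b" for l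
      using block[OF l] th[OF l(1) i] kap[OF l(1)] by auto
    have 2: "kap l + u l (w ! i) (below b (th w i)) \<le> stored_block b w X i (loc l) \<longleftrightarrow> thp w i l"
      if l: "l \<in> I" "bt l = b" for l
    proof -
      have "kap l + u l (w ! i) (th w i) \<le> MM" using kap[OF l(1)] u_le[of l "w ! i" "th w i"] by simp
      then have "kap l + u l (w ! i) (th w i) \<le> stored_block b w X i (loc l) \<longleftrightarrow>
          kap l + u l (w ! i) (th w i) \<le> (\<Sum>j\<le>i. u l (w ! j) (th w j))"
        using block[OF l] by auto
      also have "\<dots> \<longleftrightarrow> thp w i l"
        using th[OF l(1)] i by (cases i) (auto simp: thp_def)
      finally show ?thesis using u_below[OF l] by simp
    qed
    obtain f E where Hi: "H (Suc i) = TWord (w ! i) (below b (th w i)) (below b (thp w i)) f (stored_block b w X i) E"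
      using HS[OF i] by blast
    have ne: "H (Suc j) \<noteq> TBos" if "j \<le> i" for j using HS[of j] that i by auto
    have "H1 (Suc i) = TWord (w ! i)
       (\<lambda>l. below b (th w i) l \<or> l \<in> I \<and> bt l = b \<and> kap l \<le> stored_block b w X i (loc l))
       (\<lambda>l. below b (thp w i) l \<or> l \<in> I \<and> bt l = b \<and> kap l + u l (w ! i) (below b (th w i)) \<le> stored_block b w X i (loc l))
       False (\<lambda>_. 0) (\<lambda>_. 0)"
      unfolding H1_def final_layer_def
      by (subst glayer_Suc[where Z = "\<lambda>_. False" and f = "\<lambda>_ _. 0"]) (use ne in \<open>auto simp: H0 Hi\<close>)
    also have "\<dots> = TWord (w ! i) (below (Suc b) (th w i)) (below (Suc b) (thp w i)) False (\<lambda>_. 0) (\<lambda>_. 0)"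
      using 1 2 by (auto simp: below_Suc intro!: ext)
    finally show ?thesis .
  qed
  then show ?thesis using H10 by (simp add: tinv_def H1_def)
qed

lemma tinv_batch:
  assumes inv: "tinv b w H" and s: "Suc (card (UNIV :: 'a set) * MM) \<le> 2 ^ s" "Suc W \<le> 2 ^ s"
    and X: "card I < W ^ X"
  shows "tinv (Suc b) w (mrun s tV (tree_layers X b) H)"
proof -
  have "1 * MM \<le> card (UNIV :: 'a set) * MM" using UNIV_pos by (intro mult_le_mono1) simp
  then have s0: "Suc MM \<le> 2 ^ s" using s(1) by linarith
  let ?ups = "\<lambda>X. concat (map (\<lambda>h. [up_layer cur (\<lambda>\<sigma> r. set_psum \<sigma> (\<lambda>y. psum \<sigma> y + r y)) b h,
                      up_layer prv (\<lambda>\<sigma> r. set_esum \<sigma> (\<lambda>y. esum \<sigma> y + r y)) b h]) [0..<X])"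
  let ?H = "mrun s tV [class_tlayer b, base_layer cur set_psum b, base_layer prv set_esum b] H"
  have "tstage b w h (mrun s tV (?ups h) ?H)" for h
  proof (induction h)
    case 0
    then show ?case using tstage_base[OF inv s0 s(1)] by simp
  next
    case (Suc h)
    then show ?case using tstage_up[OF Suc.IH s(2)] by (simp add: mrun_append)
  qed
  from tinv_final[OF this X] show ?thesis
    unfolding tree_layers_def mrun_append by simp
qed

lemma tinv_run:
  assumes inv: "tinv 0 w H" and s: "Suc (card (UNIV :: 'a set) * MM) \<le> 2 ^ s" "Suc W \<le> 2 ^ s"
    and X: "card I < W ^ X"
  shows "tinv N w (mrun s tV (concat (map (tree_layers X) [0..<N])) H)"
proof (induction N)
  case 0
  then show ?case using inv by simp
next
  case (Suc N)
  then show ?case using tinv_batch[OF Suc.IH s X] by (simp add: mrun_append)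
qed


lemma mlayer_ok_glayer:
  assumes p: "Suc MM < 2 ^ (p - 1)"
    and ok: "\<And>\<sigma>. \<sigma> \<in> tVS \<Longrightarrow> \<sigma> \<noteq> TBos \<Longrightarrow> q \<sigma> \<in> tQ \<and> set_key (k \<sigma>) \<subseteq> tQ \<and> (\<forall>y. val \<sigma> y \<le> MM) \<and>
      (\<forall>r. (\<forall>y\<ge>\<beta>. r y = 0) \<longrightarrow> upd \<sigma> r \<in> tVS)"
  shows "mlayer_ok p tQ tV tVS (glayer q k val upd)"
proof -
  have "int (Suc MM) < int (2 ^ (p - 1))" using p by (simp only: of_nat_less_iff)
  then have p': "int (Suc MM) < 2 ^ (p - 1)" by simp
  have val: "\<bar>int (val \<sigma> y)\<bar> < 2 ^ (p - 1)" if "\<sigma> \<in> tVS" "\<sigma> \<noteq> TBos" for \<sigma> y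
  proof -
    have "val \<sigma> y \<le> MM" using ok[OF that] by blast
    then show ?thesis using p' by linarith
  qed
  have bos: "\<bar>- int (snd v)\<bar> < 2 ^ (p - 1)" if "v \<in> tV" for v
  proof -
    have "snd v \<le> Suc MM" using that by (auto simp: tV_def)
    then show ?thesis using p' by linarith
  qed
  have "TBos \<in> tVS" "(0, None) \<in> tQ" by (auto simp: tVS_def tQ_def)
  then show ?thesis using ok val bos unfolding glayer_def mlayer_ok.simps by simp
qed

lemma mlayer_ok_tree:
  assumes p: "Suc MM < 2 ^ (p - 1)" and L: "L \<in> set (tree_layers X b)"
  shows "mlayer_ok p tQ tV tVS L"
proof -
  have q: "(pot b \<theta> div c, x) \<in> tQ" "(pot b \<theta>, x) \<in> tQ" "(0, None) \<in> tQ" for \<theta> c x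
    using pot_le[of b \<theta>] div_le_dividend[of "pot b \<theta>" c] by (auto simp: tQ_def simp del: div_le_dividend)
  have word: "\<exists>a \<theta> \<theta>' f P E. \<sigma> = TWord a \<theta> \<theta>' f P E \<and> (\<forall>l. \<theta> l \<longrightarrow> l \<in> I) \<and> (\<forall>l. \<theta>' l \<longrightarrow> l \<in> I) \<and>
     (\<forall>y. P y \<le> MM \<and> E y \<le> MM \<and> (y \<ge> \<beta> \<longrightarrow> P y = 0 \<and> E y = 0))" if "\<sigma> \<in> tVS" "\<sigma> \<noteq> TBos" for \<sigma>
    using that unfolding tVS_def by blast
  have VS: "TWord a \<theta> \<theta>' f P E \<in> tVS \<longleftrightarrow> (\<forall>l. \<theta> l \<longrightarrow> l \<in> I) \<and> (\<forall>l. \<theta>' l \<longrightarrow> l \<in> I) \<and>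
     (\<forall>y. P y \<le> MM \<and> E y \<le> MM \<and> (y \<ge> \<beta> \<longrightarrow> P y = 0 \<and> E y = 0))" for a \<theta> \<theta>' f P E
    unfolding tVS_def by blast
  have ub: "ub b y a \<theta> \<le> MM" for y a \<theta> using ub_le[of b y a \<theta>] by simp
  have "mlayer_ok p tQ tV tVS (class_tlayer b)"
    unfolding class_tlayer_def
    by (rule mlayer_ok_glayer[OF p], drule (1) word) (use q K in \<open>auto simp: VS\<close>)
  moreover have "mlayer_ok p tQ tV tVS (base_layer sel set_psum b)" for sel
    unfolding base_layer_def
    by (rule mlayer_ok_glayer[OF p], drule (1) word) (use q ub in \<open>auto simp: VS set_psum_def\<close>)
  moreover have "mlayer_ok p tQ tV tVS (base_layer sel set_esum b)" for sel
    unfolding base_layer_def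
    by (rule mlayer_ok_glayer[OF p], drule (1) word) (use q ub in \<open>auto simp: VS set_esum_def\<close>)
  moreover have "mlayer_ok p tQ tV tVS (up_layer sel (\<lambda>\<sigma> r. set_psum \<sigma> (\<lambda>y. psum \<sigma> y + r y)) b h)" for sel h
    unfolding up_layer_def
    by (rule mlayer_ok_glayer[OF p], drule (1) word) (use q in \<open>auto simp: VS set_psum_def simp del: power_Suc\<close>)
  moreover have "mlayer_ok p tQ tV tVS (up_layer sel (\<lambda>\<sigma> r. set_esum \<sigma> (\<lambda>y. esum \<sigma> y + r y)) b h)" for sel h
    unfolding up_layer_def
    by (rule mlayer_ok_glayer[OF p], drule (1) word) (use q in \<open>auto simp: VS set_esum_def simp del: power_Suc\<close>)
  moreover have "mlayer_ok p tQ tV tVS (final_layer b)"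
    unfolding final_layer_def
    by (rule mlayer_ok_glayer[OF p], drule (1) word) (use q in \<open>auto simp: VS\<close>)
  ultimately show ?thesis using L unfolding tree_layers_def by auto
qed

lemma eq_if_thresholds_eq:
  fixes x y M :: nat
  assumes "x \<le> M" "y \<le> M" "\<And>g. g \<in> {1..M} \<Longrightarrow> g \<le> x \<longleftrightarrow> g \<le> y"
  shows "x = y"
  using assms(1,2) assms(3)[of x] assms(3)[of y] by (cases "x = 0"; cases "y = 0") auto

lemma tfeature_inj:
  assumes "\<sigma> \<in> tVS" "\<tau> \<in> tVS" and eq: "\<And>c. c \<in> tC \<Longrightarrow> tfeature \<sigma> c = tfeature \<tau> c"
  shows "\<sigma> = \<tau>"
proof -
  have L: "tfeature \<sigma> (FL x) = tfeature \<tau> (FL x)" for x using eq[of "FL x"] by (auto simp: tC_def)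
  show ?thesis
  proof (cases \<sigma>)
    case TBos
    then show ?thesis using L by (cases \<tau>) auto
  next
    case \<sigma>: (TWord a \<theta> \<theta>' f P E)
    show ?thesis
    proof (cases \<tau>)
      case TBos
      then show ?thesis using L[of a] \<sigma> by simp
    next
      case \<tau>: (TWord a2 \<theta>2 \<theta>2' f2 P2 E2)
      have "a = a2" using L[of a] \<sigma> \<tau> by simp
      moreover have "\<theta> = \<theta>2"
      proof
        fix l show "\<theta> l = \<theta>2 l"
          using assms(1,2) eq[of "FC l"] \<sigma> \<tau> by (cases "l \<in> I") (auto simp: tVS_def tC_def)
      qed
      moreover have "\<theta>' = \<theta>2'"
      proof
        fix l show "\<theta>' l = \<theta>2' l"
          using assms(1,2) eq[of "FM l"] \<sigma> \<tau> by (cases "l \<in> I") (auto simp: tVS_def tC_def)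
      qed
      moreover have "f = f2" using eq[of FF] \<sigma> \<tau> by (simp add: tC_def)
      moreover have "P = P2"
      proof
        fix y
        have b: "P y \<le> MM" "P2 y \<le> MM" "y \<ge> \<beta> \<Longrightarrow> P y = 0 \<and> P2 y = 0"
          using assms(1,2) \<sigma> \<tau> by (auto simp: tVS_def)
        show "P y = P2 y"
        proof (cases "y < \<beta>")
          case True
          have "g \<le> P y \<longleftrightarrow> g \<le> P2 y" if "g \<in> {1..MM}" for g
            using eq[of "FP (y, g)"] that True \<sigma> \<tau> by (auto simp: tC_def)
          then show ?thesis by (rule eq_if_thresholds_eq[OF b(1,2)])
        qed (use b(3) in simp)
      qed
      moreover have "E = E2"
      proof
        fix y
        have b: "E y \<le> MM" "E2 y \<le> MM" "y \<ge> \<beta> \<Longrightarrow> E y = 0 \<and> E2 y = 0"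
          using assms(1,2) \<sigma> \<tau> by (auto simp: tVS_def)
        show "E y = E2 y"
        proof (cases "y < \<beta>")
          case True
          have "g \<le> E y \<longleftrightarrow> g \<le> E2 y" if "g \<in> {1..MM}" for g
            using eq[of "FE (y, g)"] that True \<sigma> \<tau> by (auto simp: tC_def)
          then show ?thesis by (rule eq_if_thresholds_eq[OF b(1,2)])
        qed (use b(3) in simp)
      qed
      ultimately show ?thesis using \<sigma> \<tau> by simp
    qed
  qed
qed

lemma card_tC: "card tC \<le> card (UNIV :: 'a set) + 2 * card I + 1 + 2 * (\<beta> * MM)"
proof -
  let ?k = "card (UNIV :: 'a set)"
  have 1: "card (range FL :: ('a, 'l) tfeat set) \<le> ?k" by (rule card_image_le) simp
  have 2: "card (FC ` I :: ('a, 'l) tfeat set) \<le> card I" "card (FM ` I :: ('a, 'l) tfeat set) \<le> card I"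
    using finI by (auto intro: card_image_le)
  have 3: "card (FP ` ({..<\<beta>} \<times> {1..MM}) :: ('a, 'l) tfeat set) \<le> \<beta> * MM"
    "card (FE ` ({..<\<beta>} \<times> {1..MM}) :: ('a, 'l) tfeat set) \<le> \<beta> * MM"
    using card_image_le[of "{..<\<beta>} \<times> {1..MM}"] by (auto simp: card_cartesian_product)
  have "card tC \<le> ?k + card I + card I + 1 + \<beta> * MM + \<beta> * MM"
    unfolding tC_def
    by (intro order_trans[OF card_Un_le] add_mono 1 2 3) simp
  then show ?thesis by linarith
qed

lemma tree_transformer:
  fixes out :: "'a \<Rightarrow> ('l \<Rightarrow> bool) \<Rightarrow> bool"
  assumes s: "s \<ge> 1" "Suc (card (UNIV :: 'a set) * MM) \<le> 2 ^ s" "Suc W \<le> 2 ^ s"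
    and X: "card I < W ^ X"
    and p: "p \<ge> 2" "Suc MM < 2 ^ (p - 1)" and t: "t \<ge> 1" "(card I + 1) * (card (UNIV :: 'a set) + 1) \<le> 2 ^ t"
    and D: "card (UNIV :: 'a set) + 2 * card I + 1 + 2 * (\<beta> * MM) + \<beta> * Suc MM \<le> D" "2 * t * R \<le> D"
    and R: "real s \<le> real R * (2 ^ (p - 2) / 2 ^ s)\<^sup>2"
  shows "\<exists>T :: 'a transformer. wf_transformer T \<and> tprec T = p \<and> tdim T = D \<and> tdepth_of T = N * (2 * X + 4) \<and>
    (\<forall>w i. i < length w \<longrightarrow>
      (toutput T (None # map Some w) (Suc i) > 0 \<longleftrightarrow> out (w ! i) (below N (th w i))))"
proof -
  let ?Ls = "concat (map (tree_layers X) [0..<N])"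
  let ?out = "\<lambda>\<sigma>. case \<sigma> of TBos \<Rightarrow> False | TWord a \<theta> \<theta>' f P E \<Rightarrow> out a \<theta>"
  have cV: "card tV = \<beta> * Suc MM" by (simp add: tV_def card_cartesian_product)
  have "card (UNIV :: 'a option set) = card (insert None (range Some :: 'a option set))"
    by (simp only: UNIV_option_conv)
  also have "\<dots> = card (UNIV :: 'a set) + 1" by (simp add: card_image)
  finally have "card (UNIV :: 'a option set) = card (UNIV :: 'a set) + 1" .
  then have cQ: "card tQ = (card I + 1) * (card (UNIV :: 'a set) + 1)"
    by (simp add: tQ_def card_cartesian_product)
  obtain T :: "'a transformer" where "wf_transformer T \<and> tprec T = p \<and> tdim T = D \<and> tdepth_of T = length ?Ls \<and>
    (\<forall>u i. toutput T u i > 0 \<longleftrightarrow> ?out (mrun s tV ?Ls (\<lambda>i. tinit (u ! i)) i))"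
  proof (rule exE[OF machine_realizable[where t = t and R = R and C = tC and V = tV and Q = tQ and VS = tVS
        and feat = tfeature and init = tinit and Ls = ?Ls and p = p and s = s and D = D and out = ?out]])
    show "card tC + card tV \<le> D" using card_tC cV D by linarith
    show "finite tC" "finite tV" "finite tQ" using finI by (auto simp: tC_def tV_def tQ_def)
    show "card tQ \<le> 2 ^ t" using cQ t by simp
    show "mlayer_ok p tQ tV tVS L" if L: "L \<in> set ?Ls" for L
    proof -
      obtain b where "L \<in> set (tree_layers X b)" using L by auto
      then show ?thesis by (rule mlayer_ok_tree[OF p(2)])
    qed
    show "tinit a \<in> tVS" for a :: "'a option" by (cases a) (auto simp: tVS_def)
  qed (use assms tfeature_inj in auto)
  moreover have "?out (mrun s tV ?Ls (\<lambda>i. tinit ((None # map Some w) ! i)) (Suc i)) \<longleftrightarrow> out (w ! i) (below N (th w i))"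
    if i: "i < length w" for w i
  proof -
    have "tinv 0 w (\<lambda>i. tinit ((None # map Some w) ! i))"
      by (auto simp: tinv_def below_def)
    from tinv_run[OF this s(2,3) X, of N] show ?thesis using i by (simp add: tinv_def)
  qed
  moreover have "length ?Ls = N * (2 * X + 4)"
  proof -
    have "length (tree_layers X b) = 2 * X + 4" for b
      by (simp add: tree_layers_def length_concat comp_def sum_list_triv)
    then show ?thesis by (simp add: length_concat comp_def sum_list_triv)
  qed
  ultimately show ?thesis by (intro exI[of _ T]) simp
qed

end

section \<open>From programs to threshold systems\<close>

text \<open>References point backwards only, so the fold satisfies the defining equations of all
  lines at once. Truth values, local evaluation and depths of lines are instances.\<close>

lemma foldl_lines:
  fixes F :: "(nat \<Rightarrow> 'b) \<Rightarrow> nat \<Rightarrow> 'b" and e0 :: "nat \<Rightarrow> 'b"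
  assumes cong: "\<And>k e e'. k < n \<Longrightarrow> (\<And>r. r < k \<Longrightarrow> e r = e' r) \<Longrightarrow> F e k = F e' k"
  defines "G \<equiv> \<lambda>n. foldl (\<lambda>e k. e(k := F e k)) e0 [0..<n]"
  shows "k < n \<Longrightarrow> G n k = F (G n) k" and "n \<le> k \<Longrightarrow> G n k = e0 k"
proof -
  have "m \<le> n \<Longrightarrow> (\<forall>k<m. G m k = F (G m) k) \<and> (\<forall>k\<ge>m. G m k = e0 k)" for m
  proof (induction m)
    case 0
    then show ?case by (simp add: G_def)
  next
    case (Suc m)
    have G: "G (Suc m) = (G m)(m := F (G m) m)" by (simp add: G_def)
    have F: "F (G m) k = F (G (Suc m)) k" if "k \<le> m" for k
      using that Suc.prems by (intro cong) (auto simp: G)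
    have IH: "G m k = F (G m) k" if "k < m" for k using Suc that by simp
    have "G (Suc m) k = F (G (Suc m)) k" if "k < Suc m" for k
    proof (cases "k = m")
      case True
      have "G (Suc m) k = F (G m) m" using True by (simp add: G)
      also have "\<dots> = F (G (Suc m)) k" unfolding True by (rule F) simp
      finally show ?thesis .
    next
      case False
      then have "k < m" using that by simp
      have "G (Suc m) k = G m k" using False by (simp add: G)
      also have "\<dots> = F (G m) k" by (rule IH) fact
      also have "\<dots> = F (G (Suc m)) k" by (rule F) (use \<open>k < m\<close> in simp)
      finally show ?thesis .
    qed
    moreover have "G (Suc m) k = e0 k" if "Suc m \<le> k" for k
      using Suc that by (simp add: G)
    ultimately show ?case by blast
  qed
  then show "k < n \<Longrightarrow> G n k = F (G n) k" and "n \<le> k \<Longrightarrow> G n k = e0 k" by blast+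
qed

section \<open>Local evaluation of formulas from the truth values of their comparisons\<close>

primrec flins :: "'a cform \<Rightarrow> 'a cform set"
and tlins :: "'a cterm \<Rightarrow> 'a cform set"
and slins :: "'a lsum \<Rightarrow> 'a cform set" where
  "flins (Sym a) = {}"
| "flins (Ref k) = {}"
| "flins (Neg f) = flins f"
| "flins (Conj f g) = flins f \<union> flins g"
| "flins (Lin s c k) = insert (Lin s c k) (slins s)"
| "tlins (Cnt f) = flins f"
| "tlins (CConst c) = {}"
| "slins LNil = {}"
| "slins (LCons a t s) = tlins t \<union> slins s"

text \<open>Comparisons are the only formulas that look at other positions. Once \<open>lam\<close>
  supplies their truth values and \<open>e\<close> those of earlier lines, the letter determines the
  rest.\<close>

fun evf :: "(nat \<Rightarrow> bool) \<Rightarrow> ('a cform \<Rightarrow> bool) \<Rightarrow> 'a \<Rightarrow> 'a cform \<Rightarrow> bool" where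
  "evf e lam a (Sym x) = (a = x)"
| "evf e lam a (Ref k) = e k"
| "evf e lam a (Neg f) = (\<not> evf e lam a f)"
| "evf e lam a (Conj f g) = (evf e lam a f \<and> evf e lam a g)"
| "evf e lam a (Lin s c k) = lam (Lin s c k)"

text \<open>The amount that one position adds to the sum. Constants are kept apart in
  \<open>csum\<close>, since they do not grow with the prefix.\<close>

fun weight :: "('a cform \<Rightarrow> bool) \<Rightarrow> 'a lsum \<Rightarrow> nat" where
  "weight v LNil = 0"
| "weight v (LCons c (Cnt f) s) = c * of_bool (v f) + weight v s"
| "weight v (LCons c (CConst k) s) = weight v s"

fun csum :: "'a lsum \<Rightarrow> nat" where
  "csum LNil = 0"
| "csum (LCons c (Cnt f) s) = csum s"
| "csum (LCons c (CConst k) s) = c * k + csum s"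

fun counted :: "'a lsum \<Rightarrow> 'a cform set" where
  "counted LNil = {}"
| "counted (LCons c (Cnt f) s) = insert f (counted s)"
| "counted (LCons c (CConst k) s) = counted s"

fun cmp_bits :: "cmp \<Rightarrow> bool \<Rightarrow> bool \<Rightarrow> bool" where
  "cmp_bits CGe x y = x"
| "cmp_bits CGt x y = y"
| "cmp_bits CEq x y = (x \<and> \<not> y)"
| "cmp_bits CLt x y = (\<not> x)"
| "cmp_bits CLe x y = (\<not> y)"

lemma cmp_rel_bits: "cmp_rel c x k = cmp_bits c (k \<le> x) (Suc k \<le> x)"
  by (cases c) auto

lemma finite_lins [simp]:
  fixes f :: "'a cform" and t :: "'a cterm" and s :: "'a lsum"
  shows "finite (flins f)" "finite (tlins t)" "finite (slins s)"
  by (induction f and t and s) auto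

lemma card_lins:
  fixes f :: "'a cform" and t :: "'a cterm" and s :: "'a lsum"
  shows "card (flins f) \<le> fsize f" "card (tlins t) \<le> tsize t" "card (slins s) \<le> ssize s"
proof (induction f and t and s)
  case (Conj f g)
  then show ?case using card_Un_le[of "flins f" "flins g"] by simp
next
  case (Lin s c k)
  then show ?case using card_insert_le_m1[of "Suc (ssize s)" "slins s" "Lin s c k"] by simp
next
  case (LCons a t s)
  then show ?case using card_Un_le[of "tlins t" "slins s"] by simp
qed auto

lemma lins_subset:
  "Lin s c k \<in> flins f \<Longrightarrow> slins s \<subseteq> flins f"
  "Lin s c k \<in> tlins t \<Longrightarrow> slins s \<subseteq> tlins t"
  "Lin s c k \<in> slins s' \<Longrightarrow> slins s \<subseteq> slins s'"
  by (induction f and t and s') auto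

lemma lins_consts:
  "Lin s c k \<in> flins f \<Longrightarrow> k \<in> fconsts f"
  "Lin s c k \<in> tlins t \<Longrightarrow> k \<in> tconsts t"
  "Lin s c k \<in> slins s' \<Longrightarrow> k \<in> sconsts s'"
  by (induction f and t and s') auto

lemma lins_are_Lin:
  "g \<in> flins f \<Longrightarrow> \<exists>s c k. g = Lin s c k"
  "g \<in> tlins t \<Longrightarrow> \<exists>s c k. g = Lin s c k"
  "g \<in> slins s' \<Longrightarrow> \<exists>s c k. g = Lin s c k"
  by (induction f and t and s') auto

lemma lins_depth:
  "g \<in> flins f \<Longrightarrow> fdepth D g \<le> fdepth D f"
  "g \<in> tlins t \<Longrightarrow> fdepth D g \<le> tdepth D t"
  "g \<in> slins s' \<Longrightarrow> fdepth D g \<le> sdepth D s'"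
  by (induction f and t and s') fastforce+

lemma counted_props:
  "f \<in> counted s \<Longrightarrow> flins f \<subseteq> slins s \<and> frefs f \<subseteq> srefs s \<and> fdepth D f < sdepth D s"
  by (induction s rule: counted.induct) auto

lemma weight_cong: "(\<And>f. f \<in> counted s \<Longrightarrow> v f = v' f) \<Longrightarrow> weight v s = weight v' s"
  by (induction s rule: counted.induct) auto

lemma sval_eq_weight:
  "sval env w s i = csum s + (\<Sum>j\<le>i. weight (\<lambda>f. holds env w f j) s)"
proof (induction s rule: counted.induct)
  case (2 c f s)
  have "{j. j \<le> i \<and> holds env w f j} = {..i} \<inter> {j. holds env w f j}" by auto
  then have "card {j. j \<le> i \<and> holds env w f j} = (\<Sum>j\<le>i. of_bool (holds env w f j))"
    by (simp add: sum_of_bool_eq)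
  then show ?case using 2 by (simp add: sum.distrib sum_distrib_left)
qed auto

lemma holds_cong:
  fixes f :: "'a cform" and t :: "'a cterm" and s :: "'a lsum"
  shows "(\<And>r. r \<in> frefs f \<Longrightarrow> e r = e' r) \<Longrightarrow> holds e w f = holds e' w f"
  "(\<And>r. r \<in> trefs t \<Longrightarrow> e r = e' r) \<Longrightarrow> tval e w t = tval e' w t"
  "(\<And>r. r \<in> srefs s \<Longrightarrow> e r = e' r) \<Longrightarrow> sval e w s = sval e' w s"
  by (induction f and t and s) (auto simp: fun_eq_iff)

lemma fdepth_cong:
  fixes f :: "'a cform" and t :: "'a cterm" and s :: "'a lsum"
  shows "(\<And>r. r \<in> frefs f \<Longrightarrow> D r = D' r) \<Longrightarrow> fdepth D f = fdepth D' f"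
  "(\<And>r. r \<in> trefs t \<Longrightarrow> D r = D' r) \<Longrightarrow> tdepth D t = tdepth D' t"
  "(\<And>r. r \<in> srefs s \<Longrightarrow> D r = D' r) \<Longrightarrow> sdepth D s = sdepth D' s"
  by (induction f and t and s) auto

lemma evf_cong:
  "(\<And>r. r \<in> frefs f \<Longrightarrow> e r = e' r) \<Longrightarrow> evf e lam a f = evf e' lam a f"
  by (induction e lam a f rule: evf.induct) auto

lemma evf_holds:
  assumes "\<And>r. r \<in> frefs f \<Longrightarrow> e r = env r j" "\<And>g. g \<in> flins f \<Longrightarrow> lam g = holds env w g j"
  shows "evf e lam (w ! j) f = holds env w f j"
  using assms by (induction e lam "w ! j" f rule: evf.induct) auto

lemma evf_depth_cong:
  assumes "\<And>r. r \<in> frefs f \<Longrightarrow> D r < m \<Longrightarrow> e r = e' r"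
    and "\<And>g. g \<in> flins f \<Longrightarrow> fdepth D g < m \<Longrightarrow> lam g = lam' g" "fdepth D f < m"
  shows "evf e lam a f = evf e' lam' a f"
  using assms by (induction e lam a f rule: evf.induct) auto

lemma depth_le_size:
  fixes f :: "'a cform" and t :: "'a cterm" and s :: "'a lsum"
  shows "(\<And>r. r \<in> frefs f \<Longrightarrow> D r \<le> B) \<Longrightarrow> fdepth D f \<le> fsize f + B"
  "(\<And>r. r \<in> trefs t \<Longrightarrow> D r \<le> B) \<Longrightarrow> tdepth D t \<le> tsize t + B"
  "(\<And>r. r \<in> srefs s \<Longrightarrow> D r \<le> B) \<Longrightarrow> sdepth D s \<le> ssize s + B"
  by (induction f and t and s) fastforce+

lemma fsize_pos: "fsize f \<ge> 1"
  by (cases f) auto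

lemma bitlen_bound: "n < 2 ^ bitlen n"
proof (induction n rule: bitlen.induct)
  case (1 n)
  show ?case
  proof (cases "n \<le> 1")
    case True
    then show ?thesis by (simp add: bitlen.simps[of n])
  next
    case False
    then have "n div 2 < 2 ^ bitlen (n div 2)" using 1 by simp
    then have "n < 2 * 2 ^ bitlen (n div 2)" by linarith
    then show ?thesis using False by (simp add: bitlen.simps[of n])
  qed
qed

declare bitlen.simps [simp del]

locale program =
  fixes P :: "'a::finite cform list"
  assumes wf: "wf_prog P"
begin

definition lins :: "'a cform set" where "lins = (\<Union>f\<in>set P. flins f)"

definition line_env :: "('a cform \<Rightarrow> bool) \<Rightarrow> 'a \<Rightarrow> nat \<Rightarrow> bool" where
  "line_env lam a = foldl (\<lambda>e k. e(k := evf e lam a (P ! k))) (\<lambda>_. False) [0..<length P]"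

definition lin_truth :: "('a cform \<times> bool \<Rightarrow> bool) \<Rightarrow> 'a cform \<Rightarrow> bool" where
  "lin_truth \<theta> f = (case f of Lin s c k \<Rightarrow> cmp_bits c (\<theta> (f, False)) (\<theta> (f, True)) | _ \<Rightarrow> False)"

definition idx :: "('a cform \<times> bool) set" where "idx = lins \<times> UNIV"

text \<open>
  Each linear comparison with constant \<open>k\<close> gives the thresholds \<open>k\<close> and \<open>k + 1\<close>, which decide all five relations.
\<close>

definition pth :: "'a list \<Rightarrow> nat \<Rightarrow> 'a cform \<times> bool \<Rightarrow> bool" where
  "pth w i l = (case fst l of Lin s c k \<Rightarrow> k + of_bool (snd l) \<le> sval (penv P w) w s i | _ \<Rightarrow> False)"

text \<open>Truncated subtraction is intended: if the constants alone reach the bound, the threshold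
  is \<open>0\<close> and always met.\<close>

definition pkap :: "'a cform \<times> bool \<Rightarrow> nat" where
  "pkap l = (case fst l of Lin s c k \<Rightarrow> k + of_bool (snd l) - csum s | _ \<Rightarrow> 0)"

definition pK :: nat where "pK = 2 ^ pprec P"

text \<open>Single coefficients are below \<open>pK\<close>, but their sum over the terms need not
  be. Cutting off at \<open>pK\<close> is harmless, since no threshold exceeds
  \<open>pK\<close>.\<close>

definition pu :: "'a cform \<times> bool \<Rightarrow> 'a \<Rightarrow> ('a cform \<times> bool \<Rightarrow> bool) \<Rightarrow> nat" where
  "pu l a \<theta> = (case fst l of Lin s c k \<Rightarrow>
     min pK (weight (evf (line_env (lin_truth \<theta>) a) (lin_truth \<theta>) a) s) | _ \<Rightarrow> 0)"

definition plev :: "'a cform \<times> bool \<Rightarrow> nat" where "plev l = fdepth (line_depths P) (fst l)"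

definition pout :: "'a \<Rightarrow> ('a cform \<times> bool \<Rightarrow> bool) \<Rightarrow> bool" where
  "pout a \<theta> = line_env (lin_truth \<theta>) a (length P - 1)"

lemma refs: "k < length P \<Longrightarrow> r \<in> frefs (P ! k) \<Longrightarrow> r < k"
  using wf by (auto simp: wf_prog_def)

lemma nonempty: "P \<noteq> []" using wf by (simp add: wf_prog_def)

lemma penv_eq: "k < length P \<Longrightarrow> penv P w k = holds (penv P w) w (P ! k)"
  unfolding penv_def
  by (rule foldl_lines(1)[where F = "\<lambda>e k. holds e w (P ! k)"]) (auto intro!: holds_cong(1) dest: refs)

lemma penv_out: "length P \<le> k \<Longrightarrow> penv P w k = (\<lambda>_. False)"
  unfolding penv_def
  by (rule foldl_lines(2)[where F = "\<lambda>e k. holds e w (P ! k)"]) (auto intro!: holds_cong(1) dest: refs)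

lemma line_env_eq: "k < length P \<Longrightarrow> line_env lam a k = evf (line_env lam a) lam a (P ! k)"
  unfolding line_env_def
  by (rule foldl_lines(1)[where F = "\<lambda>e k. evf e lam a (P ! k)"]) (auto intro!: evf_cong dest: refs)

lemma line_env_out: "length P \<le> k \<Longrightarrow> line_env lam a k = False"
  unfolding line_env_def
  by (rule foldl_lines(2)[where F = "\<lambda>e k. evf e lam a (P ! k)"]) (auto intro!: evf_cong dest: refs)

lemma line_depths_eq: "k < length P \<Longrightarrow> line_depths P k = fdepth (line_depths P) (P ! k)"
  unfolding line_depths_def
  by (rule foldl_lines(1)[where F = "\<lambda>e k. fdepth e (P ! k)"]) (auto intro!: fdepth_cong(1) dest: refs)

lemma finite_program_lins: "finite lins" by (simp add: lins_def)

lemma lins_line: "k < length P \<Longrightarrow> flins (P ! k) \<subseteq> lins" using nth_mem by (fastforce simp: lins_def)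

lemma lins_closed: "Lin s c k \<in> lins \<Longrightarrow> slins s \<subseteq> lins"
  using lins_subset(1) by (fastforce simp: lins_def)

lemma lin_truth_pth: "g \<in> lins \<Longrightarrow> lin_truth (pth w j) g = holds (penv P w) w g j"
  using lins_are_Lin(1) by (fastforce simp: lins_def lin_truth_def pth_def cmp_rel_bits)

lemma line_env_penv: "line_env (lin_truth (pth w j)) (w ! j) r = penv P w r j"
proof (induction r rule: less_induct)
  case (less r)
  show ?case
  proof (cases "r < length P")
    case True
    have "evf (line_env (lin_truth (pth w j)) (w ! j)) (lin_truth (pth w j)) (w ! j) (P ! r)
      = holds (penv P w) w (P ! r) j"
      using less refs[OF True] lin_truth_pth lins_line[OF True] by (intro evf_holds) auto
    then show ?thesis using True by (simp add: line_env_eq penv_eq[OF True, symmetric])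
  next
    case False
    then show ?thesis by (simp add: line_env_out penv_out)
  qed
qed

lemma evf_pth:
  "flins f \<subseteq> lins \<Longrightarrow> evf (line_env (lin_truth (pth w j)) (w ! j)) (lin_truth (pth w j)) (w ! j) f
     = holds (penv P w) w f j"
  by (rule evf_holds) (auto simp: line_env_penv lin_truth_pth)

lemma models_pout: "models P w i = pout (w ! i) (pth w i)"
  by (simp add: models_def pout_def line_env_penv)

lemma line_env_depth_cong:
  assumes "\<And>g. g \<in> lins \<Longrightarrow> fdepth (line_depths P) g < m \<Longrightarrow> lam g = lam' g"
  shows "line_depths P r < m \<Longrightarrow> line_env lam a r = line_env lam' a r"
proof (induction r rule: less_induct)
  case (less r)
  show ?case
  proof (cases "r < length P")
    case True
    have "evf (line_env lam a) lam a (P ! r) = evf (line_env lam' a) lam' a (P ! r)"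
    proof (rule evf_depth_cong)
      show "line_env lam a x = line_env lam' a x" if "x \<in> frefs (P ! r)" "line_depths P x < m" for x
        using less.IH[OF refs[OF True that(1)] that(2)] .
      show "lam g = lam' g" if "g \<in> flins (P ! r)" "fdepth (line_depths P) g < m" for g
        using that lins_line[OF True] by (intro assms) auto
      show "fdepth (line_depths P) (P ! r) < m"
        using less.prems line_depths_eq[OF True] by simp
    qed
    then show ?thesis using True by (simp add: line_env_eq)
  next
    case False
    then show ?thesis by (simp add: line_env_out)
  qed
qed

lemma idx_cases:
  assumes "l \<in> idx"
  obtains s c k B where "l = (Lin s c k, B)" "Lin s c k \<in> lins"
  using assms lins_are_Lin(1) by (fastforce simp: idx_def lins_def)

text \<open>Counting raises the depth by one, so the formulas counted in \<open>l\<close> have depth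
  below \<open>plev l\<close> and, also through references, involve only comparisons of smaller
  depth.\<close>

lemma pu_depth_cong:
  assumes l: "l \<in> idx" and eq: "\<And>l'. l' \<in> idx \<Longrightarrow> plev l' < plev l \<Longrightarrow> \<theta> l' = \<theta>' l'"
  shows "pu l a \<theta> = pu l a \<theta>'"
proof -
  obtain s c k B where lB: "l = (Lin s c k, B)" "Lin s c k \<in> lins" using l by (rule idx_cases)
  let ?m = "sdepth (line_depths P) s"
  have lam: "lin_truth \<theta> g = lin_truth \<theta>' g" if "g \<in> lins" "fdepth (line_depths P) g < ?m" for g
  proof -
    have "\<theta> (g, B') = \<theta>' (g, B')" for B' using that eq[of "(g, B')"] lB(1) by (simp add: idx_def plev_def)
    then show ?thesis unfolding lin_truth_def by (simp only:)
  qed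
  have "weight (evf (line_env (lin_truth \<theta>) a) (lin_truth \<theta>) a) s
    = weight (evf (line_env (lin_truth \<theta>') a) (lin_truth \<theta>') a) s"
  proof (rule weight_cong)
    fix f assume f: "f \<in> counted s"
    have "flins f \<subseteq> lins" "fdepth (line_depths P) f < ?m"
      using counted_props[OF f] lins_closed[OF lB(2)] by auto
    then show "evf (line_env (lin_truth \<theta>) a) (lin_truth \<theta>) a f
      = evf (line_env (lin_truth \<theta>') a) (lin_truth \<theta>') a f"
    proof (intro evf_depth_cong)
      show "line_env (lin_truth \<theta>) a x = line_env (lin_truth \<theta>') a x" if "line_depths P x < ?m" for x
        using lam that by (rule line_env_depth_cong)
    qed (use lam in auto)
  qed
  then show ?thesis by (simp add: pu_def lB)
qed

lemma pout_cong:
  assumes "\<And>l. l \<in> idx \<Longrightarrow> \<theta> l = \<theta>' l"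
  shows "pout a \<theta> = pout a \<theta>'"
  unfolding pout_def
proof (rule line_env_depth_cong)
  show "lin_truth \<theta> g = lin_truth \<theta>' g" if "g \<in> lins" for g
  proof -
    have "\<theta> (g, B) = \<theta>' (g, B)" for B using that by (intro assms) (simp add: idx_def)
    then show ?thesis unfolding lin_truth_def by (simp only:)
  qed
  show "line_depths P (length P - 1) < Suc (line_depths P (length P - 1))" by simp
qed

text \<open>If some summand is clipped, it alone equals \<open>K\<close> and reaches
  \<open>kk\<close>; otherwise nothing changes.\<close>

lemma sum_min_ge_iff:
  fixes f :: "nat \<Rightarrow> nat"
  assumes "kk \<le> K"
  shows "kk \<le> (\<Sum>j\<le>i. min K (f j)) \<longleftrightarrow> kk \<le> (\<Sum>j\<le>i. f j)"
proof
  assume "kk \<le> (\<Sum>j\<le>i. min K (f j))"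
  also have "\<dots> \<le> (\<Sum>j\<le>i. f j)" by (intro sum_mono) auto
  finally show "kk \<le> (\<Sum>j\<le>i. f j)" .
next
  assume R: "kk \<le> (\<Sum>j\<le>i. f j)"
  show "kk \<le> (\<Sum>j\<le>i. min K (f j))"
  proof (cases "\<exists>x\<le>i. f x > K")
    case True
    then obtain x where x: "x \<le> i" "f x > K" by blast
    then have "K = min K (f x)" by simp
    also have "\<dots> \<le> (\<Sum>j\<le>i. min K (f j))" using x by (intro member_le_sum) auto
    finally show ?thesis using assms by simp
  next
    case False
    then have "(\<Sum>j\<le>i. min K (f j)) = (\<Sum>j\<le>i. f j)" by (intro sum.cong) auto
    then show ?thesis using R by simp
  qed
qed

lemma const_less: "Lin s c k \<in> lins \<Longrightarrow> k < pK"
proof -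
  assume "Lin s c k \<in> lins"
  then have "k \<in> (\<Union>f\<in>set P. fconsts f)" using lins_consts(1) by (fastforce simp: lins_def)
  moreover have fin: "finite (fconsts f)" "finite (tconsts t)" "finite (sconsts s)" for f :: "'a cform" and t :: "'a cterm" and s :: "'a lsum"
    by (induction f and t and s) auto
  ultimately have "k \<le> Max (insert 0 (\<Union>f\<in>set P. fconsts f))" by (intro Max_ge) auto
  also have "\<dots> < pK" unfolding pK_def pprec_def by (rule bitlen_bound)
  finally show ?thesis .
qed

lemma pkap_le: "l \<in> idx \<Longrightarrow> pkap l \<le> pK"
  by (erule idx_cases) (auto simp: pkap_def dest: const_less)

lemma pth_iff:
  assumes l: "l \<in> idx"
  shows "pth w i l \<longleftrightarrow> pkap l \<le> (\<Sum>j\<le>i. pu l (w ! j) (pth w j))"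
proof -
  obtain s c k B where lB: "l = (Lin s c k, B)" "Lin s c k \<in> lins" using l by (rule idx_cases)
  have w: "weight (evf (line_env (lin_truth (pth w j)) (w ! j)) (lin_truth (pth w j)) (w ! j)) s
    = weight (\<lambda>f. holds (penv P w) w f j) s" for j
    using counted_props lins_closed[OF lB(2)] by (intro weight_cong evf_pth) blast
  have "pkap l \<le> (\<Sum>j\<le>i. pu l (w ! j) (pth w j)) \<longleftrightarrow>
      pkap l \<le> (\<Sum>j\<le>i. min pK (weight (\<lambda>f. holds (penv P w) w f j) s))"
    by (simp add: pu_def lB w)
  also have "\<dots> \<longleftrightarrow> pkap l \<le> (\<Sum>j\<le>i. weight (\<lambda>f. holds (penv P w) w f j) s)"
    by (rule sum_min_ge_iff[OF pkap_le[OF l]])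
  also have "\<dots> \<longleftrightarrow> pth w i l"
    by (auto simp: pth_def pkap_def lB sval_eq_weight)
  finally show ?thesis by simp
qed

lemma threshold_system_program:
  assumes "\<And>l l'. l \<in> idx \<Longrightarrow> l' \<in> idx \<Longrightarrow> plev l' < plev l \<Longrightarrow> bt l' < bt l"
  shows "threshold_system idx pu pkap pK bt pth"
proof
  show "finite idx" by (simp add: idx_def finite_program_lins)
  show "1 \<le> pK" by (simp add: pK_def)
  show "pu l a \<theta> \<le> pK" for l a \<theta> by (cases "fst l") (auto simp: pu_def)
  show "pu l a \<theta> = pu l a \<theta>'" if "l \<in> idx" "\<And>l'. l' \<in> idx \<Longrightarrow> bt l' < bt l \<Longrightarrow> \<theta> l' = \<theta>' l'" for l \<theta> \<theta>' a
    using that assms by (intro pu_depth_cong) auto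
qed (rule pkap_le pth_iff; assumption)+

lemma card_idx: "card idx \<le> 2 * psize P"
proof -
  have "card (\<Union>f\<in>set P. flins f) \<le> sum_list (map fsize P)" for P :: "'a cform list"
  proof (induction P)
    case (Cons f P)
    have "card (\<Union>f\<in>set (f # P). flins f) \<le> card (flins f) + card (\<Union>f\<in>set P. flins f)"
      using card_Un_le[of "flins f" "\<Union>f\<in>set P. flins f"] by simp
    then show ?case using Cons card_lins(1)[of f] by simp
  qed simp
  from this[of P] show ?thesis
    by (simp add: idx_def lins_def psize_def card_cartesian_product UNIV_bool)
qed

lemma plev_le: "l \<in> idx \<Longrightarrow> plev l \<le> pdepth P"
proof -
  assume "l \<in> idx"
  then obtain k where k: "k < length P" "fst l \<in> flins (P ! k)"
    by (auto simp: idx_def lins_def in_set_conv_nth)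
  have "plev l \<le> line_depths P k"
    using lins_depth(1)[OF k(2)] line_depths_eq[OF k(1)] by (simp add: plev_def)
  also have "\<dots> \<le> pdepth P" unfolding pdepth_def using k by (intro Max_ge) auto
  finally show ?thesis .
qed

text \<open>Each line adds at most its own size to the depths of earlier lines. It follows that
  \<open>2 ^ p \<le> d\<close> whenever the depth is large.\<close>

lemma pdepth_le_psize: "pdepth P \<le> psize P"
proof -
  have "k < length P \<Longrightarrow> line_depths P k \<le> sum_list (map fsize (take (Suc k) P))" for k
  proof (induction k rule: less_induct)
    case (less k)
    have "line_depths P r \<le> sum_list (map fsize (take k P))" if "r \<in> frefs (P ! k)" for r
    proof -
      have r: "r < k" using refs[OF less.prems that] .
      have "line_depths P r \<le> sum_list (map fsize (take (Suc r) P))" using less r by simp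
      also have "\<dots> \<le> sum_list (map fsize (take k P))"
      proof -
        have "take k P = take (Suc r) P @ take (k - Suc r) (drop (Suc r) P)"
          using r by (metis Suc_leI le_add_diff_inverse take_add)
        then show ?thesis by simp
      qed
      finally show ?thesis .
    qed
    then have "line_depths P k \<le> fsize (P ! k) + sum_list (map fsize (take k P))"
      unfolding line_depths_eq[OF less.prems] by (rule depth_le_size(1))
    then show ?case using less.prems by (simp add: take_Suc_conv_app_nth)
  qed
  moreover have "sum_list (map fsize (take m P)) \<le> psize P" for m
  proof -
    have "psize P = sum_list (map fsize (take m P)) + sum_list (map fsize (drop m P))"
      unfolding psize_def by (metis append_take_drop_id map_append sum_list_append)
    then show ?thesis by simp
  qed
  ultimately show ?thesis unfolding pdepth_def by (auto intro: order_trans)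
qed

lemma psize_pos: "psize P \<ge> 1"
  using nonempty fsize_pos[of "hd P"] by (cases P) (auto simp: psize_def)

end

lemma pprec_pos: "pprec P \<ge> 1"
  by (simp add: pprec_def bitlen.simps)

section \<open>Choice of parameters\<close>

lemma sum_div_le:
  fixes f :: "'b \<Rightarrow> nat"
  assumes "finite A"
  shows "(\<Sum>x\<in>A. f x div b) \<le> (\<Sum>x\<in>A. f x) div b"
  using assms
proof (induction rule: finite_induct)
  case (insert x A)
  have "f x div b + (\<Sum>x\<in>A. f x) div b \<le> (f x + (\<Sum>x\<in>A. f x)) div b"
    by (subst div_add1_eq) (rule le_add1)
  then show ?case using insert by simp
qed simp

text \<open>Each level is cut, in an arbitrary order, into chunks of \<open>b\<close> elements.
  There are at most \<open>card I div b\<close> full chunks in total, and each of the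
  \<open>L + 1\<close> levels adds at most one more.\<close>

lemma batching:
  fixes I :: "'l set" and lev :: "'l \<Rightarrow> nat"
  assumes fin: "finite I" and lev: "\<And>l. l \<in> I \<Longrightarrow> lev l \<le> L" and b: "b \<ge> 1"
  shows "\<exists>bt loc. (\<forall>l\<in>I. loc l < b) \<and>
    (\<forall>l\<in>I. \<forall>l'\<in>I. bt l = bt l' \<longrightarrow> loc l = loc l' \<longrightarrow> l = l') \<and>
    (\<forall>l\<in>I. \<forall>l'\<in>I. lev l' < lev l \<longrightarrow> bt l' < bt l) \<and>
    (\<forall>l\<in>I. bt l < L + 1 + card I div b)"
proof -
  obtain g :: "'l \<Rightarrow> nat" where g: "inj_on g I"
    using finite_imp_inj_to_nat_seg[OF fin] by blast
  define rk where "rk l = card {l' \<in> I. lev l' = lev l \<and> g l' < g l}" for l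
  define cnt where "cnt m = card {l \<in> I. lev l = m}" for m
  define off where "off m = (\<Sum>x<m. cnt x div b + 1)" for m
  define bt where "bt l = off (lev l) + rk l div b" for l
  define loc where "loc l = rk l mod b" for l
  have rk_less: "rk l < rk l'" if "l \<in> I" "l' \<in> I" "lev l = lev l'" "g l < g l'" for l l'
    unfolding rk_def using that fin by (intro psubset_card_mono) auto
  have rk_cnt: "rk l \<le> cnt (lev l)" for l
    unfolding rk_def cnt_def using fin by (intro card_mono) auto
  have off_mono: "off m \<le> off m'" if "m \<le> m'" for m m'
    unfolding off_def using that by (intro sum_mono2) auto
  have bt_off: "bt l < off (Suc (lev l))" for l
    using div_le_mono[OF rk_cnt[of l], of b] by (simp add: bt_def off_def)
  have less: "bt l' < bt l" if "lev l' < lev l" for l l'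
  proof -
    have "bt l' < off (Suc (lev l'))" by (rule bt_off)
    also have "\<dots> \<le> off (lev l)" using that by (intro off_mono) simp
    also have "\<dots> \<le> bt l" by (simp add: bt_def)
    finally show ?thesis .
  qed
  have inj: "l = l'" if l: "l \<in> I" "l' \<in> I" "bt l = bt l'" "loc l = loc l'" for l l'
  proof -
    have lv: "lev l = lev l'" using less[of l l'] less[of l' l] l(3) by (metis less_irrefl linorder_neqE_nat)
    then have "rk l div b = rk l' div b" using l(3) by (simp add: bt_def)
    then have "rk l = rk l'" using l(4) unfolding loc_def by (metis div_mult_mod_eq)
    then have "g l = g l'" using rk_less[of l l'] rk_less[of l' l] l lv by (metis less_irrefl linorder_neqE_nat)
    then show ?thesis using g l by (auto simp: inj_on_def)
  qed
  have total: "off (Suc L) \<le> L + 1 + card I div b"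
  proof -
    have "off (Suc L) = (\<Sum>x\<in>{..<Suc L}. cnt x div b) + Suc L"
      by (simp only: off_def sum.distrib) simp
    also have "(\<Sum>x\<in>{..<Suc L}. cnt x div b) \<le> (\<Sum>x\<in>{..<Suc L}. cnt x) div b"
      by (rule sum_div_le) simp
    also have "(\<Sum>x\<in>{..<Suc L}. cnt x) = card (\<Union>x\<in>{..<Suc L}. {l \<in> I. lev l = x})"
      unfolding cnt_def using fin by (intro card_UN_disjoint[symmetric]) auto
    also have "\<dots> \<le> card I" using fin by (intro card_mono) auto
    finally show ?thesis by (simp add: div_le_mono)
  qed
  have "bt l < L + 1 + card I div b" if "l \<in> I" for l
  proof -
    have "bt l < off (Suc (lev l))" by (rule bt_off)
    also have "\<dots> \<le> off (Suc L)" using lev[OF that] by (intro off_mono) simp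
    also note total
    finally show ?thesis .
  qed
  moreover have "loc l < b" for l using b by (simp add: loc_def)
  ultimately show ?thesis using inj less by (intro exI[of _ bt] exI[of _ loc]) blast
qed

lemma Suc_le_two_power: "Suc n \<le> 2 ^ n"
  by (simp add: Suc_le_eq)

context program
begin

text \<open>Precision \<open>2 * s\<close> makes the product of two entries large enough for the
  score gap in a single coordinate, so no copies are made and \<open>R = 1\<close>.\<close>

lemma shallow_transformer:
  assumes L: "pdepth P + 1 \<le> 2 ^ pprec P"
  defines "k \<equiv> card (UNIV :: 'a set)"
  shows "\<exists>T :: 'a transformer. wf_transformer T \<and> simulates T P \<and>
    tprec T \<le> 2 * (k * k + 3 * k + 3) * (pprec P + 1) \<and>
    tdepth_of T \<le> 2 * (pdepth P + 1) \<and> tdim T \<le> (3 * k + 12) * psize P"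
proof -
  interpret threshold_system idx pu pkap pK plev pth
    by (rule threshold_system_program)
  define p where "p = pprec P"
  define N where "N = pdepth P + 1"
  define n where "n = card idx"
  \<comment> \<open>Chosen for \<open>big\<close>: the base \<open>2 * k * pK * (N + 1)\<close> is
    at most \<open>2 ^ (2 * p + k + 2)\<close>, the factor \<open>k * pK\<close> is at most
    \<open>2 ^ (k + p)\<close>, and one more bit accounts for \<open><BOS>\<close>.\<close>
  define s where "s = k * (2 * p + k + 2) + k + p + 1"
  define t where "t = n + 1 + k"
  define D where "D = (3 * k + 12) * psize P"
  have k: "k \<ge> 1" using UNIV_pos by (simp add: k_def)
  have p: "p \<ge> 1" using pprec_pos by (simp add: p_def)
  have k2: "k \<le> 2 ^ k" using less_exp[of k] by simp
  have n: "n \<le> 2 * psize P" using card_idx by (simp add: n_def)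
  have d: "psize P \<ge> 1" by (rule psize_pos)
  have pK: "pK = 2 ^ p" by (simp add: pK_def p_def)
  have "1 * (2 * p + k + 2) \<le> k * (2 * p + k + 2)" using k by (intro mult_le_mono1)
  then have s_ge: "s \<ge> 3 * p + 5" using k by (simp add: s_def)
  have s4: "s \<ge> 4" using s_ge by simp
  have big: "Suc ((2 * k * pK * (N + 1)) ^ k * (k * pK)) \<le> 2 ^ s"
  proof -
    have "N \<le> 2 ^ p" using L by (simp add: N_def p_def)
    moreover have "(1::nat) \<le> 2 ^ p" by simp
    ultimately have "N + 1 \<le> 2 * 2 ^ p" by linarith
    then have "N + 1 \<le> 2 ^ (p + 1)" by simp
    then have "2 * k * pK * (N + 1) \<le> 2 * 2 ^ k * 2 ^ p * 2 ^ (p + 1)"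
      unfolding pK using k2 by (intro mult_le_mono) auto
    also have "\<dots> = 2 ^ (1 + k + p + (p + 1))" by (simp only: power_add power_one_right)
    also have "1 + k + p + (p + 1) = 2 * p + k + 2" by simp
    finally have "(2 * k * pK * (N + 1)) ^ k \<le> (2 ^ (2 * p + k + 2)) ^ k" by (rule power_mono) simp
    also have "\<dots> = 2 ^ (k * (2 * p + k + 2))" by (simp only: power_mult[symmetric] mult.commute)
    finally have "(2 * k * pK * (N + 1)) ^ k * (k * pK) \<le> 2 ^ (k * (2 * p + k + 2)) * (2 ^ k * 2 ^ p)"
      unfolding pK using k2 by (intro mult_le_mono) auto
    also have "\<dots> = 2 ^ (k * (2 * p + k + 2) + k + p)" by (simp add: power_add)
    finally have 1: "(2 * k * pK * (N + 1)) ^ k * (k * pK) \<le> 2 ^ (k * (2 * p + k + 2) + k + p)" .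
    have 2: "(2::nat) ^ s = 2 * 2 ^ (k * (2 * p + k + 2) + k + p)" by (simp add: s_def)
    have "(1::nat) \<le> 2 ^ (k * (2 * p + k + 2) + k + p)" by simp
    then show ?thesis using 1 unfolding 2 by linarith
  qed
  have K1: "pK + 1 \<le> 2 ^ (p + 1)" by (simp add: pK)
  have "\<exists>T :: 'a transformer. wf_transformer T \<and> tprec T = 2 * s \<and> tdim T = D \<and> tdepth_of T = 2 * N \<and>
    (\<forall>w i. i < length w \<longrightarrow>
      (toutput T (None # map Some w) (Suc i) > 0 \<longleftrightarrow> pout (w ! i) (below N (pth w i))))"
  proof (rule simple_transformer[where t = t and R = 1])
    show "1 \<le> s" "2 \<le> 2 * s" "1 \<le> t" using s4 by (auto simp: t_def)
    have "(2::nat) ^ (p + 1) \<le> 2 ^ s" using s_ge by (intro power_increasing) auto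
    then show "pK + 1 \<le> 2 ^ s" using K1 by linarith
    show "Suc ((2 * card (UNIV :: 'a set) * pK * (N + 1)) ^ card (UNIV :: 'a set) * (card (UNIV :: 'a set) * pK)) \<le> 2 ^ s"
      using big by (simp only: k_def)
    have "(2::nat) ^ (p + 1) < 2 ^ (2 * s - 1)" using s_ge by (intro power_strict_increasing) auto
    then show "pK + 1 < 2 ^ (2 * s - 1)" using K1 by linarith
    have "1 + (n + 1) * k \<le> (n + 2) * k" using k by simp
    also have "\<dots> \<le> 2 ^ (n + 1) * 2 ^ k" using Suc_le_two_power[of "n + 1"] k2 by (intro mult_le_mono) auto
    finally show "1 + (card idx + 1) * card (UNIV :: 'a set) \<le> 2 ^ t"
      by (simp add: t_def power_add n_def k_def)
    have kd: "k \<le> k * psize P" using d by simp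
    define x where "x = k * psize P"
    have Dx: "D = 3 * x + 12 * psize P" by (simp add: D_def x_def algebra_simps)
    have kx: "k \<le> x" using kd by (simp add: x_def)
    have "k + 2 * (n + 1) \<le> D" using n d kx unfolding Dx by simp
    moreover have "2 * t * 1 \<le> D" using n d kx unfolding Dx t_def by simp
    ultimately show "card (UNIV :: 'a set) + 2 * (card idx + 1) \<le> D" "2 * t * 1 \<le> D" by (simp_all add: n_def k_def)
    have "(2::real) ^ (2 * s - 2) / 2 ^ s = 2 ^ (s - 2)"
      using s4 by (simp add: power_diff[symmetric] mult_2)
    moreover have "real s \<le> ((2::real) ^ (s - 2))\<^sup>2"
    proof -
      have "s < 2 ^ s" by (rule less_exp)
      also have "\<dots> \<le> 2 ^ ((s - 2) * 2)" using s4 by (intro power_increasing) auto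
      finally have "s \<le> (2 ^ (s - 2))\<^sup>2" by (simp add: power_mult)
      then have "real s \<le> real ((2 ^ (s - 2))\<^sup>2)" by (simp only: of_nat_le_iff)
      then show ?thesis by simp
    qed
    ultimately show "real s \<le> real 1 * (2 ^ (2 * s - 2) / 2 ^ s)\<^sup>2" by simp
  qed
  then obtain T :: "'a transformer" where T: "wf_transformer T" "tprec T = 2 * s" "tdim T = D" "tdepth_of T = 2 * N"
    "\<And>w i. i < length w \<Longrightarrow> (toutput T (None # map Some w) (Suc i) > 0 \<longleftrightarrow> pout (w ! i) (below N (pth w i)))"
    by blast
  have "simulates T P"
    unfolding simulates_def
  proof (intro allI impI)
    fix w :: "'a list" and i assume i: "i < length w"
    have "pout (w ! i) (below N (pth w i)) = pout (w ! i) (pth w i)"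
      using plev_le by (intro pout_cong) (auto simp: below_def N_def less_Suc_eq_le)
    then show "toutput T (None # map Some w) (Suc i) > 0 \<longleftrightarrow> models P w i"
      using T(5)[OF i] by (simp add: models_pout)
  qed
  moreover have "2 * s \<le> 2 * (k * k + 3 * k + 3) * (p + 1)"
    by (simp add: s_def algebra_simps)
  ultimately show ?thesis using T by (intro exI[of _ T]) (simp add: p_def N_def D_def)
qed

text \<open>
  Here \<open>s = p + r + k + 2\<close> exceeds the precision \<open>p + 4\<close> when \<open>r\<close> is large: all numbers are tiny, but
  \<open>2 ^ s\<close> positions can be attended. With \<open>2 ^ r\<close> about \<open>(2 d) powr (1 / 4)\<close> the \<open>s * 4 ^ (r + k)\<close> copies of the
  class bits, which restore the score gap, still fit into \<open>O(d)\<close> coordinates.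
\<close>

lemma deep_transformer:
  assumes L: "2 ^ pprec P < pdepth P + 1"
  defines "k \<equiv> card (UNIV :: 'a set)"
  shows "\<exists>T :: 'a transformer. wf_transformer T \<and> simulates T P \<and>
    tprec T \<le> 4 * (pprec P + 1) \<and>
    tdepth_of T \<le> 36 * (pdepth P + 1) \<and>
    tdim T \<le> (k + 19 + 64 * ((k + 4) * (k + 7)) * 4 ^ k) * psize P"
proof -
  define p where "p = pprec P"
  define d where "d = psize P"
  define n where "n = card idx"
  \<comment> \<open>Small enough for unary storage, \<open>b * 2 ^ p \<le> 2 * d\<close>, and large
    enough that \<open>n div b \<le> 2 * 2 ^ p\<close>.\<close>
  define b where "b = d div 2 ^ p + 1"
  define N where "N = pdepth P + 1 + n div b"
  have k: "k \<ge> 1" by (simp add: k_def Suc_le_eq card_gt_0_iff)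
  have p: "p \<ge> 1" using pprec_pos by (simp add: p_def)
  have k2: "k + 1 \<le> 2 ^ k" using Suc_le_two_power[of k] by simp
  have n: "n \<le> 2 * d" using card_idx by (simp add: n_def d_def)
  have d1: "d \<ge> 1" using psize_pos by (simp add: d_def)
  have pK: "pK = 2 ^ p" by (simp add: pK_def p_def)
  have pd: "2 ^ p \<le> d" using L pdepth_le_psize by (simp add: p_def d_def)
  have fin: "finite idx" by (simp add: idx_def finite_program_lins)
  have "\<exists>bt loc. (\<forall>l\<in>idx. loc l < b) \<and>
    (\<forall>l\<in>idx. \<forall>l'\<in>idx. bt l = bt l' \<longrightarrow> loc l = loc l' \<longrightarrow> l = l') \<and>
    (\<forall>l\<in>idx. \<forall>l'\<in>idx. plev l' < plev l \<longrightarrow> bt l' < bt l) \<and>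
    (\<forall>l\<in>idx. bt l < N)"
    unfolding N_def n_def by (rule batching) (use fin plev_le in \<open>auto simp: b_def\<close>)
  then obtain bt loc where *: "\<forall>l\<in>idx. loc l < b"
    "\<forall>l\<in>idx. \<forall>l'\<in>idx. bt l = bt l' \<longrightarrow> loc l = loc l' \<longrightarrow> l = l'"
    "\<forall>l\<in>idx. \<forall>l'\<in>idx. plev l' < plev l \<longrightarrow> bt l' < bt l" "\<forall>l\<in>idx. bt l < N"
    by blast
  have loc: "loc l < b" and btN: "bt l < N" if "l \<in> idx" for l using * that by auto
  have loc_inj: "l = l'" if "l \<in> idx" "l' \<in> idx" "bt l = bt l'" "loc l = loc l'" for l l'
    using *(2) that by blast
  have bt: "bt l' < bt l" if "l \<in> idx" "l' \<in> idx" "plev l' < plev l" for l l'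
    using *(3) that by blast
  \<comment> \<open>With fan-out \<open>2 ^ r\<close>, a tree of height four covers
    \<open>(2 ^ r) ^ 4 = 16 ^ r\<close> phases, which must exceed the number of thresholds; choosing
    the least \<open>r\<close> keeps \<open>16 ^ r\<close> in \<open>O(d)\<close>.\<close>
  obtain r where r: "2 * d < 16 ^ r" "16 ^ r \<le> 32 * d"
  proof -
    define r where "r = (LEAST r. 2 * d < 16 ^ r)"
    have "2 * d < 16 ^ (2 * d)" by (rule less_le_trans[OF less_exp]) (intro power_mono, auto)
    then have r1: "2 * d < 16 ^ r" unfolding r_def by (rule LeastI)
    have "r \<noteq> 0" using r1 d1 by (cases r) auto
    then obtain r' where r': "r = Suc r'" by (cases r) auto
    have "\<not> 2 * d < 16 ^ r'" using not_less_Least[of r' "\<lambda>r. 2 * d < 16 ^ r"] r' by (simp add: r_def)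
    then have "16 ^ r \<le> 32 * d" using r' by simp
    with r1 show ?thesis by (rule that)
  qed
  have r16: "(16::nat) ^ r = 2 ^ (4 * r)" by (simp add: power_mult)
  interpret batched_system idx pu pkap pK bt pth loc b "2 ^ r"
  proof -
    interpret threshold_system idx pu pkap pK bt pth using bt by (rule threshold_system_program)
    show "batched_system idx pu pkap pK bt pth loc b (2 ^ r)"
      by unfold_locales (use loc loc_inj in \<open>auto simp: b_def\<close>)
  qed
  \<comment> \<open>Lets \<open>s\<close> be bounded by a multiple of \<open>r + 1\<close>, so that
    the dimension bound does not involve \<open>p\<close>.\<close>
  have p4r: "p \<le> 4 * r"
  proof -
    have "(2::nat) ^ p < 2 ^ (4 * r)" using pd r(1) unfolding r16 by linarith
    then show ?thesis by (simp add: power_strict_increasing_iff)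
  qed
  define s where "s = p + r + k + 2"
  define t where "t = 4 * r + k"
  define R where "R = s * 4 ^ (r + k)"
  define D where "D = (k + 19 + 64 * ((k + 4) * (k + 7)) * 4 ^ k) * d"
  have tR: "2 * t * R \<le> 64 * ((k + 4) * (k + 7)) * 4 ^ k * d"
  proof -
    have t: "t \<le> (k + 4) * (r + 1)" by (simp add: t_def algebra_simps)
    have "s \<le> 5 * r + k + 2" using p4r by (simp add: s_def)
    also have "\<dots> \<le> (k + 7) * (r + 1)" by (simp add: algebra_simps)
    finally have s: "s \<le> (k + 7) * (r + 1)" .
    \<comment> \<open>The score gap costs \<open>4 ^ r\<close> copies, and the logarithmic factors
      from \<open>t\<close> and \<open>s\<close> cost at most another \<open>4 ^ r\<close>. Height
      four leaves room for this product, \<open>16 ^ r\<close>.\<close>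
    have "(r + 1) * (r + 1) \<le> 2 ^ r * 2 ^ r" using Suc_le_two_power[of r] by (intro mult_le_mono) auto
    also have "\<dots> = 4 ^ r" by (simp flip: power_mult_distrib)
    finally have rr: "(r + 1) * (r + 1) \<le> 4 ^ r" .
    have "2 * t * R \<le> 2 * ((k + 4) * (r + 1)) * (((k + 7) * (r + 1)) * 4 ^ (r + k))"
      unfolding R_def using t s by (intro mult_le_mono) auto
    also have "\<dots> = 2 * ((k + 4) * (k + 7)) * 4 ^ k * ((r + 1) * (r + 1) * 4 ^ r)"
      by (simp only: power_add mult_ac)
    also have "\<dots> \<le> 2 * ((k + 4) * (k + 7)) * 4 ^ k * (4 ^ r * 4 ^ r)"
      using rr by (intro mult_le_mono) auto
    also have "(4::nat) ^ r * 4 ^ r = 16 ^ r" by (simp flip: power_mult_distrib)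
    also have "2 * ((k + 4) * (k + 7)) * 4 ^ k * 16 ^ r \<le> 2 * ((k + 4) * (k + 7)) * 4 ^ k * (32 * d)"
      using r(2) by (rule mult_le_mono2)
    moreover have "2 * a * e * (32 * d) = 64 * a * e * d" for a e :: nat by simp
    ultimately show ?thesis by (simp only:)
  qed
  have bK: "b * 2 ^ p \<le> 2 * d"
  proof -
    have "d div 2 ^ p * 2 ^ p \<le> d" by simp
    moreover have "b * 2 ^ p = d div 2 ^ p * 2 ^ p + 2 ^ p" by (simp add: b_def)
    ultimately show ?thesis using pd by linarith
  qed
  have "d < b * 2 ^ p"
    unfolding b_def using dividend_less_div_times[of "2 ^ p" d] by (simp add: algebra_simps)
  then have "n \<le> 2 * 2 ^ p * b" using n by (simp add: mult_ac)
  then have nb: "n div b \<le> 2 * 2 ^ p"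
  proof -
    have "b > 0" by (simp add: b_def)
    then show ?thesis using div_le_mono[OF \<open>n \<le> 2 * 2 ^ p * b\<close>, of b] by simp
  qed
  have bd: "b \<le> d + 1" using div_le_dividend[of d "2 ^ p"] by (simp add: b_def)
  have "\<exists>T :: 'a transformer. wf_transformer T \<and> tprec T = p + 4 \<and> tdim T = D \<and> tdepth_of T = N * (2 * 4 + 4) \<and>
    (\<forall>w i. i < length w \<longrightarrow>
      (toutput T (None # map Some w) (Suc i) > 0 \<longleftrightarrow> pout (w ! i) (below N (pth w i))))"
  proof (rule tree_transformer[where t = t and R = R and s = s and X = 4])
    show "1 \<le> s" "2 \<le> p + 4" "1 \<le> t" using k by (auto simp: s_def t_def)
    have "k * (2 * pK) \<le> 2 ^ k * (2 * 2 ^ p)" unfolding pK using k2 by (intro mult_le_mono) auto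
    also have "\<dots> = 2 ^ (p + k + 1)" by (simp add: power_add)
    finally have "k * (2 * pK) \<le> 2 ^ (p + k + 1)" .
    moreover have "(1::nat) \<le> 2 ^ (p + k + 1)" by simp
    ultimately have "Suc (k * (2 * pK)) \<le> 2 * 2 ^ (p + k + 1)" by linarith
    also have "\<dots> = 2 ^ (p + k + 2)" by simp
    also have "\<dots> \<le> 2 ^ s" by (intro power_increasing) (auto simp: s_def)
    finally show "Suc (card (UNIV :: 'a set) * (2 * pK)) \<le> 2 ^ s" by (simp add: k_def)
    have "Suc (2 ^ r) \<le> 2 ^ (r + 1)" by simp
    also have "(2::nat) ^ (r + 1) \<le> 2 ^ s" by (intro power_increasing) (auto simp: s_def)
    finally show "Suc (2 ^ r) \<le> 2 ^ s" .
    have "(2 ^ r) ^ 4 = (16::nat) ^ r" by (simp add: power_mult[symmetric] mult.commute r16)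
    then show "card idx < (2 ^ r) ^ 4" using n r(1) by (simp add: n_def)
    have "(1::nat) \<le> 2 ^ p" by simp
    then have "Suc (2 * pK) < 8 * 2 ^ p" unfolding pK by linarith
    then show "Suc (2 * pK) < 2 ^ (p + 4 - 1)" by (simp add: power_add mult.commute)
    have "(n + 1) * (k + 1) \<le> 2 ^ (4 * r) * 2 ^ k"
      using n r(1) k2 unfolding r16 by (intro mult_le_mono) auto
    then show "(card idx + 1) * (card (UNIV :: 'a set) + 1) \<le> 2 ^ t"
      by (simp add: t_def power_add n_def k_def)
    have "k + 2 * n + 1 + 2 * (b * (2 * pK)) + b * Suc (2 * pK) \<le> (k + 19) * d"
    proof -
      define x y where "x = k * d" and "y = b * (2 * pK)"
      have "k \<le> x" using d1 by (simp add: x_def)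
      moreover have "y \<le> 4 * d" using bK unfolding pK y_def by simp
      moreover have "b * Suc (2 * pK) = b + y" by (simp add: y_def)
      moreover have "(k + 19) * d = x + 19 * d" by (simp add: x_def add_mult_distrib)
      ultimately show ?thesis using n bd d1 unfolding y_def[symmetric] by simp
    qed
    also have "\<dots> \<le> D" unfolding D_def by (intro mult_le_mono1) simp
    finally show "card (UNIV :: 'a set) + 2 * card idx + 1 + 2 * (b * (2 * pK)) + b * Suc (2 * pK) \<le> D"
      by (simp only: n_def k_def)
    have "64 * ((k + 4) * (k + 7)) * 4 ^ k * d \<le> D" unfolding D_def by (intro mult_le_mono1) simp
    then show "2 * t * R \<le> D" using tR by linarith
    \<comment> \<open>Entries have size \<open>1 / 2 ^ (r + k)\<close>, so
      \<open>4 ^ (r + k)\<close> copies together yield one unit of score, and \<open>R\<close>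
      copies yield \<open>s\<close> units.\<close>
    have "(2::real) ^ s = 2 ^ (p + 2) * 2 ^ (r + k)" by (simp add: s_def power_add)
    then have "(2::real) ^ (p + 4 - 2) / 2 ^ s = 1 / 2 ^ (r + k)" by simp
    moreover have "((2::real) ^ (r + k))\<^sup>2 = 4 ^ (r + k)"
      by (simp add: power2_eq_square flip: power_mult_distrib)
    ultimately show "real s \<le> real R * (2 ^ (p + 4 - 2) / 2 ^ s)\<^sup>2"
      by (simp add: R_def power_divide)
  qed
  then obtain T :: "'a transformer" where T: "wf_transformer T" "tprec T = p + 4" "tdim T = D" "tdepth_of T = N * 12"
    "\<And>w i. i < length w \<Longrightarrow> (toutput T (None # map Some w) (Suc i) > 0 \<longleftrightarrow> pout (w ! i) (below N (pth w i)))"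
    by auto
  have "simulates T P"
    unfolding simulates_def
  proof (intro allI impI)
    fix w :: "'a list" and i assume i: "i < length w"
    have "pout (w ! i) (below N (pth w i)) = pout (w ! i) (pth w i)"
      using btN by (intro pout_cong) (auto simp: below_def)
    then show "toutput T (None # map Some w) (Suc i) > 0 \<longleftrightarrow> models P w i"
      using T(5)[OF i] by (simp add: models_pout)
  qed
  \<comment> \<open>A batch takes \<open>2 * 4 + 4\<close> layers, and \<open>N\<close> is at most
    three times \<open>pdepth P + 1\<close>, because \<open>2 ^ p\<close> is below that
    number.\<close>
  moreover have "N * 12 \<le> 36 * (pdepth P + 1)" using nb L by (simp add: N_def p_def)
  moreover have "p + 4 \<le> 4 * (p + 1)" by simp
  ultimately show ?thesis using T by (intro exI[of _ T]) (simp add: p_def D_def d_def)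
qed

end

theorem theoremC11:
  "\<exists>c::nat. \<forall>P :: ('a::finite) cform list. wf_prog P \<longrightarrow>
     (\<exists>T :: 'a transformer. wf_transformer T \<and> simulates T P \<and>
        tprec T \<le> c * (pprec P + 1) \<and>
        tdepth_of T \<le> c * (pdepth P + 1) \<and>
        tdim T \<le> c * psize P)"
proof -
  \<comment> \<open>All constants depend on the alphabet size only, so \<open>c\<close> is fixed
    before the program is given.\<close>
  define k where "k = card (UNIV :: 'a set)"
  define c where "c = 2 * (k * k + 3 * k + 3) + (3 * k + 12) + 36 +
    (k + 19 + 64 * ((k + 4) * (k + 7)) * 4 ^ k)"
  have le: "x \<le> c * y" if "x \<le> m * y" "m \<le> c" for x y m
    using that by (meson le_trans mult_le_mono1)
  have c: "2 * (k * k + 3 * k + 3) \<le> c" "2 \<le> c" "3 * k + 12 \<le> c" "4 \<le> c" "36 \<le> c"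
    "k + 19 + 64 * ((k + 4) * (k + 7)) * 4 ^ k \<le> c"
    by (simp_all add: c_def)
  show ?thesis
  proof (intro exI[of _ c] allI impI)
    fix P :: "'a cform list" assume "wf_prog P"
    then interpret program P by unfold_locales
    show "\<exists>T :: 'a transformer. wf_transformer T \<and> simulates T P \<and>
        tprec T \<le> c * (pprec P + 1) \<and> tdepth_of T \<le> c * (pdepth P + 1) \<and> tdim T \<le> c * psize P"
    proof (cases "pdepth P + 1 \<le> 2 ^ pprec P")
      case True
      obtain T :: "'a transformer" where "wf_transformer T" "simulates T P"
        "tprec T \<le> 2 * (k * k + 3 * k + 3) * (pprec P + 1)" "tdepth_of T \<le> 2 * (pdepth P + 1)"
        "tdim T \<le> (3 * k + 12) * psize P"
        using shallow_transformer[OF True] unfolding k_def by blast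
      then show ?thesis using c le by (intro exI[of _ T]) blast
    next
      case False
      then have "2 ^ pprec P < pdepth P + 1" by simp
      then obtain T :: "'a transformer" where "wf_transformer T" "simulates T P"
        "tprec T \<le> 4 * (pprec P + 1)" "tdepth_of T \<le> 36 * (pdepth P + 1)"
        "tdim T \<le> (k + 19 + 64 * ((k + 4) * (k + 7)) * 4 ^ k) * psize P"
        using deep_transformer unfolding k_def by blast
      then show ?thesis using c le by (intro exI[of _ T]) blast
    qed
  qed
qed

end
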